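(* Suppose $n>2$ and let $G$ be an $n$-dimensional Lie group with Lie algebra $\mathfrak g$ and Killing form $B_{\mathfrak g}\in S^2\mathfrak g^\ast$. Suppose $k\in S^2\mathfrak g^\ast$ is invariant and suppose there is $t\in\mathfrak g$ such that $k(t,t)\ne0$. Define $h\in S^2\mathfrak g^\ast$ by $h(r,s)=k(t,t)^{-1}k(r,s)$. Define $\Pi\in S^2\mathfrak g^\ast\otimes\mathfrak g$ by $$\begin{aligned}\Pi(r,s)&=-h(t,r)h(t,s)t+h(t,r)s+h(t,s)r+\tfrac12h(t,r)[t,s]+\tfrac12h(t,s)[t,r]\\&\quad+\tfrac1{4(n-2)}\big(B_{\mathfrak g}(r,s)+B_{\mathfrak g}(t,t)h(t,r)h(t,s)-B_{\mathfrak g}(t,r)h(t,s)-B_{\mathfrak g}(t,s)h(t,r)-2h([t,r],[t,s])\big)t.\end{aligned}$$ The left-invariant connection $\nabla$ on $G$ determined by $A(r,s)=\Pi(r,s)+\frac12[r,s]$ constitutes with the left-invariant vector field $E^t$ a left-invariant conelike radiant structure with antisymmetric Ricci tensor $$\mathrm{ric}(r,s)=\tfrac{2n+\ell(t)}4h(t,[r,s]),$$ and satisfying $\varrho=0$. Moreover: (1) For $g\in G$, let $t'=\mathrm{Ad}(g^{-1})t$. The left-invariant conelike radiant connection associated with $t'$, that is, the left-invariant connection determined by $A'(r,s)=\Pi'(r,s)+\frac12[r,s]$, where $$\begin{aligned}\Pi'(r,s)&=-h'(t',r)h'(t',s)t'+h'(t',r)s+h'(t',s)r+\tfrac12h'(t',r)[t',s]+\tfrac12h'(t',s)[t',r]\\&\quad+\tfrac1{4(n-2)}\big(B_{\mathfrak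 g}(r,s)+B_{\mathfrak g}(t',t')h'(t',r)h'(t',s)-B_{\mathfrak g}(t',r)h'(t',s)-B_{\mathfrak g}(t',s)h'(t',r)-2h'([t',r],[t',s])\big)t'\end{aligned}$$ and $h'(r,s)=k(t',t')^{-1}k(r,s)$, is $\mathrm{Ad}(g)^\ast(\nabla)$. In particular the stabilizer of $t$ in $\mathrm{Ad}(G)$ acts as automorphisms of $(\nabla,E^t)$. (2) $(\nabla,E^t)$ admits a complete set of planes. (3) If $\mathfrak g$ is semisimple, then $\nabla$ is not Ricci-flat. (4) A subgroup $H\subset G$ tangent to $t$ is $\nabla$-totally geodesic, and the connection induced on $H$ by $\nabla$ constitutes with the left-invariant vector field $E^t$ a left-invariant conelike radiant structure on $H$. (5) Suppose $H\subset G$ is an abelian subgroup tangent to $t$, having Lie algebra $\mathfrak h\subset\mathfrak g$, and such that $\dim H\ge3$. The left-invariant connection $\tilde\nabla$ on $H$ associated with the tensor $\tilde\Pi\in S^2\mathfrak h^\ast\otimes\mathfrak h$ defined by $$\tilde\Pi(a,b)=h(t,a)b+h(t,b)a-h(t,a)h(t,b)t$$ constitutes with $E^t$ a Ricci-flat left-invariant conelike radiant structure on $H$ having the same planelike surfaces as the connection induced on $H$ by $\nabla$.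
   Context: Lie groups and Lie algebras are real. For $r\in\mathfrak g$, $E^r$ is the left-invariant vector field generated by $r$. The left-invariant torsion-free connection determined by $\Pi\in S^2\mathfrak g^\ast\otimes\mathfrak g$ is given by $\nabla_{E^r}E^s=E^{A(r,s)}$ with $A(r,s)=\Pi(r,s)+\frac12[r,s]$. $k$ invariant means $k([a,r],s)+k(r,[a,s])=0$ for all $a,r,s\in\mathfrak g$. $\ell(a)=\mathrm{tr}\,\mathrm{ad}_{\mathfrak g}(a)$. The curvature is $R(X,Y)Z=\nabla_X\nabla_YZ-\nabla_Y\nabla_XZ-\nabla_{[X,Y]}Z$, the Ricci tensor is $\mathrm{Ric}(X,Y)=\mathrm{tr}(Z\mapsto R(Z,X)Y)$, $\mathrm{ric}(a,b)=\mathrm{Ric}(E^a,E^b)$, and $\varrho(a)=\mathrm{ric}(t,a)$. In (1), $\mathrm{Ad}(g)$ denotes both the inner automorphism $x\mapsto gxg^{-1}$ of $G$ (by which $\nabla$ is pulled back) and its action on $\mathfrak g$. A subgroup is tangent to $t$ if its Lie algebra contains $t$. A radiant structure $(\nabla,\mathbb E)$ is a torsion-free affine connection and vector field with $\nabla_X\mathbb E=X$ for all $X$; it is left-invariant if both are. An immersed surface is planelike if it is totally geodesic and everywhere tangent to $\mathbb E$; a planelike surface is a plane if the connection induced on it is flat. The structure is conelike (resp. admits a complete set of planes) if for every point $p$ and every two-dimensional subspace $L$ of the tangent space at $p$ containing $\mathbb E_p$ there is a smoothly immersed planelike surface (resp. plane) through $p$ tangent to $L$ at $p$.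
   Formalization: Item (1), including the statement on the stabilizer of t, is proved for those g in G that lie in the identity component or whose Ad(g) preserves k; for disconnected G and merely ad-invariant k it is false as stated. *)

theory Defs
  imports "HOL-Analysis.Analysis" "HOL-Algebra.Group"
begin

section \<open>Smooth manifolds\<close>

primrec Ck_on :: "nat \<Rightarrow> ('e::real_normed_vector \<Rightarrow> 'f::real_normed_vector) \<Rightarrow> 'e set \<Rightarrow> bool" where
  "Ck_on 0 f S \<longleftrightarrow> continuous_on S f"
| "Ck_on (Suc k) f S \<longleftrightarrow>
     (\<forall>x\<in>S. f differentiable at x) \<and> (\<forall>v. Ck_on k (\<lambda>x. frechet_derivative f (at x) v) S)"

text \<open>Only used for open \<open>S\<close>.\<close>
definition smooth_on :: "'e::real_normed_vector set \<Rightarrow> ('e \<Rightarrow> 'f::real_normed_vector) \<Rightarrow> bool" where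
  "smooth_on S f \<longleftrightarrow> (\<forall>k. Ck_on k f S)"

text \<open>A manifold is given by an atlas of charts, a chart being a pair of its domain and its
  coordinate map into the model space \<open>'e\<close>, a Euclidean space; so the dimension is
  \<open>DIM('e)\<close>. The point set and the topology are those determined by the atlas. They are unrelated
  to any topology on the type \<open>'a\<close>, so that a Lie subgroup can carry a topology finer than the
  subspace topology.\<close>

type_synonym ('a, 'e) chart = "'a set \<times> ('a \<Rightarrow> 'e)"
type_synonym ('a, 'e) atlas = "('a, 'e) chart set"

definition chart_inv :: "('a, 'e) chart \<Rightarrow> 'e \<Rightarrow> 'a" where
  "chart_inv c = inv_into (fst c) (snd c)"

definition points :: "('a, 'e) atlas \<Rightarrow> 'a set" where
  "points M = (\<Union>c\<in>M. fst c)"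

definition smooth_atlas :: "('a, 'e::euclidean_space) atlas \<Rightarrow> bool" where
  "smooth_atlas M \<longleftrightarrow>
     (\<forall>c\<in>M. inj_on (snd c) (fst c) \<and> open (snd c ` fst c)) \<and>
     (\<forall>c\<in>M. \<forall>d\<in>M. open (snd c ` (fst c \<inter> fst d)) \<and>
        smooth_on (snd c ` (fst c \<inter> fst d)) (snd d \<circ> chart_inv c))"

definition mtop :: "('a, 'e::euclidean_space) atlas \<Rightarrow> 'a topology" where
  "mtop M = topology (\<lambda>W. W \<subseteq> points M \<and> (\<forall>c\<in>M. open (snd c ` (fst c \<inter> W))))"

lemma openin_mtop:
  assumes "smooth_atlas M"
  shows "openin (mtop M) W \<longleftrightarrow> W \<subseteq> points M \<and> (\<forall>c\<in>M. open (snd c ` (fst c \<inter> W)))"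
proof -
  have "istopology (\<lambda>W. W \<subseteq> points M \<and> (\<forall>c\<in>M. open (snd c ` (fst c \<inter> W))))"
    unfolding istopology_def
  proof (intro conjI allI impI; (elim conjE)?)
    fix S T assume S: "S \<subseteq> points M" "\<forall>c\<in>M. open (snd c ` (fst c \<inter> S))"
      and T: "T \<subseteq> points M" "\<forall>c\<in>M. open (snd c ` (fst c \<inter> T))"
    show "S \<inter> T \<subseteq> points M" using S by blast
    show "\<forall>c\<in>M. open (snd c ` (fst c \<inter> (S \<inter> T)))"
    proof
      fix c assume c: "c \<in> M"
      have "inj_on (snd c) (fst c)" using assms c by (auto simp: smooth_atlas_def)
      then have "snd c ` (fst c \<inter> (S \<inter> T)) = snd c ` (fst c \<inter> S) \<inter> snd c ` (fst c \<inter> T)"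
        by (auto simp: inj_on_def)
      then show "open (snd c ` (fst c \<inter> (S \<inter> T)))" using S T c by auto
    qed
  next
    fix K assume K: "\<forall>S\<in>K. S \<subseteq> points M \<and> (\<forall>c\<in>M. open (snd c ` (fst c \<inter> S)))"
    show "\<Union>K \<subseteq> points M" using K by blast
    show "\<forall>c\<in>M. open (snd c ` (fst c \<inter> \<Union>K))"
    proof
      fix c assume c: "c \<in> M"
      have "snd c ` (fst c \<inter> \<Union>K) = (\<Union>S\<in>K. snd c ` (fst c \<inter> S))" by blast
      then show "open (snd c ` (fst c \<inter> \<Union>K))" using K c by auto
    qed
  qed
  then show ?thesis by (simp add: mtop_def)
qed

definition manifold :: "('a, 'e::euclidean_space) atlas \<Rightarrow> bool" where
  "manifold M \<longleftrightarrow> smooth_atlas M \<and> Hausdorff_space (mtop M) \<and> second_countable (mtop M)"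

definition prod_atlas :: "('a, 'e) atlas \<Rightarrow> ('b, 'f) atlas \<Rightarrow> ('a \<times> 'b, 'e \<times> 'f) atlas" where
  "prod_atlas M N = {(fst c \<times> fst d, map_prod (snd c) (snd d)) | c d. c \<in> M \<and> d \<in> N}"

definition smooth_map ::
  "('a, 'e::euclidean_space) atlas \<Rightarrow> ('b, 'f::euclidean_space) atlas \<Rightarrow> ('a \<Rightarrow> 'b) \<Rightarrow> bool" where
  "smooth_map M N f \<longleftrightarrow> f ` points M \<subseteq> points N \<and>
     (\<forall>c\<in>M. \<forall>d\<in>N. open (snd c ` (fst c \<inter> f -` fst d)) \<and>
        smooth_on (snd c ` (fst c \<inter> f -` fst d)) (snd d \<circ> f \<circ> chart_inv c))"

definition diffeomorphism :: "('a, 'e::euclidean_space) atlas \<Rightarrow> ('a \<Rightarrow> 'a) \<Rightarrow> bool" where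
  "diffeomorphism M \<phi> \<longleftrightarrow> bij_betw \<phi> (points M) (points M) \<and>
     smooth_map M M \<phi> \<and> smooth_map M M (inv_into (points M) \<phi>)"

section \<open>Tangent vectors and vector fields\<close>

text \<open>Each point has a preferred chart, through which the tangent space at that point is identified
  with the whole model space \<open>'e\<close>. Every notion below is independent of the choice.\<close>

definition chart_at :: "('a, 'e) atlas \<Rightarrow> 'a \<Rightarrow> ('a, 'e) chart" where
  "chart_at M p = (SOME c. c \<in> M \<and> p \<in> fst c)"

definition tmap ::
  "('a, 'e::euclidean_space) atlas \<Rightarrow> ('b, 'f::euclidean_space) atlas \<Rightarrow> ('a \<Rightarrow> 'b) \<Rightarrow> 'a \<Rightarrow> 'e \<Rightarrow> 'f" where
  "tmap M N f p v = frechet_derivative (snd (chart_at N (f p)) \<circ> f \<circ> chart_inv (chart_at M p))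
     (at (snd (chart_at M p) p)) v"

definition dfun ::
  "('a, 'e::euclidean_space) atlas \<Rightarrow> ('a \<Rightarrow> 'f::euclidean_space) \<Rightarrow> 'a \<Rightarrow> 'e \<Rightarrow> 'f" where
  "dfun M f p v = frechet_derivative (f \<circ> chart_inv (chart_at M p)) (at (snd (chart_at M p) p)) v"

text \<open>Components in the chart \<open>c\<close> of the tangent vector \<open>v\<close> at \<open>p\<close>, and the vector field with constant
  components \<open>v\<close> in \<open>c\<close>.\<close>

definition component :: "('a, 'e::euclidean_space) atlas \<Rightarrow> ('a, 'e) chart \<Rightarrow> 'a \<Rightarrow> 'e \<Rightarrow> 'e" where
  "component M c p v = dfun M (snd c) p v"

definition coord_field :: "('a, 'e::euclidean_space) atlas \<Rightarrow> ('a, 'e) chart \<Rightarrow> 'e \<Rightarrow> 'a \<Rightarrow> 'e" where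
  "coord_field M c v p = frechet_derivative (snd (chart_at M p) \<circ> chart_inv c) (at (snd c p)) v"

definition local_rep ::
  "('a, 'e::euclidean_space) atlas \<Rightarrow> ('a, 'e) chart \<Rightarrow> ('a \<Rightarrow> 'e) \<Rightarrow> 'e \<Rightarrow> 'e" where
  "local_rep M c X x = component M c (chart_inv c x) (X (chart_inv c x))"

text \<open>Functions and vector fields are smooth on an open set \<open>W\<close>; their values elsewhere are junk.\<close>

definition smooth_fun_on :: "('a, 'e::euclidean_space) atlas \<Rightarrow> 'a set \<Rightarrow> ('a \<Rightarrow> real) \<Rightarrow> bool" where
  "smooth_fun_on M W f \<longleftrightarrow> openin (mtop M) W \<and>
     (\<forall>c\<in>M. smooth_on (snd c ` (fst c \<inter> W)) (f \<circ> chart_inv c))"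

definition vector_field_on :: "('a, 'e::euclidean_space) atlas \<Rightarrow> 'a set \<Rightarrow> ('a \<Rightarrow> 'e) \<Rightarrow> bool" where
  "vector_field_on M W X \<longleftrightarrow> openin (mtop M) W \<and>
     (\<forall>c\<in>M. smooth_on (snd c ` (fst c \<inter> W)) (local_rep M c X))"

text \<open>\<open>[X,Y] = DY(X) - DX(Y)\<close> in the preferred chart at \<open>p\<close>.\<close>
definition lie_bracket ::
  "('a, 'e::euclidean_space) atlas \<Rightarrow> ('a \<Rightarrow> 'e) \<Rightarrow> ('a \<Rightarrow> 'e) \<Rightarrow> 'a \<Rightarrow> 'e" where
  "lie_bracket M X Y p = (let c = chart_at M p; x = snd c p in
     frechet_derivative (local_rep M c Y) (at x) (X p) -
     frechet_derivative (local_rep M c X) (at x) (Y p))"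

definition push :: "('a, 'e::euclidean_space) atlas \<Rightarrow> ('a \<Rightarrow> 'a) \<Rightarrow> ('a \<Rightarrow> 'e) \<Rightarrow> 'a \<Rightarrow> 'e" where
  "push M \<phi> X q = (let p = inv_into (points M) \<phi> q in tmap M M \<phi> p (X p))"

section \<open>Affine connections\<close>

text \<open>\<open>D p v Y\<close> is the covariant derivative of the vector field \<open>Y\<close>, defined near \<open>p\<close>, in the direction
  of the tangent vector \<open>v\<close> at \<open>p\<close>. Locality is implied by the Leibniz rule, as the function in it may
  be the indicator function of \<open>W\<close>.\<close>

type_synonym ('a, 'e) conn = "'a \<Rightarrow> 'e \<Rightarrow> ('a \<Rightarrow> 'e) \<Rightarrow> 'e"

definition affine_connection :: "('a, 'e::euclidean_space) atlas \<Rightarrow> ('a, 'e) conn \<Rightarrow> bool" where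
  "affine_connection M D \<longleftrightarrow>
     (\<forall>W Y. vector_field_on M W Y \<longrightarrow>
        (\<forall>p\<in>W. linear (\<lambda>v. D p v Y)) \<and>
        (\<forall>Z. vector_field_on M W Z \<longrightarrow>
           (\<forall>p\<in>W. \<forall>v. D p v (\<lambda>q. Y q + Z q) = D p v Y + D p v Z)) \<and>
        (\<forall>f. smooth_fun_on M W f \<longrightarrow>
           (\<forall>p\<in>W. \<forall>v. D p v (\<lambda>q. f q *\<^sub>R Y q) = dfun M f p v *\<^sub>R Y p + f p *\<^sub>R D p v Y)) \<and>
        (\<forall>X. vector_field_on M W X \<longrightarrow> vector_field_on M W (\<lambda>p. D p (X p) Y)))"

definition conn_eq :: "('a, 'e::euclidean_space) atlas \<Rightarrow> ('a, 'e) conn \<Rightarrow> ('a, 'e) conn \<Rightarrow> bool" where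
  "conn_eq M D D' \<longleftrightarrow> (\<forall>W Y. vector_field_on M W Y \<longrightarrow> (\<forall>p\<in>W. \<forall>v. D p v Y = D' p v Y))"

definition torsion_free :: "('a, 'e::euclidean_space) atlas \<Rightarrow> ('a, 'e) conn \<Rightarrow> bool" where
  "torsion_free M D \<longleftrightarrow>
     (\<forall>W X Y. vector_field_on M W X \<and> vector_field_on M W Y \<longrightarrow>
        (\<forall>p\<in>W. D p (X p) Y - D p (Y p) X = lie_bracket M X Y p))"

definition curvature ::
  "('a, 'e::euclidean_space) atlas \<Rightarrow> ('a, 'e) conn \<Rightarrow> ('a \<Rightarrow> 'e) \<Rightarrow> ('a \<Rightarrow> 'e) \<Rightarrow> ('a \<Rightarrow> 'e) \<Rightarrow> 'a \<Rightarrow> 'e" where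
  "curvature M D X Y Z p =
     D p (X p) (\<lambda>q. D q (Y q) Z) - D p (Y p) (\<lambda>q. D q (X q) Z) - D p (lie_bracket M X Y p) Z"

definition flat :: "('a, 'e::euclidean_space) atlas \<Rightarrow> ('a, 'e) conn \<Rightarrow> bool" where
  "flat M D \<longleftrightarrow>
     (\<forall>W X Y Z. vector_field_on M W X \<and> vector_field_on M W Y \<and> vector_field_on M W Z \<longrightarrow>
        (\<forall>p\<in>W. curvature M D X Y Z p = 0))"

definition tr :: "('e::euclidean_space \<Rightarrow> 'e) \<Rightarrow> real" where
  "tr f = (\<Sum>b\<in>Basis. f b \<bullet> b)"

text \<open>\<open>Ric(u,v) = tr (z \<mapsto> R(z,u)v)\<close> for tangent vectors at \<open>p\<close>, which are extended to coordinate fields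
  to evaluate the tensor \<open>R\<close>.\<close>
definition Ricci ::
  "('a, 'e::euclidean_space) atlas \<Rightarrow> ('a, 'e) conn \<Rightarrow> 'a \<Rightarrow> 'e \<Rightarrow> 'e \<Rightarrow> real" where
  "Ricci M D p u v = (let X = coord_field M (chart_at M p) in
     tr (\<lambda>z. curvature M D (X z) (X u) (X v) p))"

definition Ricci_flat :: "('a, 'e::euclidean_space) atlas \<Rightarrow> ('a, 'e) conn \<Rightarrow> bool" where
  "Ricci_flat M D \<longleftrightarrow> (\<forall>p\<in>points M. \<forall>u v. Ricci M D p u v = 0)"

text \<open>\<open>\<phi>\<^sup>*D\<close>, for a diffeomorphism \<open>\<phi>\<close>: \<open>(\<phi>\<^sup>*D)\<^sub>v Y = d\<phi>\<^sup>-\<^sup>1 (D\<^bsub>d\<phi>(v)\<^esub> \<phi>\<^sub>*Y)\<close>.\<close>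
definition pullback_conn ::
  "('a, 'e::euclidean_space) atlas \<Rightarrow> ('a \<Rightarrow> 'a) \<Rightarrow> ('a, 'e) conn \<Rightarrow> ('a, 'e) conn" where
  "pullback_conn M \<phi> D p v Y =
     tmap M M (inv_into (points M) \<phi>) (\<phi> p) (D (\<phi> p) (tmap M M \<phi> p v) (push M \<phi> Y))"

definition automorphism ::
  "('a, 'e::euclidean_space) atlas \<Rightarrow> ('a, 'e) conn \<Rightarrow> ('a \<Rightarrow> 'e) \<Rightarrow> ('a \<Rightarrow> 'a) \<Rightarrow> bool" where
  "automorphism M D E \<phi> \<longleftrightarrow> diffeomorphism M \<phi> \<and> conn_eq M (pullback_conn M \<phi> D) D \<and>
     (\<forall>p\<in>points M. push M \<phi> E p = E p)"

section \<open>Immersed submanifolds\<close>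

definition immersion ::
  "('s, 'f::euclidean_space) atlas \<Rightarrow> ('a, 'e::euclidean_space) atlas \<Rightarrow> ('s \<Rightarrow> 'a) \<Rightarrow> bool" where
  "immersion S M f \<longleftrightarrow> smooth_map S M f \<and> (\<forall>s\<in>points S. inj (tmap S M f s))"

text \<open>Covariant derivative along \<open>f : S \<rightarrow> M\<close> of a section \<open>V\<close> of the pullback by \<open>f\<close> of the tangent
  bundle. Writing \<open>V = \<Sum>\<^sub>i w\<^sup>i \<partial>\<^sub>i\<close> in the preferred chart at \<open>f s\<close>, this is
  \<open>\<Sum>\<^sub>i (dw\<^sup>i(v) \<partial>\<^sub>i + w\<^sup>i D\<^bsub>df(v)\<^esub> \<partial>\<^sub>i)\<close>; the second part is the derivative of the
  field with constant components \<open>w(s) = V s\<close>.\<close>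
definition cov_along ::
  "('s, 'f::euclidean_space) atlas \<Rightarrow> ('a, 'e::euclidean_space) atlas \<Rightarrow> ('a, 'e) conn \<Rightarrow>
   ('s \<Rightarrow> 'a) \<Rightarrow> 's \<Rightarrow> 'f \<Rightarrow> ('s \<Rightarrow> 'e) \<Rightarrow> 'e" where
  "cov_along S M D f s v V = (let c = chart_at M (f s) in
     dfun S (\<lambda>\<sigma>. component M c (f \<sigma>) (V \<sigma>)) s v +
     D (f s) (tmap S M f s v) (coord_field M c (V s)))"

definition totally_geodesic ::
  "('s, 'f::euclidean_space) atlas \<Rightarrow> ('a, 'e::euclidean_space) atlas \<Rightarrow> ('a, 'e) conn \<Rightarrow>
   ('s \<Rightarrow> 'a) \<Rightarrow> bool" where
  "totally_geodesic S M D f \<longleftrightarrow>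
     (\<forall>W Y. vector_field_on S W Y \<longrightarrow>
        (\<forall>s\<in>W. \<forall>v. cov_along S M D f s v (\<lambda>\<sigma>. tmap S M f \<sigma> (Y \<sigma>)) \<in> range (tmap S M f s)))"

definition induced_conn ::
  "('s, 'f::euclidean_space) atlas \<Rightarrow> ('a, 'e::euclidean_space) atlas \<Rightarrow> ('a, 'e) conn \<Rightarrow>
   ('s \<Rightarrow> 'a) \<Rightarrow> ('s, 'f) conn" where
  "induced_conn S M D f s v Y =
     (THE u. tmap S M f s u = cov_along S M D f s v (\<lambda>\<sigma>. tmap S M f \<sigma> (Y \<sigma>)))"

section \<open>Radiant structures\<close>

definition radiant_structure ::
  "('a, 'e::euclidean_space) atlas \<Rightarrow> ('a, 'e) conn \<Rightarrow> ('a \<Rightarrow> 'e) \<Rightarrow> bool" where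
  "radiant_structure M D E \<longleftrightarrow> affine_connection M D \<and> torsion_free M D \<and>
     vector_field_on M (points M) E \<and> (\<forall>p\<in>points M. \<forall>v. D p v E = v)"

text \<open>The type of the points of a surface is immaterial: a second countable 2-manifold has at most
  continuum many points, so it is diffeomorphic to one whose points are elements of the type
  \<open>real \<times> real\<close>, with a topology that need not be that of the plane.\<close>

type_synonym surface = "(real \<times> real, real \<times> real) atlas"

definition planelike_surface ::
  "('a, 'e::euclidean_space) atlas \<Rightarrow> ('a, 'e) conn \<Rightarrow> ('a \<Rightarrow> 'e) \<Rightarrow>
   surface \<Rightarrow> (real \<times> real \<Rightarrow> 'a) \<Rightarrow> bool" where
  "planelike_surface M D E S f \<longleftrightarrow> manifold S \<and> immersion S M f \<and> totally_geodesic S M D f \<and>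
     (\<forall>s\<in>points S. E (f s) \<in> range (tmap S M f s))"

definition plane ::
  "('a, 'e::euclidean_space) atlas \<Rightarrow> ('a, 'e) conn \<Rightarrow> ('a \<Rightarrow> 'e) \<Rightarrow>
   surface \<Rightarrow> (real \<times> real \<Rightarrow> 'a) \<Rightarrow> bool" where
  "plane M D E S f \<longleftrightarrow> planelike_surface M D E S f \<and> flat S (induced_conn S M D f)"

definition conelike ::
  "('a, 'e::euclidean_space) atlas \<Rightarrow> ('a, 'e) conn \<Rightarrow> ('a \<Rightarrow> 'e) \<Rightarrow> bool" where
  "conelike M D E \<longleftrightarrow>
     (\<forall>p\<in>points M. \<forall>L. subspace L \<and> dim L = 2 \<and> E p \<in> L \<longrightarrow>
        (\<exists>S f. planelike_surface M D E S f \<and> (\<exists>s\<in>points S. f s = p \<and> range (tmap S M f s) = L)))"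

definition complete_set_of_planes ::
  "('a, 'e::euclidean_space) atlas \<Rightarrow> ('a, 'e) conn \<Rightarrow> ('a \<Rightarrow> 'e) \<Rightarrow> bool" where
  "complete_set_of_planes M D E \<longleftrightarrow>
     (\<forall>p\<in>points M. \<forall>L. subspace L \<and> dim L = 2 \<and> E p \<in> L \<longrightarrow>
        (\<exists>S f. plane M D E S f \<and> (\<exists>s\<in>points S. f s = p \<and> range (tmap S M f s) = L)))"

section \<open>Lie groups and their Lie algebras\<close>

definition Lie_group :: "'a monoid \<Rightarrow> ('a, 'e::euclidean_space) atlas \<Rightarrow> bool" where
  "Lie_group G M \<longleftrightarrow> group G \<and> manifold M \<and> points M = carrier G \<and>
     smooth_map (prod_atlas M M) M (\<lambda>(x, y). x \<otimes>\<^bsub>G\<^esub> y) \<and> smooth_map M M (\<lambda>x. inv\<^bsub>G\<^esub> x)"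

definition ltrans :: "'a monoid \<Rightarrow> 'a \<Rightarrow> 'a \<Rightarrow> 'a" where
  "ltrans G g x = g \<otimes>\<^bsub>G\<^esub> x"

definition conj_by :: "'a monoid \<Rightarrow> 'a \<Rightarrow> 'a \<Rightarrow> 'a" where
  "conj_by G g x = g \<otimes>\<^bsub>G\<^esub> x \<otimes>\<^bsub>G\<^esub> inv\<^bsub>G\<^esub> g"

text \<open>The Lie algebra is the tangent space at the identity, that is, the type \<open>'e\<close>;
  \<open>linv_field G M r\<close> is \<open>E\<^sup>r\<close>.\<close>

definition linv_field :: "'a monoid \<Rightarrow> ('a, 'e::euclidean_space) atlas \<Rightarrow> 'e \<Rightarrow> 'a \<Rightarrow> 'e" where
  "linv_field G M r p = tmap M M (ltrans G p) \<one>\<^bsub>G\<^esub> r"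

definition br :: "'a monoid \<Rightarrow> ('a, 'e::euclidean_space) atlas \<Rightarrow> 'e \<Rightarrow> 'e \<Rightarrow> 'e" where
  "br G M r s = lie_bracket M (linv_field G M r) (linv_field G M s) \<one>\<^bsub>G\<^esub>"

definition Ad :: "'a monoid \<Rightarrow> ('a, 'e::euclidean_space) atlas \<Rightarrow> 'a \<Rightarrow> 'e \<Rightarrow> 'e" where
  "Ad G M g = tmap M M (conj_by G g) \<one>\<^bsub>G\<^esub>"

definition ell :: "'a monoid \<Rightarrow> ('a, 'e::euclidean_space) atlas \<Rightarrow> 'e \<Rightarrow> real" where
  "ell G M a = tr (br G M a)"

definition Killing :: "'a monoid \<Rightarrow> ('a, 'e::euclidean_space) atlas \<Rightarrow> 'e \<Rightarrow> 'e \<Rightarrow> real" where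
  "Killing G M r s = tr (\<lambda>x. br G M r (br G M s x))"

definition symmetric_form :: "('e::euclidean_space \<Rightarrow> 'e \<Rightarrow> real) \<Rightarrow> bool" where
  "symmetric_form k \<longleftrightarrow> bilinear k \<and> (\<forall>r s. k r s = k s r)"

definition invariant_form ::
  "'a monoid \<Rightarrow> ('a, 'e::euclidean_space) atlas \<Rightarrow> ('e \<Rightarrow> 'e \<Rightarrow> real) \<Rightarrow> bool" where
  "invariant_form G M k \<longleftrightarrow> (\<forall>a r s. k (br G M a r) s + k r (br G M a s) = 0)"

definition simple_ideal :: "('e::euclidean_space \<Rightarrow> 'e \<Rightarrow> 'e) \<Rightarrow> 'e set \<Rightarrow> bool" where
  "simple_ideal b J \<longleftrightarrow> subspace J \<and> (\<forall>x. \<forall>y\<in>J. b x y \<in> J) \<and> (\<exists>x\<in>J. \<exists>y\<in>J. b x y \<noteq> 0) \<and>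
     (\<forall>I. subspace I \<and> I \<subseteq> J \<and> (\<forall>x\<in>J. \<forall>y\<in>I. b x y \<in> I) \<longrightarrow> I = {0} \<or> I = J)"

text \<open>A Lie algebra is semisimple if it is the direct sum of ideals that are simple Lie algebras.\<close>
definition semisimple :: "('e::euclidean_space \<Rightarrow> 'e \<Rightarrow> 'e) \<Rightarrow> bool" where
  "semisimple b \<longleftrightarrow>
     (\<exists>\<J>. finite \<J> \<and> (\<forall>J\<in>\<J>. simple_ideal b J \<and> J \<inter> span (\<Union>(\<J> - {J})) = {0}) \<and>
        span (\<Union>\<J>) = UNIV)"

section \<open>Left-invariant structures\<close>

definition left_invariant_field ::
  "'a monoid \<Rightarrow> ('a, 'e::euclidean_space) atlas \<Rightarrow> ('a \<Rightarrow> 'e) \<Rightarrow> bool" where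
  "left_invariant_field G M X \<longleftrightarrow>
     (\<forall>g\<in>carrier G. \<forall>p\<in>carrier G. push M (ltrans G g) X p = X p)"

definition left_invariant_conn ::
  "'a monoid \<Rightarrow> ('a, 'e::euclidean_space) atlas \<Rightarrow> ('a, 'e) conn \<Rightarrow> bool" where
  "left_invariant_conn G M D \<longleftrightarrow>
     (\<forall>g\<in>carrier G. conn_eq M (pullback_conn M (ltrans G g) D) D)"

definition left_invariant_radiant_structure ::
  "'a monoid \<Rightarrow> ('a, 'e::euclidean_space) atlas \<Rightarrow> ('a, 'e) conn \<Rightarrow> ('a \<Rightarrow> 'e) \<Rightarrow> bool" where
  "left_invariant_radiant_structure G M D E \<longleftrightarrow>
     radiant_structure M D E \<and> left_invariant_conn G M D \<and> left_invariant_field G M E"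

text \<open>\<open>D\<close> is the left-invariant connection determined by \<open>A(r,s) = P(r,s) + 1/2 [r,s]\<close>.\<close>
definition determined_by ::
  "'a monoid \<Rightarrow> ('a, 'e::euclidean_space) atlas \<Rightarrow> ('e \<Rightarrow> 'e \<Rightarrow> 'e) \<Rightarrow> ('a, 'e) conn \<Rightarrow> bool" where
  "determined_by G M P D \<longleftrightarrow> affine_connection M D \<and> left_invariant_conn G M D \<and>
     (\<forall>p\<in>carrier G. \<forall>r s. D p (linv_field G M r p) (linv_field G M s) =
        linv_field G M (P r s + (1/2) *\<^sub>R br G M r s) p)"

definition normalized :: "('e \<Rightarrow> 'e \<Rightarrow> real) \<Rightarrow> 'e \<Rightarrow> 'e \<Rightarrow> 'e \<Rightarrow> real" where
  "normalized k t r s = inverse (k t t) * k r s"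

definition Pi_tensor ::
  "'a monoid \<Rightarrow> ('a, 'e::euclidean_space) atlas \<Rightarrow> ('e \<Rightarrow> 'e \<Rightarrow> real) \<Rightarrow> 'e \<Rightarrow> 'e \<Rightarrow> 'e \<Rightarrow> 'e" where
  "Pi_tensor G M k t r s =
     (let h = normalized k t; B = Killing G M; ad_t = br G M t; n = real DIM('e) in
       - (h t r * h t s) *\<^sub>R t + h t r *\<^sub>R s + h t s *\<^sub>R r
       + (1/2 * h t r) *\<^sub>R ad_t s + (1/2 * h t s) *\<^sub>R ad_t r
       + (1 / (4 * (n - 2)) *
           (B r s + B t t * h t r * h t s - B t r * h t s - B t s * h t r
            - 2 * h (ad_t r) (ad_t s))) *\<^sub>R t)"

section \<open>Lie subgroups\<close>

text \<open>Lie subgroups are immersed, not necessarily closed; \<open>N\<close> is the atlas of \<open>H\<close>. The Lie algebra of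
  \<open>H\<close> is identified with a subspace of that of \<open>G\<close> by the differential of the inclusion.\<close>
definition Lie_subgroup ::
  "'a monoid \<Rightarrow> ('a, 'e::euclidean_space) atlas \<Rightarrow> 'a set \<Rightarrow> ('a, 'f::euclidean_space) atlas \<Rightarrow> bool" where
  "Lie_subgroup G M H N \<longleftrightarrow> subgroup H G \<and> Lie_group (G\<lparr>carrier := H\<rparr>) N \<and> immersion N M (\<lambda>x. x)"

definition incl ::
  "'a monoid \<Rightarrow> ('a, 'e::euclidean_space) atlas \<Rightarrow> ('a, 'f::euclidean_space) atlas \<Rightarrow> 'f \<Rightarrow> 'e" where
  "incl G M N = tmap N M (\<lambda>x. x) \<one>\<^bsub>G\<^esub>"

text \<open>The tensor on the Lie algebra \<open>'f\<close> of a subgroup with \<open>\<iota>\<close> the inclusion of that Lie algebra;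
  \<open>\<tau>\<close> is the element of \<open>'f\<close> corresponding to \<open>t\<close>.\<close>
definition Pi_abelian ::
  "('e::euclidean_space \<Rightarrow> 'e \<Rightarrow> real) \<Rightarrow> ('f::euclidean_space \<Rightarrow> 'e) \<Rightarrow> 'f \<Rightarrow> 'f \<Rightarrow> 'f \<Rightarrow> 'f" where
  "Pi_abelian k \<iota> \<tau> a b =
     (let h = (\<lambda>x y. normalized k (\<iota> \<tau>) (\<iota> x) (\<iota> y)) in
       h \<tau> a *\<^sub>R b + h \<tau> b *\<^sub>R a - (h \<tau> a * h \<tau> b) *\<^sub>R \<tau>)"

end

theory Submission
  imports Defs
begin

text \<open>In the left-invariant trivialization \<open>\<theta>\<close> of the tangent bundle a left-invariant connection is
  \<open>\<theta>(\<nabla>\<^sub>X Y) = d(\<theta> Y)(X) + A(\<theta> X, \<theta> Y)\<close>, so torsion, curvature and the Ricci tensor become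
  algebraic in \<open>A\<close> and the bracket. In the trace defining the Ricci tensor the term \<open>(n - 2) q(r, s)\<close>
  coming from the last summand \<open>q(r, s) t\<close> of \<open>\<Pi>\<close> cancels the symmetric part of everything else. A
  semisimple algebra is perfect and unimodular, so there \<open>ric = 0\<close> would force \<open>h(t, -) = 0\<close>.

  The planes are \<open>(u, w) \<mapsto> p exp(w r) exp(u t)\<close> with \<open>h(t, r) = 0\<close>. In the trivialization their
  tangent planes are spanned by \<open>t\<close> and \<open>r\<^sub>u = Ad(exp(- u t)) r\<close>; invariance of \<open>h\<close> and of the
  Killing form keeps \<open>h(t, r\<^sub>u) = 0\<close> and \<open>q(r\<^sub>u, r\<^sub>u)\<close> constant, whence total geodesy and
  flatness. A subalgebra containing \<open>t\<close> is closed under \<open>A\<close>, which on it has the same form, so that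
  the argument applies to subgroups; on an abelian one the two connections differ by a multiple of
  \<open>t\<close>, which is tangent to every planelike surface.\<close>

section \<open>Calculus of smooth functions\<close>

text \<open>The formula for \<open>q\<close> contains the Killing form and the dimension of the
  whole group, so its restriction to a subgroup is not the tensor that the same formula yields
  there. Radiance and the planes are therefore derived from properties of \<open>l = h(t, -)\<close>
  and \<open>q\<close> that do restrict, collected in \<open>radiant_data\<close>. They yield
  \<open>A(r, t) = r\<close>, which is radiance, \<open>A(t, r) = r + [t, r]\<close>, and
  \<open>A(r, r) = q(r, r) t\<close> when \<open>l(r) = 0\<close>; the excess \<open>[t, r]\<close>
  is what the motion of the second frame vector of a plane has to absorb. Invariance of
  \<open>k\<close> under brackets integrates to invariance under \<open>Ad(g)\<close> along the
  identity component; on other components it is a separate condition on \<open>g\<close>, which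
  accounts for the two alternatives in the statement on pullbacks. The facts about the group come
  from two properties of the multiplication read in charts, the product rule and the symmetry of
  mixed second derivatives. The latter makes left- and right-invariant fields commute; bilinearity
  of the bracket and the Jacobi identity are then read off from the differential of
  \<open>Ad\<close>.\<close>

lemma Ck_on_cong:
  assumes "open S" and "\<And>x. x \<in> S \<Longrightarrow> f x = g x" and "Ck_on k f S"
  shows "Ck_on k g S"
  using assms(2,3)
proof (induction k arbitrary: f g)
  case 0
  then show ?case using continuous_on_cong by force
next
  case (Suc k)
  have d: "(g has_derivative frechet_derivative f (at x)) (at x)" if "x \<in> S" for x
  proof -
    have "(f has_derivative frechet_derivative f (at x)) (at x)"
      using Suc.prems(2) that frechet_derivative_works by auto
    then show ?thesis
      by (rule has_derivative_transform_within_open[OF _ assms(1) that]) (use Suc.prems in auto)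
  qed
  have eq: "frechet_derivative g (at x) = frechet_derivative f (at x)" if "x \<in> S" for x
    using frechet_derivative_at[OF d[OF that]] by simp
  have "Ck_on k (\<lambda>x. frechet_derivative g (at x) v) S" for v
    by (rule Suc.IH[of "\<lambda>x. frechet_derivative f (at x) v"]) (use Suc.prems eq in auto)
  then show ?case using d by (auto simp: differentiable_def)
qed

lemma Ck_on_SucI:
  assumes "open S" and "\<And>x. x \<in> S \<Longrightarrow> (f has_derivative f' x) (at x)"
    and "\<And>v. Ck_on k (\<lambda>x. f' x v) S"
  shows "Ck_on (Suc k) f S"
proof -
  have eq: "frechet_derivative f (at x) = f' x" if "x \<in> S" for x
    using frechet_derivative_at[OF assms(2)[OF that]] by simp
  show ?thesis
    using assms(2) by (auto simp: differentiable_def eq intro!: Ck_on_cong[OF assms(1) _ assms(3)])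
qed

lemma Ck_on_has_derivative:
  "Ck_on (Suc k) f S \<Longrightarrow> x \<in> S \<Longrightarrow> (f has_derivative frechet_derivative f (at x)) (at x)"
  using frechet_derivative_works by auto

lemma Ck_on_Suc_imp: "Ck_on (Suc k) f S \<Longrightarrow> Ck_on k f S"
proof (induction k arbitrary: f)
  case 0
  then have "\<And>x. x \<in> S \<Longrightarrow> continuous (at x) f"
    using differentiable_imp_continuous_within by auto
  then show ?case by (simp add: continuous_at_imp_continuous_on)
next
  case (Suc k)
  then show ?case by (metis Ck_on.simps(2))
qed

lemma Ck_on_subset: "Ck_on k f S \<Longrightarrow> T \<subseteq> S \<Longrightarrow> Ck_on k f T"
  by (induction k arbitrary: f) (auto intro: continuous_on_subset)

lemma Ck_on_local:
  assumes "\<And>x. x \<in> S \<Longrightarrow> \<exists>U. open U \<and> x \<in> U \<and> Ck_on k f U"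
  shows "Ck_on k f S"
  using assms
proof (induction k arbitrary: f)
  case 0
  then have "\<And>x. x \<in> S \<Longrightarrow> continuous (at x) f"
    by (metis Ck_on.simps(1) continuous_on_eq_continuous_at)
  then show ?case by (simp add: continuous_at_imp_continuous_on)
next
  case (Suc k)
  then show ?case by (metis Ck_on.simps(2))
qed

lemma Ck_on_const: "open S \<Longrightarrow> Ck_on k (\<lambda>x. c) S"
proof (induction k arbitrary: c)
  case (Suc k)
  then show ?case by (intro Ck_on_SucI[where f' = "\<lambda>x v. 0"]) auto
qed auto

lemma Ck_on_add:
  assumes "open S"
  shows "Ck_on k f S \<Longrightarrow> Ck_on k g S \<Longrightarrow> Ck_on k (\<lambda>x. f x + g x) S"
proof (induction k arbitrary: f g)
  case (Suc k)
  show ?case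
    by (rule Ck_on_SucI[OF assms, where f' = "\<lambda>x v. frechet_derivative f (at x) v + frechet_derivative g (at x) v"])
      (use Suc in \<open>auto intro!: has_derivative_add Ck_on_has_derivative\<close>)
qed (auto intro: continuous_intros)

lemma Ck_on_sum:
  "open S \<Longrightarrow> (\<And>i. i \<in> I \<Longrightarrow> Ck_on k (f i) S) \<Longrightarrow> Ck_on k (\<lambda>x. \<Sum>i\<in>I. f i x) S"
  by (induction I rule: infinite_finite_induct) (auto intro: Ck_on_const Ck_on_add)

lemma (in bounded_bilinear) Ck_on:
  assumes "open S"
  shows "Ck_on k f S \<Longrightarrow> Ck_on k g S \<Longrightarrow> Ck_on k (\<lambda>x. prod (f x) (g x)) S"
proof (induction k arbitrary: f g)
  case 0
  then show ?case by (auto intro: continuous_on)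
next
  case (Suc k)
  show ?case
  proof (rule Ck_on_SucI[OF assms, where f' = "\<lambda>x v. prod (f x) (frechet_derivative g (at x) v) + prod (frechet_derivative f (at x) v) (g x)"])
    show "((\<lambda>x. prod (f x) (g x)) has_derivative (\<lambda>v. prod (f x) (frechet_derivative g (at x) v) + prod (frechet_derivative f (at x) v) (g x))) (at x)"
      if "x \<in> S" for x
      by (rule FDERIV) (use Ck_on_has_derivative Suc.prems that in auto)
    show "Ck_on k (\<lambda>x. prod (f x) (frechet_derivative g (at x) v) + prod (frechet_derivative f (at x) v) (g x)) S" for v
      using Suc.prems Suc.prems[THEN Ck_on_Suc_imp] by (intro Ck_on_add assms Suc.IH) auto
  qed
qed

lemma Ck_on_linear:
  assumes "bounded_linear L" "open S"
  shows "Ck_on k f S \<Longrightarrow> Ck_on k (\<lambda>x. L (f x)) S"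
proof (induction k arbitrary: f)
  case 0
  then show ?case using assms bounded_linear.continuous_on by auto
next
  case (Suc k)
  show ?case
    by (rule Ck_on_SucI[OF assms(2), where f' = "\<lambda>x v. L (frechet_derivative f (at x) v)"])
      (use Suc in \<open>auto intro!: bounded_linear.has_derivative[OF assms(1)] Ck_on_has_derivative\<close>)
qed

lemma linear_basis_sum:
  fixes L :: "'e::euclidean_space \<Rightarrow> 'f::real_vector"
  assumes "linear L"
  shows "L v = (\<Sum>b\<in>Basis. (v \<bullet> b) *\<^sub>R L b)"
  by (metis (no_types, lifting) assms euclidean_representation linear_scale linear_sum sum.cong)

lemma Ck_on_compose:
  fixes g :: "'b::euclidean_space \<Rightarrow> 'c::real_normed_vector"
  assumes "open S" "open T" "f ` S \<subseteq> T"
  shows "Ck_on k f S \<Longrightarrow> Ck_on k g T \<Longrightarrow> Ck_on k (\<lambda>x. g (f x)) S"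
proof (induction k arbitrary: g)
  case 0
  then show ?case using assms(3) continuous_on_compose2 by auto
next
  case (Suc k)
  let ?g = "\<lambda>b x. frechet_derivative g (at (f x)) b"
  show ?case
  \<comment> \<open>Expanding the inner derivative in the basis turns the derivative of the
    composite into a finite sum of products. Each factor \<open>?g b x\<close> is again a composite
    with \<open>f\<close>, of the partial derivative of \<open>g\<close> for a fixed
    \<open>b\<close>, so the induction hypothesis applies to it.\<close>
  proof (rule Ck_on_SucI[OF assms(1), where f' = "\<lambda>x v. \<Sum>b\<in>Basis. (frechet_derivative f (at x) v \<bullet> b) *\<^sub>R ?g b x"])
    fix x assume x: "x \<in> S"
    have f: "(f has_derivative frechet_derivative f (at x)) (at x)"
      using Suc.prems(1) x by (rule Ck_on_has_derivative)
    have g: "(g has_derivative frechet_derivative g (at (f x))) (at (f x))"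
      by (rule Ck_on_has_derivative[OF Suc.prems(2)]) (use assms(3) x in auto)
    have "frechet_derivative g (at (f x)) \<circ> frechet_derivative f (at x)
      = (\<lambda>v. \<Sum>b\<in>Basis. (frechet_derivative f (at x) v \<bullet> b) *\<^sub>R ?g b x)"
      unfolding comp_def by (rule ext) (rule linear_basis_sum[OF has_derivative_linear[OF g]])
    with diff_chain_at[OF f g]
    show "((\<lambda>x. g (f x)) has_derivative (\<lambda>v. \<Sum>b\<in>Basis. (frechet_derivative f (at x) v \<bullet> b) *\<^sub>R ?g b x)) (at x)"
      by (simp add: comp_def)
  next
    fix v
    show "Ck_on k (\<lambda>x. \<Sum>b\<in>Basis. (frechet_derivative f (at x) v \<bullet> b) *\<^sub>R ?g b x) S"
      by (intro Ck_on_sum[OF assms(1)] bounded_bilinear.Ck_on[OF bounded_bilinear_scaleR assms(1)]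
          Ck_on_linear[OF bounded_linear_inner_left assms(1)] Suc.IH)
        (use Suc.prems Ck_on_Suc_imp[OF Suc.prems(1)] in auto)
  qed
qed

lemma smooth_onD: "smooth_on S f \<Longrightarrow> Ck_on k f S" by (simp add: smooth_on_def)

lemma smooth_on_cong:
  "open S \<Longrightarrow> (\<And>x. x \<in> S \<Longrightarrow> f x = g x) \<Longrightarrow> smooth_on S f \<Longrightarrow> smooth_on S g"
  by (simp add: smooth_on_def) (metis Ck_on_cong)

lemma smooth_on_subset: "smooth_on S f \<Longrightarrow> T \<subseteq> S \<Longrightarrow> smooth_on T f"
  by (auto simp: smooth_on_def intro: Ck_on_subset)

lemma smooth_on_local:
  assumes "\<And>x. x \<in> S \<Longrightarrow> \<exists>U. open U \<and> x \<in> U \<and> smooth_on U f"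
  shows "smooth_on S f"
  unfolding smooth_on_def using assms by (meson Ck_on_local smooth_onD)

lemma smooth_on_const: "open S \<Longrightarrow> smooth_on S (\<lambda>x. c)"
  by (simp add: smooth_on_def Ck_on_const)

lemma smooth_on_add: "open S \<Longrightarrow> smooth_on S f \<Longrightarrow> smooth_on S g \<Longrightarrow> smooth_on S (\<lambda>x. f x + g x)"
  by (simp add: smooth_on_def Ck_on_add)

lemma smooth_on_sum:
  "open S \<Longrightarrow> (\<And>i. i \<in> I \<Longrightarrow> smooth_on S (f i)) \<Longrightarrow> smooth_on S (\<lambda>x. \<Sum>i\<in>I. f i x)"
  by (simp add: smooth_on_def Ck_on_sum)

lemma smooth_on_bilinear:
  "bounded_bilinear B \<Longrightarrow> open S \<Longrightarrow> smooth_on S f \<Longrightarrow> smooth_on S g \<Longrightarrow> smooth_on S (\<lambda>x. B (f x) (g x))"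
  by (simp add: smooth_on_def bounded_bilinear.Ck_on)

lemma smooth_on_linear:
  "bounded_linear L \<Longrightarrow> open S \<Longrightarrow> smooth_on S f \<Longrightarrow> smooth_on S (\<lambda>x. L (f x))"
  by (simp add: smooth_on_def Ck_on_linear)

lemma smooth_on_compose:
  fixes g :: "'b::euclidean_space \<Rightarrow> 'c::real_normed_vector"
  assumes "smooth_on S f" "smooth_on T g" "open S" "open T" "f ` S \<subseteq> T"
  shows "smooth_on S (\<lambda>x. g (f x))"
  using assms by (simp add: smooth_on_def Ck_on_compose[where T=T])

lemma smooth_on_derivative: "smooth_on S f \<Longrightarrow> smooth_on S (\<lambda>x. frechet_derivative f (at x) v)"
  unfolding smooth_on_def by (metis Ck_on.simps(2))

lemma smooth_on_has_derivative:
  "smooth_on S f \<Longrightarrow> x \<in> S \<Longrightarrow> (f has_derivative frechet_derivative f (at x)) (at x)"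
  by (meson Ck_on_has_derivative smooth_onD)

lemma smooth_on_continuous: "smooth_on S f \<Longrightarrow> continuous_on S f"
  using smooth_onD[of S f 0] by simp

lemma smooth_on_derivative':
  fixes f :: "'e::euclidean_space \<Rightarrow> 'f::real_normed_vector" and g w :: "'d::real_normed_vector \<Rightarrow> 'e"
  assumes "smooth_on T f" "smooth_on S g" "smooth_on S w" "open S" "open T" "g ` S \<subseteq> T"
  shows "smooth_on S (\<lambda>x. frechet_derivative f (at (g x)) (w x))"
proof (rule smooth_on_cong[OF \<open>open S\<close>])
  show "smooth_on S (\<lambda>x. \<Sum>b\<in>Basis. (w x \<bullet> b) *\<^sub>R frechet_derivative f (at (g x)) b)"
    by (intro smooth_on_sum smooth_on_bilinear[OF bounded_bilinear_scaleR] assms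
        smooth_on_linear[OF bounded_linear_inner_left] smooth_on_compose[OF assms(2) smooth_on_derivative, of T])
  show "(\<Sum>b\<in>Basis. (w x \<bullet> b) *\<^sub>R frechet_derivative f (at (g x)) b) = frechet_derivative f (at (g x)) (w x)"
    if "x \<in> S" for x
    by (rule linear_basis_sum[symmetric], rule has_derivative_linear[OF smooth_on_has_derivative[OF assms(1)]])
      (use assms(6) that in auto)
qed

lemma smooth_on_id: "open S \<Longrightarrow> smooth_on S (\<lambda>x. x)"
  unfolding smooth_on_def
proof
  fix k assume "open S"
  then show "Ck_on k (\<lambda>x. x) S"
    by (cases k) (auto intro!: Ck_on_SucI[where f' = "\<lambda>x v. v"] Ck_on_const simp del: Ck_on.simps(2))
qed

lemma smooth_on_Pair:
  assumes "open S" "smooth_on S f" "smooth_on S g"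
  shows "smooth_on S (\<lambda>x. (f x, g x))"
proof -
  have "smooth_on S (\<lambda>x. (f x, 0) + (0, g x))"
    by (intro smooth_on_add smooth_on_linear[of "\<lambda>x. (x, 0)"] smooth_on_linear[of "\<lambda>x. (0, x)"] assms
        bounded_linear_Pair bounded_linear_ident bounded_linear_zero)
  then show ?thesis by simp
qed

lemma smooth_on_imp_C1:
  fixes f :: "'e::euclidean_space \<Rightarrow> 'f::real_normed_vector"
  assumes "smooth_on S f" "open S"
  shows "continuous_on S (\<lambda>x. frechet_derivative f (at x) v)"
  using smooth_on_continuous smooth_on_derivative assms by blast

section \<open>Symmetry of second derivatives\<close>

lemma smooth_on_line_derivative:
  fixes f :: "'e::real_normed_vector \<Rightarrow> real"
  assumes "smooth_on S f" "c a \<in> S" "\<And>a. c a = p + a *\<^sub>R u"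
  shows "((\<lambda>a. f (c a)) has_real_derivative frechet_derivative f (at (c a)) u) (at a)"
proof -
  note f = smooth_on_has_derivative[OF assms(1,2)]
  have "c = (\<lambda>a. p + a *\<^sub>R u)" using assms(3) by auto
  then have "(c has_derivative (\<lambda>h. h *\<^sub>R u)) (at a)" by (auto intro!: derivative_eq_intros)
  from diff_chain_at[OF this f] show ?thesis
    by (simp add: comp_def has_field_derivative_def linear_scale[OF has_derivative_linear[OF f]] mult.commute[of _ "frechet_derivative f (at (c a)) u"])
qed

text \<open>Both iterated derivatives are compared with the second difference
  \<open>f (x + s u + s v) - f (x + s u) - f (x + s v) + f x\<close>, which is symmetric in \<open>u\<close> and \<open>v\<close>.\<close>

lemma second_difference_limit:
  fixes f :: "'e::euclidean_space \<Rightarrow> real"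
  assumes "smooth_on S f" "open S" "x \<in> S" "e > 0"
  shows "\<exists>d>0. \<forall>s. 0 < s \<and> s < d \<longrightarrow>
    \<bar>(f (x + s *\<^sub>R u + s *\<^sub>R v) - f (x + s *\<^sub>R u) - f (x + s *\<^sub>R v) + f x) / s\<^sup>2
      - frechet_derivative (\<lambda>y. frechet_derivative f (at y) u) (at x) v\<bar> \<le> e"
proof -
  let ?D = "\<lambda>y. frechet_derivative f (at y) u"
  let ?DD = "\<lambda>y. frechet_derivative ?D (at y) v"
  have D: "smooth_on S ?D" by (rule smooth_on_derivative[OF assms(1)])
  have "continuous_on S ?DD" by (rule smooth_on_imp_C1[OF D assms(2)])
  then have "continuous (at x) ?DD" using assms continuous_on_eq_continuous_at by blast
  then obtain r1 where r1: "r1 > 0" "\<And>y. dist y x < r1 \<Longrightarrow> dist (?DD y) (?DD x) < e"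
    using assms(4) by (auto simp: continuous_at_eps_delta)
  obtain r2 where r2: "r2 > 0" "ball x r2 \<subseteq> S" using assms(2,3) open_contains_ball by blast
  \<comment> \<open>The \<open>+ 1\<close> keeps the denominator positive when \<open>u\<close> and
    \<open>v\<close> vanish and makes the estimate in \<open>near\<close> strict.\<close>
  define d where "d = min r1 r2 / (norm u + norm v + 1)"
  have nuv: "norm u + norm v + 1 > 0" by (simp add: add_nonneg_pos)
  have d: "d > 0" using r1 r2 nuv by (simp add: d_def)
  have near: "dist (x + a *\<^sub>R u + b *\<^sub>R v) x < min r1 r2"
    if "0 \<le> a" "a < d" "0 \<le> b" "b < d" for a b
  proof -
    have "dist (x + a *\<^sub>R u + b *\<^sub>R v) x \<le> a * norm u + b * norm v"
      using that norm_triangle_ineq[of "a *\<^sub>R u" "b *\<^sub>R v"] by (simp add: dist_norm)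
    also have "\<dots> \<le> d * norm u + d * norm v"
      using that by (intro add_mono mult_right_mono) auto
    also have "\<dots> < d * (norm u + norm v + 1)" using d by (simp add: algebra_simps)
    finally show ?thesis using nuv by (simp add: d_def)
  qed
  then have near2: "x + a *\<^sub>R u + b *\<^sub>R v \<in> S" if "0 \<le> a" "a < d" "0 \<le> b" "b < d" for a b
    using r2 that by (force simp: dist_commute)
  have "\<bar>(f (x + s *\<^sub>R u + s *\<^sub>R v) - f (x + s *\<^sub>R u) - f (x + s *\<^sub>R v) + f x) / s\<^sup>2 - ?DD x\<bar> \<le> e"
    if s: "0 < s" "s < d" for s
  proof -
    \<comment> \<open>One mean value step in the direction \<open>u\<close>, applied to the
      difference along two parallel lines, and one in the direction \<open>v\<close>, applied to
      \<open>?D\<close>, express the second difference as \<open>s\<^sup>2\<close> times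
      \<open>?DD\<close> at an intermediate point.\<close>
    define \<phi> where "\<phi> a = f (x + a *\<^sub>R u + s *\<^sub>R v) - f (x + a *\<^sub>R u)" for a
    have der\<phi>: "(\<phi> has_real_derivative (?D (x + a *\<^sub>R u + s *\<^sub>R v) - ?D (x + a *\<^sub>R u))) (at a)"
      if "0 \<le> a" "a \<le> s" for a
    proof -
      have p: "x + a *\<^sub>R u + s *\<^sub>R v \<in> S" "x + a *\<^sub>R u \<in> S" using near2[of a s] near2[of a 0] that s by auto
      show ?thesis unfolding \<phi>_def
        by (intro DERIV_diff smooth_on_line_derivative[OF assms(1), of "\<lambda>a. x + a *\<^sub>R u + s *\<^sub>R v" _ "x + s *\<^sub>R v"]
            smooth_on_line_derivative[OF assms(1), of "\<lambda>a. x + a *\<^sub>R u"] p) (simp_all add: algebra_simps)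
    qed
    obtain a where a: "0 < a" "a < s" "\<phi> s - \<phi> 0 = (s - 0) * (?D (x + a *\<^sub>R u + s *\<^sub>R v) - ?D (x + a *\<^sub>R u))"
      using MVT2[of 0 s \<phi> "\<lambda>a. ?D (x + a *\<^sub>R u + s *\<^sub>R v) - ?D (x + a *\<^sub>R u)"] der\<phi> s by auto
    have der2: "((\<lambda>b. ?D (x + a *\<^sub>R u + b *\<^sub>R v)) has_real_derivative ?DD (x + a *\<^sub>R u + b *\<^sub>R v)) (at b)"
      if "0 \<le> b" "b \<le> s" for b
    proof -
      have p: "x + a *\<^sub>R u + b *\<^sub>R v \<in> S" using near2[of a b] a that s by auto
      show ?thesis
        by (rule smooth_on_line_derivative[OF D, of "\<lambda>b. x + a *\<^sub>R u + b *\<^sub>R v"]) (use p in auto)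
    qed
    obtain b where b: "0 < b" "b < s" "?D (x + a *\<^sub>R u + s *\<^sub>R v) - ?D (x + a *\<^sub>R u + 0 *\<^sub>R v) = (s - 0) * ?DD (x + a *\<^sub>R u + b *\<^sub>R v)"
      using MVT2[of 0 s "\<lambda>b. ?D (x + a *\<^sub>R u + b *\<^sub>R v)" "\<lambda>b. ?DD (x + a *\<^sub>R u + b *\<^sub>R v)"] der2 s by auto
    have "f (x + s *\<^sub>R u + s *\<^sub>R v) - f (x + s *\<^sub>R u) - f (x + s *\<^sub>R v) + f x = \<phi> s - \<phi> 0" by (simp add: \<phi>_def)
    also have "\<dots> = s\<^sup>2 * ?DD (x + a *\<^sub>R u + b *\<^sub>R v)" using a b by (simp add: power2_eq_square)
    finally have "(f (x + s *\<^sub>R u + s *\<^sub>R v) - f (x + s *\<^sub>R u) - f (x + s *\<^sub>R v) + f x) / s\<^sup>2 = ?DD (x + a *\<^sub>R u + b *\<^sub>R v)"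
      using s by simp
    moreover have "dist (?DD (x + a *\<^sub>R u + b *\<^sub>R v)) (?DD x) < e"
      using r1(2) near[of a b] a b s by auto
    ultimately show ?thesis by (simp add: dist_real_def)
  qed
  then show ?thesis using d by blast
qed

lemma symmetric_second_derivative_real:
  fixes f :: "'e::euclidean_space \<Rightarrow> real"
  assumes "smooth_on S f" "open S" "x \<in> S"
  shows "frechet_derivative (\<lambda>y. frechet_derivative f (at y) u) (at x) v
       = frechet_derivative (\<lambda>y. frechet_derivative f (at y) v) (at x) u" (is "?a = ?b")
proof (rule ccontr)
  assume "?a \<noteq> ?b"
  \<comment> \<open>Both values are within \<open>e\<close> of the same difference quotient, so they
    differ by at most \<open>2 * e\<close>, which is less than \<open>3 * e\<close>.\<close>
  define e where "e = \<bar>?a - ?b\<bar> / 3"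
  have e: "e > 0" using \<open>?a \<noteq> ?b\<close> by (simp add: e_def)
  obtain d1 where d1: "d1 > 0" "\<And>s. 0 < s \<and> s < d1 \<Longrightarrow>
    \<bar>(f (x + s *\<^sub>R u + s *\<^sub>R v) - f (x + s *\<^sub>R u) - f (x + s *\<^sub>R v) + f x) / s\<^sup>2 - ?a\<bar> \<le> e"
    using second_difference_limit[OF assms e] by blast
  obtain d2 where d2: "d2 > 0" "\<And>s. 0 < s \<and> s < d2 \<Longrightarrow>
    \<bar>(f (x + s *\<^sub>R v + s *\<^sub>R u) - f (x + s *\<^sub>R v) - f (x + s *\<^sub>R u) + f x) / s\<^sup>2 - ?b\<bar> \<le> e"
    using second_difference_limit[OF assms e] by blast
  define s where "s = min d1 d2 / 2"
  have s: "0 < s" "s < d1" "s < d2" using d1 d2 by (auto simp: s_def)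
  have "f (x + s *\<^sub>R v + s *\<^sub>R u) - f (x + s *\<^sub>R v) - f (x + s *\<^sub>R u) + f x
      = f (x + s *\<^sub>R u + s *\<^sub>R v) - f (x + s *\<^sub>R u) - f (x + s *\<^sub>R v) + f x"
    by (simp add: add.commute add.left_commute)
  then have "\<bar>(f (x + s *\<^sub>R u + s *\<^sub>R v) - f (x + s *\<^sub>R u) - f (x + s *\<^sub>R v) + f x) / s\<^sup>2 - ?b\<bar> \<le> e"
    using d2(2)[of s] s by metis
  then have "\<bar>?a - ?b\<bar> \<le> 2 * e" using d1(2)[of s] s by linarith
  then show False using e by (simp add: e_def)
qed

lemma frechet_derivative_inner:
  assumes "f differentiable at x"
  shows "frechet_derivative (\<lambda>y. f y \<bullet> b) (at x) u = frechet_derivative f (at x) u \<bullet> b"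
proof -
  have "((\<lambda>y. f y \<bullet> b) has_derivative (\<lambda>u. frechet_derivative f (at x) u \<bullet> b)) (at x)"
    by (rule has_derivative_inner_left) (use assms frechet_derivative_works in blast)
  then show ?thesis by (metis frechet_derivative_at)
qed

lemma smooth_on_differentiable: "smooth_on S f \<Longrightarrow> x \<in> S \<Longrightarrow> f differentiable at x"
  using smooth_on_has_derivative by (auto simp: differentiable_def)

lemma symmetric_second_derivative:
  fixes f :: "'e::euclidean_space \<Rightarrow> 'f::euclidean_space"
  assumes "smooth_on S f" "open S" "x \<in> S"
  shows "frechet_derivative (\<lambda>y. frechet_derivative f (at y) u) (at x) v
       = frechet_derivative (\<lambda>y. frechet_derivative f (at y) v) (at x) u"
proof (rule euclidean_eqI)
  fix b :: 'f assume "b \<in> Basis"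
  have 1: "frechet_derivative (\<lambda>y. frechet_derivative (\<lambda>y. f y \<bullet> b) (at y) u) (at x) v
      = frechet_derivative (\<lambda>y. frechet_derivative f (at y) u) (at x) v \<bullet> b" for u v
  proof -
    have "((\<lambda>y. frechet_derivative f (at y) u \<bullet> b) has_derivative
        (\<lambda>v. frechet_derivative (\<lambda>y. frechet_derivative f (at y) u) (at x) v \<bullet> b)) (at x)"
      by (rule has_derivative_inner_left) (rule smooth_on_has_derivative[OF smooth_on_derivative[OF assms(1)] assms(3)])
    then have "((\<lambda>y. frechet_derivative (\<lambda>y. f y \<bullet> b) (at y) u) has_derivative
        (\<lambda>v. frechet_derivative (\<lambda>y. frechet_derivative f (at y) u) (at x) v \<bullet> b)) (at x)"
      by (rule has_derivative_transform_within_open[OF _ assms(2,3)])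
        (simp add: frechet_derivative_inner[OF smooth_on_differentiable[OF assms(1)]])
    then show ?thesis by (metis frechet_derivative_at)
  qed
  have "smooth_on S (\<lambda>y. f y \<bullet> b)"
    by (rule smooth_on_linear[OF bounded_linear_inner_left assms(2,1)])
  from symmetric_second_derivative_real[OF this assms(2,3), of u v]
  show "frechet_derivative (\<lambda>y. frechet_derivative f (at y) u) (at x) v \<bullet> b
       = frechet_derivative (\<lambda>y. frechet_derivative f (at y) v) (at x) u \<bullet> b"
    by (simp add: 1)
qed

lemma frechet_derivative_cong:
  assumes "open S" "x \<in> S" "\<And>y. y \<in> S \<Longrightarrow> f y = g y"
  shows "frechet_derivative f (at x) = frechet_derivative g (at x)"
proof -
  have "(f has_derivative D) (at x) \<longleftrightarrow> (g has_derivative D) (at x)" for D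
    using has_derivative_transform_within_open[OF _ assms(1,2), of f D UNIV g]
      has_derivative_transform_within_open[OF _ assms(1,2), of g D UNIV f] assms(3) by auto
  then show ?thesis by (simp add: frechet_derivative_def)
qed

text \<open>Product rule for a derivative whose base point and direction both move, obtained by
  expanding \<open>w\<close> in the basis. The first summand keeps the direction frozen at
  \<open>w x\<close>; it is a second derivative of \<open>F\<close> and hence the part that drops
  out of commutators.\<close>

lemma has_derivative_directional:
  fixes F :: "'e::euclidean_space \<Rightarrow> 'f::real_normed_vector" and w :: "'e \<Rightarrow> 'e"
  assumes "smooth_on S F" "smooth_on S w" "open S" "x \<in> S"
  shows "((\<lambda>x. frechet_derivative F (at x) (w x)) has_derivative
    (\<lambda>v. frechet_derivative (\<lambda>y. frechet_derivative F (at y) (w x)) (at x) v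
      + frechet_derivative F (at x) (frechet_derivative w (at x) v))) (at x)"
proof -
  let ?D = "\<lambda>y. frechet_derivative F (at y)"
  have lin: "linear (?D y)" if "y \<in> S" for y
    by (rule has_derivative_linear[OF smooth_on_has_derivative[OF assms(1) that]])
  have D: "((\<lambda>y. ?D y b) has_derivative frechet_derivative (\<lambda>y. ?D y b) (at x)) (at x)" for b
    by (rule smooth_on_has_derivative[OF smooth_on_derivative[OF assms(1)] assms(4)])
  have w: "((\<lambda>y. w y \<bullet> b) has_derivative (\<lambda>v. frechet_derivative w (at x) v \<bullet> b)) (at x)" for b
    by (rule has_derivative_inner_left[OF smooth_on_has_derivative[OF assms(2,4)]])
  have "((\<lambda>y. \<Sum>b\<in>Basis. (w y \<bullet> b) *\<^sub>R ?D y b) has_derivative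
     (\<lambda>v. \<Sum>b\<in>Basis. (w x \<bullet> b) *\<^sub>R frechet_derivative (\<lambda>y. ?D y b) (at x) v
        + (frechet_derivative w (at x) v \<bullet> b) *\<^sub>R ?D x b)) (at x)"
    by (intro has_derivative_sum has_derivative_scaleR w D)
  then have 1: "((\<lambda>y. ?D y (w y)) has_derivative
     (\<lambda>v. \<Sum>b\<in>Basis. (w x \<bullet> b) *\<^sub>R frechet_derivative (\<lambda>y. ?D y b) (at x) v
        + (frechet_derivative w (at x) v \<bullet> b) *\<^sub>R ?D x b)) (at x)"
    by (rule has_derivative_transform_within_open[OF _ assms(3,4)]) (rule linear_basis_sum[OF lin, symmetric])
  have "((\<lambda>y. \<Sum>b\<in>Basis. (w x \<bullet> b) *\<^sub>R ?D y b) has_derivative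
     (\<lambda>v. \<Sum>b\<in>Basis. (w x \<bullet> b) *\<^sub>R frechet_derivative (\<lambda>y. ?D y b) (at x) v)) (at x)"
    by (intro has_derivative_sum has_derivative_scaleR_right D)
  then have "((\<lambda>y. ?D y (w x)) has_derivative
     (\<lambda>v. \<Sum>b\<in>Basis. (w x \<bullet> b) *\<^sub>R frechet_derivative (\<lambda>y. ?D y b) (at x) v)) (at x)"
    by (rule has_derivative_transform_within_open[OF _ assms(3,4)]) (rule linear_basis_sum[OF lin, symmetric])
  then have 2: "frechet_derivative (\<lambda>y. ?D y (w x)) (at x)
      = (\<lambda>v. \<Sum>b\<in>Basis. (w x \<bullet> b) *\<^sub>R frechet_derivative (\<lambda>y. ?D y b) (at x) v)"
    by (rule frechet_derivative_at[symmetric])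
  have "frechet_derivative (\<lambda>y. ?D y (w x)) (at x) v + ?D x (frechet_derivative w (at x) v)
     = (\<Sum>b\<in>Basis. (w x \<bullet> b) *\<^sub>R frechet_derivative (\<lambda>y. ?D y b) (at x) v
        + (frechet_derivative w (at x) v \<bullet> b) *\<^sub>R ?D x b)" for v
    unfolding 2 sum.distrib
    by (subst linear_basis_sum[OF lin[OF assms(4)], of "frechet_derivative w (at x) v"]) (rule refl)
  with 1 show ?thesis by (simp only:)
qed

section \<open>Integral curves of smooth vector fields\<close>

lemma smooth_integral_curve:
  fixes F :: "'e::euclidean_space \<Rightarrow> 'e"
  assumes "smooth_on S F" "open S" "open I" "\<And>u. u \<in> I \<Longrightarrow> y u \<in> S"
    and "\<And>u. u \<in> I \<Longrightarrow> (y has_vector_derivative F (y u)) (at u)"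
  shows "smooth_on I y"
  unfolding smooth_on_def
proof
  fix k show "Ck_on k y I"
  proof (induction k)
    case 0
    show ?case
      using assms(5) by (auto intro!: continuous_at_imp_continuous_on has_vector_derivative_continuous)
  next
    \<comment> \<open>Bootstrapping: a solution of class \<open>C^k\<close> has the derivative
      \<open>F (y u)\<close>, again of class \<open>C^k\<close>, so it is one class better.\<close>
    case (Suc k)
    show ?case
    proof (rule Ck_on_SucI[OF assms(3)])
      show "(y has_derivative (\<lambda>h. h *\<^sub>R F (y u))) (at u)" if "u \<in> I" for u
        using assms(5)[OF that] by (simp add: has_vector_derivative_def)
      show "Ck_on k (\<lambda>u. v *\<^sub>R F (y u)) I" for v
        by (intro Ck_on_linear[OF bounded_linear_scaleR_right assms(3)] Ck_on_compose[OF assms(3,2) _ Suc.IH])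
          (use assms(4) smooth_onD[OF assms(1)] in auto)
    qed
  qed
qed

text \<open>The partial derivatives are bounded on the compact set \<open>C\<close>, and convexity
  makes the mean value inequality available between any two of its points. The summand 1 in
  \<open>L\<close> keeps the constant positive.\<close>

lemma smooth_on_imp_lipschitz:
  fixes F :: "'e::euclidean_space \<Rightarrow> 'f::real_normed_vector"
  assumes "smooth_on S F" "open S" "compact C" "convex C" "C \<subseteq> S"
  obtains L where "L > 0" "\<And>x y. x \<in> C \<Longrightarrow> y \<in> C \<Longrightarrow> norm (F x - F y) \<le> L * norm (x - y)"
proof -
  let ?D = "\<lambda>x. frechet_derivative F (at x)"
  have "\<exists>B. \<forall>x\<in>C. norm (?D x b) \<le> B" for b
  proof -
    have "compact ((\<lambda>x. ?D x b) ` C)"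
      by (rule compact_continuous_image[OF continuous_on_subset[OF smooth_on_imp_C1[OF assms(1,2)] assms(5)] assms(3)])
    then show ?thesis by (auto dest!: compact_imp_bounded simp: bounded_iff)
  qed
  then obtain B where B: "\<And>b x. x \<in> C \<Longrightarrow> norm (?D x b) \<le> B b" by metis
  define L where "L = 1 + (\<Sum>b\<in>Basis. \<bar>B b\<bar>)"
  have onorm: "onorm (?D x) \<le> L" if x: "x \<in> C" for x
  proof (rule onorm_le)
    fix v
    have "norm (?D x v) \<le> (\<Sum>b\<in>Basis. norm ((v \<bullet> b) *\<^sub>R ?D x b))"
      by (subst linear_basis_sum[of "?D x" v]) (use x assms(1,5) has_derivative_linear smooth_on_has_derivative norm_sum in blast)+
    also have "\<dots> \<le> (\<Sum>b\<in>Basis. norm v * \<bar>B b\<bar>)"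
    proof (rule sum_mono)
      fix b :: 'e assume "b \<in> Basis"
      then have "\<bar>v \<bullet> b\<bar> \<le> norm v" by (rule Basis_le_norm)
      moreover have "norm (?D x b) \<le> \<bar>B b\<bar>" using B[OF x, of b] by linarith
      ultimately show "norm ((v \<bullet> b) *\<^sub>R ?D x b) \<le> norm v * \<bar>B b\<bar>" by (simp add: mult_mono)
    qed
    also have "\<dots> \<le> L * norm v"
      by (simp add: L_def algebra_simps flip: sum_distrib_left)
    finally show "norm (?D x v) \<le> L * norm v" .
  qed
  show thesis
  proof
    show "L > 0" by (simp add: L_def add_pos_nonneg sum_nonneg)
    show "norm (F x - F y) \<le> L * norm (x - y)" if "x \<in> C" "y \<in> C" for x y
      by (rule differentiable_bound[OF assms(4) _ onorm])
        (use that assms(1,5) smooth_on_has_derivative has_derivative_at_withinI in blast)+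
  qed
qed

text \<open>Picard iteration as a contraction of the complete space of bounded continuous functions
  on the whole line. Times outside \<open>[-e, e]\<close> are clamped by \<open>cl\<close>, so the
  values there carry no information.\<close>

lemma lipschitz_ode_solution:
  fixes G :: "'e::euclidean_space \<Rightarrow> 'e"
  assumes L: "\<And>x y. norm (G x - G y) \<le> L * norm (x - y)" and e: "e > 0" "L > 0" "8 * e * L \<le> 1"
  obtains y :: "real \<Rightarrow> 'e" where "y 0 = x0"
    "\<And>u. u \<in> {-e<..<e} \<Longrightarrow> (y has_vector_derivative G (y u)) (at u)"
proof -
  define cl where "cl u = max (-e) (min e u)" for u
  have cl: "cl u \<in> {-e..e}" "\<And>u. u \<in> {-e..e} \<Longrightarrow> cl u = u" for u using e by (auto simp: cl_def)
  have "L-lipschitz_on UNIV G" using L e by (auto intro!: lipschitz_onI simp: dist_norm)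
  then have G: "continuous_on UNIV G" by (rule lipschitz_on_continuous_on)
  have Gy: "continuous_on X (\<lambda>\<tau>. G (apply_bcontfun y \<tau>))" for X y
    by (rule continuous_on_compose2[OF G continuous_on_apply_bcontfun]) auto
  \<comment> \<open>Starting all integrals at \<open>-e\<close> avoids integrals with reversed
    endpoints; subtracting \<open>J y 0\<close> in \<open>T\<close> restores the initial value at
    time 0.\<close>
  define J where "J y w = integral {-e..w} (\<lambda>\<tau>. G (apply_bcontfun y \<tau>))" for y w
  define T where "T y u = x0 + J y (cl u) - J y 0" for y u
  have contJ: "continuous_on {-e..e} (J y)" for y
    unfolding J_def by (intro indefinite_integral_continuous_1 integrable_continuous_interval Gy)
  have Tb: "T y \<in> bcontfun" for y
    unfolding bcontfun_def
  proof (intro CollectI conjI)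
    have "continuous_on UNIV cl" unfolding cl_def by (intro continuous_intros)
    then have "continuous_on UNIV (\<lambda>u. J y (cl u))"
      by (rule continuous_on_compose2[OF contJ]) (use cl in auto)
    then show "continuous_on UNIV (T y)" unfolding T_def by (intro continuous_intros)
    have "compact ((\<lambda>w. x0 + J y w - J y 0) ` {-e..e})"
      by (intro compact_continuous_image continuous_intros contJ) auto
    moreover have "range (T y) \<subseteq> (\<lambda>w. x0 + J y w - J y 0) ` {-e..e}" using cl by (auto simp: T_def)
    ultimately show "bounded (range (T y))" by (meson bounded_subset compact_imp_bounded)
  qed
  have Jdiff: "norm (J y w - J z w) \<le> 2 * e * L * dist y z" if "w \<in> {-e..e}" for y z w
  proof -
    have "J y w - J z w = integral {-e..w} (\<lambda>\<tau>. G (apply_bcontfun y \<tau>) - G (apply_bcontfun z \<tau>))"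
      unfolding J_def by (intro Henstock_Kurzweil_Integration.integral_diff[symmetric] integrable_continuous_interval Gy)
    also have "norm \<dots> \<le> L * dist y z * (w - (-e))"
    proof (rule integral_bound)
      show "norm (G (apply_bcontfun y \<tau>) - G (apply_bcontfun z \<tau>)) \<le> L * dist y z" for \<tau>
        using L[of "apply_bcontfun y \<tau>" "apply_bcontfun z \<tau>"] dist_bounded[of y \<tau> z] e
        by (smt (verit, best) dist_norm mult_left_mono)
    qed (use that in \<open>auto intro!: continuous_intros Gy\<close>)
    also have "\<dots> \<le> L * dist y z * (2 * e)" using that e by (intro mult_left_mono) auto
    finally show ?thesis by (simp add: algebra_simps)
  qed
  have "\<exists>!y. Bcontfun (T y) = y"
  proof (rule banach_fix_type[of "1/2"])
    show "\<forall>y z. dist (Bcontfun (T y)) (Bcontfun (T z)) \<le> 1/2 * dist y z"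
    proof (intro allI dist_bound)
      fix y z u
      have "dist (T y u) (T z u) = norm ((J y (cl u) - J z (cl u)) - (J y 0 - J z 0))"
        by (simp add: T_def dist_norm algebra_simps)
      also have "\<dots> \<le> 2 * e * L * dist y z + 2 * e * L * dist y z"
        by (rule order_trans[OF norm_triangle_ineq4]) (intro add_mono Jdiff, use cl e in auto)
      \<comment> \<open>Two integrals over intervals of length at most \<open>2 * e\<close>
        contribute, and \<open>8 * e * L \<le> 1\<close> is what turns their sum into the
        contraction factor 1/2.\<close>
      also have "\<dots> = (8 * e * L) * (1/2 * dist y z)" by simp
      also have "\<dots> \<le> 1 * (1/2 * dist y z)" using e by (intro mult_right_mono) auto
      finally show "dist (apply_bcontfun (Bcontfun (T y)) u) (apply_bcontfun (Bcontfun (T z)) u) \<le> 1/2 * dist y z"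
        using Tb by (simp add: Bcontfun_inverse)
    qed
  qed auto
  then obtain y where "Bcontfun (T y) = y" by blast
  then have y: "apply_bcontfun y u = T y u" for u by (metis Bcontfun_inverse Tb)
  show thesis
  proof
    show "apply_bcontfun y 0 = x0" using cl(2)[of 0] e by (subst y) (simp add: T_def)
    fix u assume u: "u \<in> {-e<..<e}"
    have "(J y has_vector_derivative G (apply_bcontfun y u)) (at u within {-e..e})"
      unfolding J_def by (rule integral_has_vector_derivative[OF Gy]) (use u in auto)
    then have "(J y has_vector_derivative G (apply_bcontfun y u)) (at u)"
      using u by (metis at_within_Icc_at greaterThanLessThan_iff)
    then have "((\<lambda>w. x0 + J y w - J y 0) has_vector_derivative G (apply_bcontfun y u)) (at u)"
      by (auto intro!: derivative_eq_intros)
    then show "(apply_bcontfun y has_vector_derivative G (apply_bcontfun y u)) (at u)"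
      by (rule has_vector_derivative_transform_within_open[OF _ open_greaterThanLessThan u])
        (use cl(2) in \<open>subst y, auto simp: T_def\<close>)
  qed
qed

text \<open>Picard's theorem; the field is made globally Lipschitz by composing it with the projection onto a ball.\<close>

lemma integral_curve_exists:
  fixes F :: "'e::euclidean_space \<Rightarrow> 'e"
  assumes "smooth_on S F" "open S" "x0 \<in> S"
  obtains y :: "real \<Rightarrow> 'e" and d where "d > 0" "y 0 = x0"
    "\<And>e. e \<le> d \<Longrightarrow> smooth_on {-e<..<e} y"
    "\<And>u. u \<in> {-d<..<d} \<Longrightarrow> y u \<in> S"
    "\<And>u. u \<in> {-d<..<d} \<Longrightarrow> (y has_vector_derivative F (y u)) (at u)"
proof -
  obtain R where R: "R > 0" "cball x0 R \<subseteq> S" using assms open_contains_cball by blast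
  define C where "C = cball x0 R"
  have C: "compact C" "convex C" "closed C" "C \<noteq> {}" "C \<subseteq> S" using R by (auto simp: C_def)
  obtain L where L: "L > 0" "\<And>x y. x \<in> C \<Longrightarrow> y \<in> C \<Longrightarrow> norm (F x - F y) \<le> L * norm (x - y)"
    using smooth_on_imp_lipschitz[OF assms(1,2) C(1,2,5)] by blast
  have "compact (F ` C)"
    by (rule compact_continuous_image[OF continuous_on_subset[OF smooth_on_continuous[OF assms(1)] C(5)] C(1)])
  then obtain K where K: "K > 0" "\<And>x. x \<in> C \<Longrightarrow> norm (F x) \<le> K"
    by (auto dest!: compact_imp_bounded simp: bounded_pos)
  define G where "G x = F (closest_point C x)" for x
  have cp: "closest_point C x \<in> C" for x using C closest_point_in_set by blast
  have GL: "norm (G x - G y) \<le> L * norm (x - y)" for x y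
  proof -
    have "norm (G x - G y) \<le> L * norm (closest_point C x - closest_point C y)"
      unfolding G_def by (rule L(2)[OF cp cp])
    also have "\<dots> \<le> L * norm (x - y)"
      using closest_point_lipschitz[OF C(2,3,4)] L(1) by (simp add: dist_norm mult_left_mono)
    finally show ?thesis .
  qed
  \<comment> \<open>The first bound makes the Picard map a contraction. The second keeps a curve of
    speed at most \<open>K\<close> inside the ball of radius \<open>R\<close>, where the projection
    is the identity and \<open>G\<close> agrees with \<open>F\<close>.\<close>
  define d where "d = min (1 / (8 * L)) (R / K)"
  have d: "d > 0" using L K R by (simp add: d_def)
  have "d \<le> 1 / (8 * L)" "d \<le> R / K" by (auto simp: d_def)
  then have dL: "8 * d * L \<le> 1" and dK: "K * d \<le> R" using L K by (auto simp: field_simps)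
  obtain y where y: "y 0 = x0" "\<And>u. u \<in> {-d<..<d} \<Longrightarrow> (y has_vector_derivative G (y u)) (at u)"
    using lipschitz_ode_solution[OF GL d L(1) dL] by blast
  have yC: "y u \<in> C" if u: "u \<in> {-d<..<d}" for u
  proof -
    have "norm (y u - y 0) \<le> K * norm (u - 0)"
    proof (rule differentiable_bound[of "{-d<..<d}" y "\<lambda>u h. h *\<^sub>R G (y u)"])
      show "(y has_derivative (\<lambda>h. h *\<^sub>R G (y w))) (at w within {-d<..<d})" if "w \<in> {-d<..<d}" for w
        using y(2)[OF that] by (simp add: has_vector_derivative_def has_derivative_at_withinI)
      show "onorm (\<lambda>h. h *\<^sub>R G (y w)) \<le> K" for w
        by (rule onorm_le) (use K(2)[OF cp] in \<open>simp add: G_def mult.commute[of K] mult_left_mono\<close>)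
    qed (use d u in auto)
    also have "\<dots> \<le> K * d" using K u by (intro mult_left_mono) auto
    finally show ?thesis using dK y(1) by (simp add: C_def dist_norm norm_minus_commute)
  qed
  have yF: "(y has_vector_derivative F (y u)) (at u)" if "u \<in> {-d<..<d}" for u
    using y(2)[OF that] closest_point_self[OF yC[OF that]] by (simp add: G_def)
  show thesis
  proof
    show "smooth_on {-e<..<e} y" if "e \<le> d" for e
      by (rule smooth_integral_curve[OF assms(1,2)]) (use that yC C(5) yF in auto)
  qed (use d y yC C yF in auto)
qed

section \<open>Functions, maps and vector fields on manifolds\<close>

lemma chart_inv_snd: "smooth_atlas M \<Longrightarrow> c \<in> M \<Longrightarrow> p \<in> fst c \<Longrightarrow> chart_inv c (snd c p) = p"
  by (simp add: chart_inv_def smooth_atlas_def)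

lemma chart_at: "p \<in> points M \<Longrightarrow> chart_at M p \<in> M \<and> p \<in> fst (chart_at M p)"
  unfolding chart_at_def points_def by (rule someI_ex) auto

lemma chart_subset_points: "c \<in> M \<Longrightarrow> fst c \<subseteq> points M"
  by (auto simp: points_def)

lemma openin_mtop_subset: "smooth_atlas M \<Longrightarrow> openin (mtop M) W \<Longrightarrow> W \<subseteq> points M"
  by (simp add: openin_mtop)

lemma open_chart_image: "smooth_atlas M \<Longrightarrow> openin (mtop M) W \<Longrightarrow> c \<in> M \<Longrightarrow> open (snd c ` (fst c \<inter> W))"
  by (simp add: openin_mtop)

lemma openin_chart: "smooth_atlas M \<Longrightarrow> c \<in> M \<Longrightarrow> openin (mtop M) (fst c)"
  by (auto simp: openin_mtop chart_subset_points smooth_atlas_def)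

lemma openin_points: "smooth_atlas M \<Longrightarrow> openin (mtop M) (points M)"
  using chart_subset_points by (fastforce simp: openin_mtop smooth_atlas_def Int_absorb2)

text \<open>Extends \<open>smooth_fun_on\<close> to values in a normed space, so that coordinate
  maps and frame components fall under the same calculus.\<close>

definition vsmooth_on ::
  "('a, 'e::euclidean_space) atlas \<Rightarrow> 'a set \<Rightarrow> ('a \<Rightarrow> 'b::real_normed_vector) \<Rightarrow> bool" where
  "vsmooth_on M W f \<longleftrightarrow> openin (mtop M) W \<and> (\<forall>c\<in>M. smooth_on (snd c ` (fst c \<inter> W)) (f \<circ> chart_inv c))"

lemma smooth_fun_on_eq: "smooth_fun_on M W f \<longleftrightarrow> vsmooth_on M W f"
  by (simp add: smooth_fun_on_def vsmooth_on_def)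

lemma vsmooth_onD: "vsmooth_on M W f \<Longrightarrow> openin (mtop M) W"
  by (simp add: vsmooth_on_def)

lemma vsmooth_onD_chart: "vsmooth_on M W f \<Longrightarrow> c \<in> M \<Longrightarrow> smooth_on (snd c ` (fst c \<inter> W)) (f \<circ> chart_inv c)"
  by (simp add: vsmooth_on_def)

lemma vsmooth_on_cong:
  assumes "smooth_atlas M" "vsmooth_on M W f" "\<And>p. p \<in> W \<Longrightarrow> f p = g p"
  shows "vsmooth_on M W g"
  unfolding vsmooth_on_def
proof (intro conjI ballI)
  fix c assume c: "c \<in> M"
  show "smooth_on (snd c ` (fst c \<inter> W)) (g \<circ> chart_inv c)"
    by (rule smooth_on_cong[of _ "f \<circ> chart_inv c"])
      (use c assms chart_inv_snd[OF assms(1) c] in \<open>auto simp: vsmooth_on_def open_chart_image\<close>)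
qed (use assms vsmooth_onD in blast)

lemma vsmooth_on_subset: "vsmooth_on M W f \<Longrightarrow> openin (mtop M) V \<Longrightarrow> V \<subseteq> W \<Longrightarrow> vsmooth_on M V f"
  unfolding vsmooth_on_def by (meson Int_mono image_mono order_refl smooth_on_subset)

lemma vsmooth_on_local:
  assumes M: "smooth_atlas M" and loc: "\<And>p. p \<in> W \<Longrightarrow> \<exists>U. p \<in> U \<and> U \<subseteq> W \<and> vsmooth_on M U f"
  shows "vsmooth_on M W f"
  unfolding vsmooth_on_def
proof (intro conjI ballI)
  have "\<exists>T. openin (mtop M) T \<and> p \<in> T \<and> T \<subseteq> W" if p: "p \<in> W" for p
  proof -
    obtain U where "p \<in> U" "U \<subseteq> W" "vsmooth_on M U f" using loc[OF p] by blast
    with vsmooth_onD[OF this(3)] show ?thesis by blast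
  qed
  then show "openin (mtop M) W" using openin_subopen by blast
  fix c assume c: "c \<in> M"
  show "smooth_on (snd c ` (fst c \<inter> W)) (f \<circ> chart_inv c)"
  proof (rule smooth_on_local)
    fix x assume "x \<in> snd c ` (fst c \<inter> W)"
    then obtain p where p: "p \<in> fst c" "p \<in> W" "x = snd c p" by auto
    then obtain U where "p \<in> U" "vsmooth_on M U f" using loc by blast
    then show "\<exists>U. open U \<and> x \<in> U \<and> smooth_on U (f \<circ> chart_inv c)"
      by (intro exI[of _ "snd c ` (fst c \<inter> U)"]) (use p c M in \<open>auto simp: vsmooth_on_def open_chart_image\<close>)
  qed
qed

lemma vsmooth_on_chart:
  assumes M: "smooth_atlas M" and c: "c \<in> M" and W: "openin (mtop M) W" "W \<subseteq> fst c"
    and f: "smooth_on (snd c ` W) (f \<circ> chart_inv c)"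
  shows "vsmooth_on M W f"
  unfolding vsmooth_on_def
proof (intro conjI ballI W)
  fix d assume d: "d \<in> M"
  have sub: "snd d ` (fst d \<inter> W) \<subseteq> snd d ` (fst d \<inter> fst c)" using W by auto
  have cW: "fst c \<inter> W = W" using W by auto
  have "smooth_on (snd d ` (fst d \<inter> W)) (\<lambda>x. (f \<circ> chart_inv c) ((snd c \<circ> chart_inv d) x))"
  proof (rule smooth_on_compose[OF _ f])
    show "smooth_on (snd d ` (fst d \<inter> W)) (snd c \<circ> chart_inv d)"
      using M c d smooth_on_subset[OF _ sub] by (auto simp: smooth_atlas_def)
    show "open (snd d ` (fst d \<inter> W))" by (rule open_chart_image[OF M W(1) d])
    show "open (snd c ` W)" using open_chart_image[OF M W(1) c] cW by simp
    show "(snd c \<circ> chart_inv d) ` snd d ` (fst d \<inter> W) \<subseteq> snd c ` W"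
      using chart_inv_snd[OF M d] by auto
  qed
  then show "smooth_on (snd d ` (fst d \<inter> W)) (f \<circ> chart_inv d)"
  proof (rule smooth_on_cong[OF open_chart_image[OF M W(1) d], rotated])
    show "(f \<circ> chart_inv c) ((snd c \<circ> chart_inv d) x) = (f \<circ> chart_inv d) x" if "x \<in> snd d ` (fst d \<inter> W)" for x
      using that chart_inv_snd[OF M d] chart_inv_snd[OF M c] W(2) by auto
  qed
qed

lemma vsmooth_on_snd: "smooth_atlas M \<Longrightarrow> c \<in> M \<Longrightarrow> vsmooth_on M (fst c) (snd c)"
proof (rule vsmooth_on_chart)
  assume M: "smooth_atlas M" "c \<in> M"
  then have o: "open (snd c ` fst c)" by (simp add: smooth_atlas_def)
  show "smooth_on (snd c ` fst c) (snd c \<circ> chart_inv c)"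
    by (rule smooth_on_cong[OF o _ smooth_on_id[OF o]]) (use chart_inv_snd[OF M] in auto)
qed (auto intro: openin_chart)

section \<open>Algebra and differentials of smooth functions\<close>

context
  fixes M :: "('a, 'e::euclidean_space) atlas"
  assumes M: "smooth_atlas M"
begin

lemma vsmooth_on_const: "openin (mtop M) W \<Longrightarrow> vsmooth_on M W (\<lambda>p. v)"
  unfolding vsmooth_on_def comp_def by (intro conjI ballI smooth_on_const open_chart_image[OF M]) auto

lemma vsmooth_on_add: "vsmooth_on M W f \<Longrightarrow> vsmooth_on M W g \<Longrightarrow> vsmooth_on M W (\<lambda>p. f p + g p)"
  unfolding vsmooth_on_def comp_def by (intro conjI ballI smooth_on_add open_chart_image[OF M]) auto

lemma vsmooth_on_sum:
  "openin (mtop M) W \<Longrightarrow> (\<And>i. i \<in> I \<Longrightarrow> vsmooth_on M W (f i)) \<Longrightarrow> vsmooth_on M W (\<lambda>p. \<Sum>i\<in>I. f i p)"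
  unfolding vsmooth_on_def comp_def by (intro conjI ballI smooth_on_sum open_chart_image[OF M]) auto

lemma vsmooth_on_linear: "bounded_linear L \<Longrightarrow> vsmooth_on M W f \<Longrightarrow> vsmooth_on M W (\<lambda>p. L (f p))"
  unfolding vsmooth_on_def comp_def by (intro conjI ballI smooth_on_linear[of L] open_chart_image[OF M]) auto

lemma vsmooth_on_bilinear:
  "bounded_bilinear B \<Longrightarrow> vsmooth_on M W f \<Longrightarrow> vsmooth_on M W g \<Longrightarrow> vsmooth_on M W (\<lambda>p. B (f p) (g p))"
  unfolding vsmooth_on_def comp_def by (intro conjI ballI smooth_on_bilinear[of B] open_chart_image[OF M]) auto

lemma vsmooth_on_Pair: "vsmooth_on M W f \<Longrightarrow> vsmooth_on M W g \<Longrightarrow> vsmooth_on M W (\<lambda>p. (f p, g p))"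
  unfolding vsmooth_on_def comp_def by (intro conjI ballI smooth_on_Pair open_chart_image[OF M]) auto

lemma openin_vsmooth_preimage:
  assumes f: "vsmooth_on M W f" and T: "open T"
  shows "openin (mtop M) {p \<in> W. f p \<in> T}"
  unfolding openin_mtop[OF M]
proof (intro conjI ballI)
  show "{p \<in> W. f p \<in> T} \<subseteq> points M"
    using openin_mtop_subset[OF M vsmooth_onD[OF f]] by blast
  fix c assume c: "c \<in> M"
  have o: "open (snd c ` (fst c \<inter> W))" by (rule open_chart_image[OF M vsmooth_onD[OF f] c])
  have "continuous_on (snd c ` (fst c \<inter> W)) (f \<circ> chart_inv c)"
    by (rule smooth_on_continuous) (use f c in \<open>auto simp: vsmooth_on_def\<close>)
  then have "open (snd c ` (fst c \<inter> W) \<inter> (f \<circ> chart_inv c) -` T)"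
    using continuous_on_open_vimage[OF o] T by (metis Int_commute)
  also have "snd c ` (fst c \<inter> W) \<inter> (f \<circ> chart_inv c) -` T = snd c ` (fst c \<inter> {p \<in> W. f p \<in> T})"
    using chart_inv_snd[OF M c] by auto
  finally show "open (snd c ` (fst c \<inter> {p \<in> W. f p \<in> T}))" .
qed

lemma vsmooth_on_compose:
  fixes g :: "'b::euclidean_space \<Rightarrow> 'c::real_normed_vector"
  assumes f: "vsmooth_on M W f" and g: "smooth_on T g" "open T" "f ` W \<subseteq> T"
  shows "vsmooth_on M W (\<lambda>p. g (f p))"
  unfolding vsmooth_on_def
proof (intro conjI ballI vsmooth_onD[OF f])
  fix c assume c: "c \<in> M"
  have "smooth_on (snd c ` (fst c \<inter> W)) (\<lambda>x. g ((f \<circ> chart_inv c) x))"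
    by (rule smooth_on_compose[OF vsmooth_onD_chart[OF f c] g(1) open_chart_image[OF M vsmooth_onD[OF f] c] g(2)])
      (use g(3) chart_inv_snd[OF M c] in auto)
  then show "smooth_on (snd c ` (fst c \<inter> W)) ((\<lambda>p. g (f p)) \<circ> chart_inv c)" by (simp add: comp_def)
qed

lemma vsmooth_on_directional:
  fixes F :: "'b::euclidean_space \<Rightarrow> 'c::real_normed_vector" and g w :: "'a \<Rightarrow> 'b"
  assumes F: "smooth_on T F" "open T" and g: "vsmooth_on M W g" "g ` W \<subseteq> T" and w: "vsmooth_on M W w"
  shows "vsmooth_on M W (\<lambda>p. frechet_derivative F (at (g p)) (w p))"
  unfolding vsmooth_on_def
proof (intro conjI ballI vsmooth_onD[OF w])
  fix c assume c: "c \<in> M"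
  have "smooth_on (snd c ` (fst c \<inter> W)) (\<lambda>x. frechet_derivative F (at ((g \<circ> chart_inv c) x)) ((w \<circ> chart_inv c) x))"
    by (rule smooth_on_derivative'[OF F(1) vsmooth_onD_chart[OF g(1) c] vsmooth_onD_chart[OF w c]
          open_chart_image[OF M vsmooth_onD[OF w] c] F(2)])
      (use g(2) chart_inv_snd[OF M c] in auto)
  then show "smooth_on (snd c ` (fst c \<inter> W)) ((\<lambda>p. frechet_derivative F (at (g p)) (w p)) \<circ> chart_inv c)"
    by (simp add: comp_def)
qed

lemma dfun_cong:
  assumes "openin (mtop M) W" "p \<in> W" "\<And>q. q \<in> W \<Longrightarrow> f q = g q"
  shows "dfun M f p = dfun M g p"
proof -
  have p: "p \<in> points M" using assms openin_mtop_subset[OF M] by blast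
  let ?c = "chart_at M p"
  have c: "?c \<in> M" "p \<in> fst ?c" using chart_at[OF p] by auto
  have "frechet_derivative (f \<circ> chart_inv ?c) (at (snd ?c p)) = frechet_derivative (g \<circ> chart_inv ?c) (at (snd ?c p))"
    by (rule frechet_derivative_cong[OF open_chart_image[OF M assms(1) c(1)]])
      (use assms c chart_inv_snd[OF M c(1)] in auto)
  then show ?thesis by (auto simp: dfun_def)
qed

lemma dfun_has_derivative:
  assumes "vsmooth_on M W f" "p \<in> W"
  shows "(f \<circ> chart_inv (chart_at M p) has_derivative dfun M f p) (at (snd (chart_at M p) p))"
proof -
  have p: "p \<in> points M" using assms openin_mtop_subset[OF M] vsmooth_onD by blast
  let ?c = "chart_at M p"
  have c: "?c \<in> M" "p \<in> fst ?c" using chart_at[OF p] by auto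
  have "smooth_on (snd ?c ` (fst ?c \<inter> W)) (f \<circ> chart_inv ?c)" using assms c by (auto simp: vsmooth_on_def)
  then have "(f \<circ> chart_inv ?c has_derivative frechet_derivative (f \<circ> chart_inv ?c) (at (snd ?c p))) (at (snd ?c p))"
    by (rule smooth_on_has_derivative) (use c assms in auto)
  then show ?thesis by (simp add: dfun_def[abs_def])
qed

lemma dfun_eqI:
  "(f \<circ> chart_inv (chart_at M p) has_derivative D) (at (snd (chart_at M p) p)) \<Longrightarrow> dfun M f p = D"
  using frechet_derivative_at by (fastforce simp: dfun_def)

lemma dfun_linear: "vsmooth_on M W f \<Longrightarrow> p \<in> W \<Longrightarrow> linear (dfun M f p)"
  using dfun_has_derivative has_derivative_linear by blast

lemma dfun_const: "dfun M (\<lambda>q. a) p v = 0"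
  using dfun_eqI[of "\<lambda>q. a" p "\<lambda>v. 0"] by (simp add: comp_def)

lemma dfun_add:
  "vsmooth_on M W f \<Longrightarrow> vsmooth_on M W g \<Longrightarrow> p \<in> W \<Longrightarrow>
    dfun M (\<lambda>q. f q + g q) p v = dfun M f p v + dfun M g p v"
  using dfun_eqI[of "\<lambda>q. f q + g q"] has_derivative_add[OF dfun_has_derivative dfun_has_derivative, of W f p W g]
  by (simp add: comp_def)

lemma dfun_comp_linear:
  "bounded_linear L \<Longrightarrow> vsmooth_on M W f \<Longrightarrow> p \<in> W \<Longrightarrow> dfun M (\<lambda>q. L (f q)) p v = L (dfun M f p v)"
  using dfun_eqI[of "\<lambda>q. L (f q)"] bounded_linear.has_derivative[OF _ dfun_has_derivative, of L W f p]
  by (simp add: comp_def)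

lemma dfun_bilinear:
  "bounded_bilinear B \<Longrightarrow> vsmooth_on M W f \<Longrightarrow> vsmooth_on M W g \<Longrightarrow> p \<in> W \<Longrightarrow>
    dfun M (\<lambda>q. B (f q) (g q)) p v = B (f p) (dfun M g p v) + B (dfun M f p v) (g p)"
proof -
  assume a: "bounded_bilinear B" "vsmooth_on M W f" "vsmooth_on M W g" "p \<in> W"
  then have "p \<in> points M" using openin_mtop_subset[OF M vsmooth_onD[OF a(2)]] by blast
  then have "chart_inv (chart_at M p) (snd (chart_at M p) p) = p" using chart_inv_snd[OF M] chart_at[of p M] by auto
  then show ?thesis
    using dfun_eqI[of "\<lambda>q. B (f q) (g q)"] bounded_bilinear.FDERIV[OF a(1) dfun_has_derivative[OF a(2,4)] dfun_has_derivative[OF a(3,4)]]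
    by (simp add: comp_def)
qed

lemma dfun_sum:
  "(\<And>i. i \<in> I \<Longrightarrow> vsmooth_on M W (f i)) \<Longrightarrow> p \<in> W \<Longrightarrow> dfun M (\<lambda>q. \<Sum>i\<in>I. f i q) p v = (\<Sum>i\<in>I. dfun M (f i) p v)"
proof -
  assume a: "\<And>i. i \<in> I \<Longrightarrow> vsmooth_on M W (f i)" "p \<in> W"
  have "((\<lambda>x. \<Sum>i\<in>I. (f i \<circ> chart_inv (chart_at M p)) x) has_derivative (\<lambda>v. \<Sum>i\<in>I. dfun M (f i) p v))
      (at (snd (chart_at M p) p))"
    by (intro has_derivative_sum dfun_has_derivative[of W] a)
  then show ?thesis using dfun_eqI[of "\<lambda>q. \<Sum>i\<in>I. f i q" p] by (simp add: comp_def)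
qed

text \<open>Chain rule through the transition from the preferred chart:
  \<open>dfun M (snd c) p v\<close> are the components of \<open>v\<close> in \<open>c\<close>, so
  differentials may be computed in any chart.\<close>

lemma dfun_in_chart:
  assumes f: "vsmooth_on M W f" "p \<in> W" and c: "c \<in> M" "p \<in> fst c"
  shows "dfun M f p v = frechet_derivative (f \<circ> chart_inv c) (at (snd c p)) (dfun M (snd c) p v)"
proof -
  have p: "p \<in> points M" using c chart_subset_points by blast
  let ?c = "chart_at M p"
  have c0: "?c \<in> M" "p \<in> fst ?c" using chart_at[OF p] by auto
  have 1: "(snd c \<circ> chart_inv ?c has_derivative dfun M (snd c) p) (at (snd ?c p))"
    by (rule dfun_has_derivative[OF vsmooth_on_snd[OF M c(1)] c(2)])
  have "smooth_on (snd c ` (fst c \<inter> W)) (f \<circ> chart_inv c)" using f c by (auto simp: vsmooth_on_def)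
  then have 2: "(f \<circ> chart_inv c has_derivative frechet_derivative (f \<circ> chart_inv c) (at (snd c p))) (at (snd c p))"
    by (rule smooth_on_has_derivative) (use f c in auto)
  have 3: "snd c p = (snd c \<circ> chart_inv ?c) (snd ?c p)" using chart_inv_snd[OF M c0] by simp
  have "((f \<circ> chart_inv c) \<circ> (snd c \<circ> chart_inv ?c) has_derivative
      frechet_derivative (f \<circ> chart_inv c) (at (snd c p)) \<circ> dfun M (snd c) p) (at (snd ?c p))"
    by (rule diff_chain_at[OF 1]) (use 2 3 in simp)
  then have "(f \<circ> chart_inv ?c has_derivative
      frechet_derivative (f \<circ> chart_inv c) (at (snd c p)) \<circ> dfun M (snd c) p) (at (snd ?c p))"
  proof (rule has_derivative_transform_within_open)
    show "open (snd ?c ` (fst ?c \<inter> (W \<inter> fst c)))"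
      by (rule open_chart_image[OF M openin_Int[OF vsmooth_onD[OF f(1)] openin_chart[OF M c(1)]] c0(1)])
  qed (use f c c0 chart_inv_snd[OF M c(1)] chart_inv_snd[OF M c0(1)] in auto)
  from dfun_eqI[OF this] show ?thesis by simp
qed

lemma dfun_chart_at:
  assumes "p \<in> points M"
  shows "dfun M (snd (chart_at M p)) p v = v"
proof -
  let ?c = "chart_at M p"
  have c: "?c \<in> M" "p \<in> fst ?c" using chart_at[OF assms] by auto
  have "((\<lambda>x. x) has_derivative (\<lambda>v. v)) (at (snd ?c p))" by (rule has_derivative_ident)
  then have "(snd ?c \<circ> chart_inv ?c has_derivative (\<lambda>v. v)) (at (snd ?c p))"
  proof (rule has_derivative_transform_within_open)
    show "open (snd ?c ` fst ?c)" using M c by (auto simp: smooth_atlas_def)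
  qed (use c chart_inv_snd[OF M c(1)] in auto)
  from dfun_eqI[OF this] show ?thesis by simp
qed

lemma coord_field_component:
  assumes c: "c \<in> M" "p \<in> fst c"
  shows "coord_field M c (dfun M (snd c) p v) p = v" "dfun M (snd c) p (coord_field M c v p) = v"
proof -
  have p: "p \<in> points M" using c chart_subset_points by blast
  let ?c = "chart_at M p"
  have c0: "?c \<in> M" "p \<in> fst ?c" using chart_at[OF p] by auto
  show 1: "coord_field M c (dfun M (snd c) p v) p = v" for v
    using dfun_in_chart[OF vsmooth_on_snd[OF M c0(1)] c0(2) c, of v] dfun_chart_at[OF p, of v]
    by (simp add: coord_field_def)
  have lin: "linear (dfun M (snd c) p)" by (rule dfun_linear[OF vsmooth_on_snd[OF M c(1)] c(2)])
  \<comment> \<open>In finite dimension the injective linear map is onto, which turns the left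
    inverse just found into a two-sided one.\<close>
  have "inj (dfun M (snd c) p)" using 1 by (metis injI)
  then have "surj (dfun M (snd c) p)" using lin linear_injective_imp_surjective by blast
  then obtain w where "v = dfun M (snd c) p w" by (metis surjD)
  then show "dfun M (snd c) p (coord_field M c v p) = v" using 1 by simp
qed

lemma tangent_eqI: "c \<in> M \<Longrightarrow> p \<in> fst c \<Longrightarrow> dfun M (snd c) p u = dfun M (snd c) p v \<Longrightarrow> u = v"
  by (metis coord_field_component(1))

end

section \<open>Smooth maps and their differentials\<close>

lemma smooth_map_points: "smooth_map M N \<phi> \<Longrightarrow> p \<in> points M \<Longrightarrow> \<phi> p \<in> points N"
  by (auto simp: smooth_map_def)

context
  fixes M :: "('a, 'e::euclidean_space) atlas" and N :: "('b, 'f::euclidean_space) atlas"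
  assumes M: "smooth_atlas M" and N: "smooth_atlas N"
begin

lemma smooth_map_snd:
  assumes "smooth_map M N \<phi>" "d \<in> N"
  shows "vsmooth_on M {p \<in> points M. \<phi> p \<in> fst d} (\<lambda>p. snd d (\<phi> p))"
  unfolding vsmooth_on_def openin_mtop[OF M]
proof (intro conjI ballI)
  have eq: "fst c \<inter> {p \<in> points M. \<phi> p \<in> fst d} = fst c \<inter> \<phi> -` fst d" if "c \<in> M" for c
    using chart_subset_points[OF that] by auto
  fix c assume c: "c \<in> M"
  show "open (snd c ` (fst c \<inter> {p \<in> points M. \<phi> p \<in> fst d}))"
    using assms c by (simp add: eq smooth_map_def)
  have "smooth_on (snd c ` (fst c \<inter> \<phi> -` fst d)) (snd d \<circ> \<phi> \<circ> chart_inv c)"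
    using assms c by (simp add: smooth_map_def)
  then show "smooth_on (snd c ` (fst c \<inter> {p \<in> points M. \<phi> p \<in> fst d})) ((\<lambda>p. snd d (\<phi> p)) \<circ> chart_inv c)"
    using c by (simp add: eq comp_def)
qed auto

lemma smooth_map_vsmooth:
  assumes \<phi>: "smooth_map M N \<phi>" and f: "vsmooth_on N W f"
  shows "vsmooth_on M {p \<in> points M. \<phi> p \<in> W} (\<lambda>p. f (\<phi> p))"
proof (rule vsmooth_on_local[OF M])
  fix p assume p: "p \<in> {p \<in> points M. \<phi> p \<in> W}"
  let ?d = "chart_at N (\<phi> p)"
  have d: "?d \<in> N" "\<phi> p \<in> fst ?d" using chart_at[OF smooth_map_points[OF \<phi>, of p]] p by auto
  let ?U = "{q \<in> {q \<in> points M. \<phi> q \<in> fst ?d}. snd ?d (\<phi> q) \<in> snd ?d ` (fst ?d \<inter> W)}"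
  note s = smooth_map_snd[OF \<phi> d(1)]
  have oW: "open (snd ?d ` (fst ?d \<inter> W))" by (rule open_chart_image[OF N vsmooth_onD[OF f] d(1)])
  have U: "openin (mtop M) ?U" by (rule openin_vsmooth_preimage[OF M s oW])
  have UW: "\<phi> q \<in> W" if "q \<in> ?U" for q
  proof -
    from that obtain r where "r \<in> fst ?d" "r \<in> W" "snd ?d (\<phi> q) = snd ?d r" by auto
    then show ?thesis using that chart_inv_snd[OF N d(1)] by (metis (mono_tags, lifting) mem_Collect_eq)
  qed
  have "vsmooth_on M ?U (\<lambda>q. (f \<circ> chart_inv ?d) (snd ?d (\<phi> q)))"
    by (rule vsmooth_on_compose[OF M vsmooth_on_subset[OF s U] vsmooth_onD_chart[OF f d(1)] oW]) auto
  then have 3: "vsmooth_on M ?U (\<lambda>q. f (\<phi> q))"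
    by (rule vsmooth_on_cong[OF M]) (use chart_inv_snd[OF N d(1)] in auto)
  have 1: "p \<in> ?U" using p d by auto
  have 2: "?U \<subseteq> {p \<in> points M. \<phi> p \<in> W}" using UW openin_mtop_subset[OF M U] by blast
  show "\<exists>U. p \<in> U \<and> U \<subseteq> {p \<in> points M. \<phi> p \<in> W} \<and> vsmooth_on M U (\<lambda>p. f (\<phi> p))"
    by (rule exI[of _ ?U], rule conjI[OF 1 conjI[OF 2 3]])
qed

text \<open>One chart of the target around each image point suffices, because any other chart
  \<open>e\<close> is reached from it by a smooth transition map; openness of the preimage of
  \<open>fst e\<close> comes out of the same argument.\<close>

lemma smooth_mapI:
  assumes "\<And>p. p \<in> points M \<Longrightarrow> \<exists>d\<in>N. \<exists>U. p \<in> U \<and> \<phi> ` U \<subseteq> fst d \<and> vsmooth_on M U (\<lambda>q. snd d (\<phi> q))"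
  shows "smooth_map M N \<phi>"
proof -
  have key: "vsmooth_on M {p \<in> points M. \<phi> p \<in> fst e} (\<lambda>p. snd e (\<phi> p))" if e: "e \<in> N" for e
  proof (rule vsmooth_on_local[OF M])
    fix p assume p: "p \<in> {p \<in> points M. \<phi> p \<in> fst e}"
    then obtain d U where d: "d \<in> N" and U: "p \<in> U" "\<phi> ` U \<subseteq> fst d" "vsmooth_on M U (\<lambda>q. snd d (\<phi> q))"
      using assms by blast
    note e' = vsmooth_on_snd[OF N e]
    let ?V = "{q \<in> U. snd d (\<phi> q) \<in> snd d ` (fst d \<inter> fst e)}"
    have oW: "open (snd d ` (fst d \<inter> fst e))" by (rule open_chart_image[OF N vsmooth_onD[OF e'] d])
    have V: "openin (mtop M) ?V" by (rule openin_vsmooth_preimage[OF M U(3) oW])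
    have VW: "\<phi> q \<in> fst e" if "q \<in> ?V" for q
    proof -
      from that obtain r where "r \<in> fst d" "r \<in> fst e" "snd d (\<phi> q) = snd d r" by auto
      then show ?thesis using that U(2) chart_inv_snd[OF N d] by (metis (mono_tags, lifting) image_subset_iff mem_Collect_eq)
    qed
    have c: "vsmooth_on M ?V (\<lambda>q. (snd e \<circ> chart_inv d) (snd d (\<phi> q)))"
      by (rule vsmooth_on_compose[OF M vsmooth_on_subset[OF U(3) V] vsmooth_onD_chart[OF e' d] oW]) auto
    have inv: "chart_inv d (snd d (\<phi> q)) = \<phi> q" if "q \<in> U" for q
      using U(2) that chart_inv_snd[OF N d] by blast
    have 3: "vsmooth_on M ?V (\<lambda>q. snd e (\<phi> q))"
      by (rule vsmooth_on_cong[OF M c]) (simp add: inv)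
    have 1: "p \<in> ?V" using p U by auto
    have 2: "?V \<subseteq> {p \<in> points M. \<phi> p \<in> fst e}"
      using VW openin_mtop_subset[OF M V] by blast
    show "\<exists>U. p \<in> U \<and> U \<subseteq> {p \<in> points M. \<phi> p \<in> fst e} \<and> vsmooth_on M U (\<lambda>p. snd e (\<phi> p))"
      by (rule exI[of _ ?V], rule conjI[OF 1 conjI[OF 2 3]])
  qed
  show ?thesis
    unfolding smooth_map_def
  proof (intro conjI ballI)
    show "\<phi> ` points M \<subseteq> points N" using assms chart_subset_points by fast
    fix c d assume c: "c \<in> M" and d: "d \<in> N"
    have eq: "fst c \<inter> {p \<in> points M. \<phi> p \<in> fst d} = fst c \<inter> \<phi> -` fst d"
      using chart_subset_points[OF c] by auto
    show "open (snd c ` (fst c \<inter> \<phi> -` fst d))"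
      using open_chart_image[OF M vsmooth_onD[OF key[OF d]] c] by (simp add: eq)
    show "smooth_on (snd c ` (fst c \<inter> \<phi> -` fst d)) (snd d \<circ> \<phi> \<circ> chart_inv c)"
      using vsmooth_onD_chart[OF key[OF d] c, unfolded eq] by (simp add: comp_def)
  qed
qed

lemma dfun_tmap:
  assumes \<phi>: "smooth_map M N \<phi>" "p \<in> points M" and f: "vsmooth_on N W f" "\<phi> p \<in> W"
  shows "dfun N f (\<phi> p) (tmap M N \<phi> p v) = dfun M (\<lambda>q. f (\<phi> q)) p v"
proof -
  let ?c = "chart_at M p" and ?d = "chart_at N (\<phi> p)"
  have c: "?c \<in> M" "p \<in> fst ?c" using chart_at[OF \<phi>(2)] by auto
  have d: "?d \<in> N" "\<phi> p \<in> fst ?d" using chart_at[OF smooth_map_points[OF \<phi>]] by auto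
  have 1: "((\<lambda>q. snd ?d (\<phi> q)) \<circ> chart_inv ?c has_derivative tmap M N \<phi> p) (at (snd ?c p))"
    using dfun_has_derivative[OF M smooth_map_snd[OF \<phi>(1) d(1)], of p] \<phi>(2) d(2)
    by (simp add: dfun_def[abs_def] tmap_def[abs_def] comp_def)
  have 2: "(f \<circ> chart_inv ?d has_derivative dfun N f (\<phi> p)) (at (snd ?d (\<phi> p)))"
    by (rule dfun_has_derivative[OF N f])
  have 3: "snd ?d (\<phi> p) = ((\<lambda>q. snd ?d (\<phi> q)) \<circ> chart_inv ?c) (snd ?c p)" using chart_inv_snd[OF M c] by simp
  have "((f \<circ> chart_inv ?d) \<circ> ((\<lambda>q. snd ?d (\<phi> q)) \<circ> chart_inv ?c) has_derivative
      dfun N f (\<phi> p) \<circ> tmap M N \<phi> p) (at (snd ?c p))"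
    by (rule diff_chain_at[OF 1]) (use 2 3 in simp)
  then have "((\<lambda>q. f (\<phi> q)) \<circ> chart_inv ?c has_derivative dfun N f (\<phi> p) \<circ> tmap M N \<phi> p) (at (snd ?c p))"
  proof (rule has_derivative_transform_within_open)
    show "open (snd ?c ` (fst ?c \<inter> {q \<in> points M. \<phi> q \<in> fst ?d}))"
      by (rule open_chart_image[OF M vsmooth_onD[OF smooth_map_snd[OF \<phi>(1) d(1)]] c(1)])
  qed (use \<phi>(2) c d chart_inv_snd[OF M c(1)] chart_inv_snd[OF N d(1)] in auto)
  from dfun_eqI[OF M this] show ?thesis by simp
qed

lemma tmap_eqI:
  assumes \<phi>: "smooth_map M N \<phi>" "p \<in> points M"
    and d: "d \<in> N" "\<phi> p \<in> fst d" "dfun M (\<lambda>q. snd d (\<phi> q)) p v = dfun N (snd d) (\<phi> p) w"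
  shows "tmap M N \<phi> p v = w"
  by (rule tangent_eqI[OF N d(1,2)]) (simp add: dfun_tmap[OF \<phi> vsmooth_on_snd[OF N d(1)] d(2)] d(3))

lemma tmap_linear:
  assumes \<phi>: "smooth_map M N \<phi>" "p \<in> points M"
  shows "linear (tmap M N \<phi> p)"
proof -
  let ?d = "chart_at N (\<phi> p)"
  have d: "?d \<in> N" "\<phi> p \<in> fst ?d" using chart_at[OF smooth_map_points[OF \<phi>]] by auto
  have "linear (dfun M (\<lambda>q. snd ?d (\<phi> q)) p)"
    by (rule dfun_linear[OF M smooth_map_snd[OF \<phi>(1) d(1)]]) (use \<phi> d in auto)
  then show ?thesis by (simp add: dfun_def[abs_def] tmap_def[abs_def] comp_def)
qed

lemma tmap_cong:
  assumes "openin (mtop M) U" "p \<in> U" "\<And>q. q \<in> U \<Longrightarrow> \<phi> q = \<psi> q"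
  shows "tmap M N \<phi> p v = tmap M N \<psi> p v"
proof -
  have "dfun M (\<lambda>q. snd (chart_at N (\<phi> p)) (\<phi> q)) p v = dfun M (\<lambda>q. snd (chart_at N (\<phi> p)) (\<psi> q)) p v"
    by (subst dfun_cong[OF M assms(1,2)]) (auto simp: assms(3))
  then show ?thesis using assms(3)[OF assms(2)] by (simp add: dfun_def tmap_def comp_def)
qed

lemma smooth_map_cong:
  assumes "smooth_map M N \<phi>" "\<And>q. q \<in> points M \<Longrightarrow> \<phi> q = \<psi> q"
  shows "smooth_map M N \<psi>"
proof (rule smooth_mapI)
  fix p assume p: "p \<in> points M"
  let ?d = "chart_at N (\<phi> p)"
  have d: "?d \<in> N" "\<phi> p \<in> fst ?d" using chart_at[OF smooth_map_points[OF assms(1) p]] by auto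
  have "vsmooth_on M {p \<in> points M. \<phi> p \<in> fst ?d} (\<lambda>q. snd ?d (\<psi> q))"
    by (rule vsmooth_on_cong[OF M smooth_map_snd[OF assms(1) d(1)]]) (use assms in auto)
  then show "\<exists>d\<in>N. \<exists>U. p \<in> U \<and> \<psi> ` U \<subseteq> fst d \<and> vsmooth_on M U (\<lambda>q. snd d (\<psi> q))"
    using d p assms(2) by (intro bexI[of _ ?d] exI[of _ "{p \<in> points M. \<phi> p \<in> fst ?d}"]) auto
qed

lemma smooth_map_const: "q \<in> points N \<Longrightarrow> smooth_map M N (\<lambda>p. q)"
  using chart_at[of q N]
  by (intro smooth_mapI bexI[of _ "chart_at N q"] exI[of _ "points M"])
    (auto intro!: vsmooth_on_const[OF M] openin_points[OF M])

lemma tmap_const: "q \<in> points N \<Longrightarrow> p \<in> points M \<Longrightarrow> tmap M N (\<lambda>p. q) p v = 0"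
  using tmap_eqI[OF smooth_map_const, of q p "chart_at N q" v 0] chart_at[of q N]
    linear_0[OF dfun_linear[OF N vsmooth_on_snd[OF N], of "chart_at N q" q]]
  by (simp add: dfun_const[OF M])

end

lemma smooth_map_id: "smooth_atlas M \<Longrightarrow> smooth_map M M (\<lambda>p. p)"
  using chart_at[of _ M] vsmooth_on_snd[of M]
  by (intro smooth_mapI) blast+

lemma tmap_id: "smooth_atlas M \<Longrightarrow> p \<in> points M \<Longrightarrow> tmap M M (\<lambda>p. p) p v = v"
  using chart_at[of p M] by (intro tmap_eqI[of M M _ _ "chart_at M p"] smooth_map_id) auto

context
  fixes M :: "('a, 'e::euclidean_space) atlas" and N :: "('b, 'f::euclidean_space) atlas"
    and P :: "('c, 'g::euclidean_space) atlas" and \<phi> \<psi>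
  assumes M: "smooth_atlas M" and N: "smooth_atlas N" and P: "smooth_atlas P"
    and \<phi>: "smooth_map M N \<phi>" and \<psi>: "smooth_map N P \<psi>"
begin

lemma smooth_map_compose: "smooth_map M P (\<lambda>p. \<psi> (\<phi> p))"
proof (rule smooth_mapI[OF M P])
  fix p assume p: "p \<in> points M"
  let ?d = "chart_at P (\<psi> (\<phi> p))"
  have d: "?d \<in> P" "\<psi> (\<phi> p) \<in> fst ?d"
    using chart_at[OF smooth_map_points[OF \<psi> smooth_map_points[OF \<phi> p]]] by auto
  note s = smooth_map_vsmooth[OF M N \<phi> smooth_map_snd[OF N P \<psi> d(1)]]
  then show "\<exists>d\<in>P. \<exists>U. p \<in> U \<and> (\<lambda>p. \<psi> (\<phi> p)) ` U \<subseteq> fst d \<and> vsmooth_on M U (\<lambda>q. snd d (\<psi> (\<phi> q)))"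
    using d p smooth_map_points[OF \<phi>] by (intro bexI[of _ ?d] exI[of _ "{p \<in> points M. \<phi> p \<in> {q \<in> points N. \<psi> q \<in> fst ?d}}"]) auto
qed

lemma tmap_compose:
  assumes p: "p \<in> points M"
  shows "tmap M P (\<lambda>p. \<psi> (\<phi> p)) p v = tmap N P \<psi> (\<phi> p) (tmap M N \<phi> p v)"
proof -
  let ?d = "chart_at P (\<psi> (\<phi> p))"
  have q: "\<phi> p \<in> points N" by (rule smooth_map_points[OF \<phi> p])
  have d: "?d \<in> P" "\<psi> (\<phi> p) \<in> fst ?d"
    using chart_at[OF smooth_map_points[OF \<psi> q]] by auto
  show ?thesis
    by (rule tmap_eqI[OF M P smooth_map_compose p d])
      (use dfun_tmap[OF N P \<psi> q vsmooth_on_snd[OF P d(1)] d(2)] dfun_tmap[OF M N \<phi> p smooth_map_snd[OF N P \<psi> d(1)]] q d in auto)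
qed

end

text \<open>Sections of the pullback of the tangent bundle along \<open>b\<close>: vector fields
  when \<open>b\<close> is the identity, a moving vector in one tangent space when \<open>b\<close>
  is constant. Pairs of such sections are fed into the derivative of the group
  multiplication.\<close>

definition section_on ::
  "('s, 'f::euclidean_space) atlas \<Rightarrow> 's set \<Rightarrow> ('a, 'e::euclidean_space) atlas \<Rightarrow> ('s \<Rightarrow> 'a) \<Rightarrow> ('s \<Rightarrow> 'e) \<Rightarrow> bool" where
  "section_on S W M b V \<longleftrightarrow> openin (mtop S) W \<and>
     (\<forall>d\<in>M. vsmooth_on S {s \<in> W. b s \<in> fst d} (\<lambda>s. dfun M (snd d) (b s) (V s)))"

context
  fixes S :: "('s, 'f::euclidean_space) atlas" and M :: "('a, 'e::euclidean_space) atlas" and b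
  assumes S: "smooth_atlas S" and M: "smooth_atlas M" and b: "smooth_map S M b"
begin

lemma section_on_dfun:
  assumes V: "section_on S W M b V" and f: "vsmooth_on M U f"
  shows "vsmooth_on S {s \<in> W. b s \<in> U} (\<lambda>s. dfun M f (b s) (V s))"
proof (rule vsmooth_on_local[OF S])
  fix s assume s: "s \<in> {s \<in> W. b s \<in> U}"
  have W: "openin (mtop S) W" using V by (simp add: section_on_def)
  have WS: "W \<subseteq> points S" by (rule openin_mtop_subset[OF S W])
  let ?d = "chart_at M (b s)"
  have d: "?d \<in> M" "b s \<in> fst ?d" using chart_at[OF smooth_map_points[OF b, of s]] s WS by auto
  let ?Q = "{s \<in> W. b s \<in> fst ?d} \<inter> {s \<in> points S. b s \<in> U}"
  have V': "vsmooth_on S {s \<in> W. b s \<in> fst ?d} (\<lambda>s. dfun M (snd ?d) (b s) (V s))"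
    using V d by (simp add: section_on_def)
  have Q: "openin (mtop S) ?Q"
    by (rule openin_Int[OF vsmooth_onD[OF V'] vsmooth_onD[OF smooth_map_vsmooth[OF S M b f]]])
  have g: "vsmooth_on S ?Q (\<lambda>s. snd ?d (b s))"
    by (rule vsmooth_on_subset[OF smooth_map_vsmooth[OF S M b vsmooth_on_snd[OF M d(1)]] Q]) (use WS in auto)
  have "vsmooth_on S ?Q (\<lambda>s. frechet_derivative (f \<circ> chart_inv ?d) (at (snd ?d (b s))) (dfun M (snd ?d) (b s) (V s)))"
    by (rule vsmooth_on_directional[OF S vsmooth_onD_chart[OF f d(1)] open_chart_image[OF M vsmooth_onD[OF f] d(1)] g _
        vsmooth_on_subset[OF V' Q]]) auto
  then have 3: "vsmooth_on S ?Q (\<lambda>s. dfun M f (b s) (V s))"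
  proof (rule vsmooth_on_cong[OF S])
    fix q assume "q \<in> ?Q"
    then show "frechet_derivative (f \<circ> chart_inv ?d) (at (snd ?d (b q))) (dfun M (snd ?d) (b q) (V q)) = dfun M f (b q) (V q)"
      by (intro dfun_in_chart[OF M f _ d(1), symmetric]) auto
  qed
  have 1: "s \<in> ?Q" using s d WS by auto
  have 2: "?Q \<subseteq> {s \<in> W. b s \<in> U}" by auto
  show "\<exists>Q. s \<in> Q \<and> Q \<subseteq> {s \<in> W. b s \<in> U} \<and> vsmooth_on S Q (\<lambda>s. dfun M f (b s) (V s))"
    by (rule exI[of _ ?Q], rule conjI[OF 1 conjI[OF 2 3]])
qed

lemma section_onI:
  assumes W: "openin (mtop S) W"
    and loc: "\<And>s. s \<in> W \<Longrightarrow> \<exists>d\<in>M. \<exists>U. s \<in> U \<and> U \<subseteq> W \<and> b ` U \<subseteq> fst d \<and> vsmooth_on S U (\<lambda>s. dfun M (snd d) (b s) (V s))"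
  shows "section_on S W M b V"
  unfolding section_on_def
proof (intro conjI ballI W)
  fix e assume e: "e \<in> M"
  note fe = vsmooth_on_snd[OF M e]
  show "vsmooth_on S {s \<in> W. b s \<in> fst e} (\<lambda>s. dfun M (snd e) (b s) (V s))"
  proof (rule vsmooth_on_local[OF S])
    fix s assume s: "s \<in> {s \<in> W. b s \<in> fst e}"
    have WS: "W \<subseteq> points S" by (rule openin_mtop_subset[OF S W])
    obtain d U where d: "d \<in> M" and U: "s \<in> U" "U \<subseteq> W" "b ` U \<subseteq> fst d" "vsmooth_on S U (\<lambda>s. dfun M (snd d) (b s) (V s))"
      using loc s by blast
    let ?Q = "U \<inter> {s \<in> points S. b s \<in> fst e}"
    have Q: "openin (mtop S) ?Q"
      by (rule openin_Int[OF vsmooth_onD[OF U(4)] vsmooth_onD[OF smooth_map_vsmooth[OF S M b fe]]])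
    have g: "vsmooth_on S ?Q (\<lambda>s. snd d (b s))"
      by (rule vsmooth_on_subset[OF smooth_map_vsmooth[OF S M b vsmooth_on_snd[OF M d(1)]] Q]) (use U in auto)
    have "vsmooth_on S ?Q (\<lambda>s. frechet_derivative (snd e \<circ> chart_inv d) (at (snd d (b s))) (dfun M (snd d) (b s) (V s)))"
      by (rule vsmooth_on_directional[OF S vsmooth_onD_chart[OF fe d(1)] open_chart_image[OF M vsmooth_onD[OF fe] d(1)] g _
          vsmooth_on_subset[OF U(4) Q]]) (use U in auto)
    then have 3: "vsmooth_on S ?Q (\<lambda>s. dfun M (snd e) (b s) (V s))"
    proof (rule vsmooth_on_cong[OF S])
      fix q assume "q \<in> ?Q"
      then show "frechet_derivative (snd e \<circ> chart_inv d) (at (snd d (b q))) (dfun M (snd d) (b q) (V q)) = dfun M (snd e) (b q) (V q)"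
        by (intro dfun_in_chart[OF M fe _ d(1), symmetric]) (use U in auto)
    qed
    have 1: "s \<in> ?Q" using s U WS by auto
    have 2: "?Q \<subseteq> {s \<in> W. b s \<in> fst e}" using U by auto
    show "\<exists>Q. s \<in> Q \<and> Q \<subseteq> {s \<in> W. b s \<in> fst e} \<and> vsmooth_on S Q (\<lambda>s. dfun M (snd e) (b s) (V s))"
      by (rule exI[of _ ?Q], rule conjI[OF 1 conjI[OF 2 3]])
  qed
qed

end

section \<open>Vector fields and the Lie bracket\<close>

context
  fixes M :: "('a, 'e::euclidean_space) atlas"
  assumes M: "smooth_atlas M"
begin

lemma local_rep_eq: "local_rep M c X = (\<lambda>p. dfun M (snd c) p (X p)) \<circ> chart_inv c"
  by (auto simp: local_rep_def component_def)

lemma vector_field_on_eq_section: "vector_field_on M W X \<longleftrightarrow> section_on M W M (\<lambda>p. p) X"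
proof
  assume X: "vector_field_on M W X"
  then have W: "openin (mtop M) W" by (simp add: vector_field_on_def)
  show "section_on M W M (\<lambda>p. p) X"
    unfolding section_on_def
  proof (intro conjI ballI W)
    fix d assume d: "d \<in> M"
    have eq: "{p \<in> W. p \<in> fst d} = fst d \<inter> W" by auto
    show "vsmooth_on M {p \<in> W. p \<in> fst d} (\<lambda>p. dfun M (snd d) p (X p))"
      unfolding eq
      by (rule vsmooth_on_chart[OF M d openin_Int[OF openin_chart[OF M d] W]])
        (use X d in \<open>auto simp: vector_field_on_def local_rep_eq\<close>)
  qed
next
  assume X: "section_on M W M (\<lambda>p. p) X"
  show "vector_field_on M W X"
    unfolding vector_field_on_def
  proof (intro conjI ballI)
    show "openin (mtop M) W" using X by (simp add: section_on_def)
    fix c assume c: "c \<in> M"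
    then have "vsmooth_on M {p \<in> W. p \<in> fst c} (\<lambda>p. dfun M (snd c) p (X p))"
      using X by (simp add: section_on_def)
    moreover have "fst c \<inter> {p \<in> W. p \<in> fst c} = fst c \<inter> W" by auto
    ultimately show "smooth_on (snd c ` (fst c \<inter> W)) (local_rep M c X)"
      using vsmooth_onD_chart[OF _ c] by (metis local_rep_eq)
  qed
qed

lemma vector_field_onD: "vector_field_on M W X \<Longrightarrow> openin (mtop M) W"
  by (simp add: vector_field_on_def)

lemma vector_field_on_dfun:
  assumes "vector_field_on M W X" "vsmooth_on M W f"
  shows "vsmooth_on M W (\<lambda>p. dfun M f p (X p))"
  using section_on_dfun[OF M M smooth_map_id[OF M] assms(1)[unfolded vector_field_on_eq_section] assms(2)] by simp

lemma vector_field_onI: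
  assumes W: "openin (mtop M) W"
    and loc: "\<And>p. p \<in> W \<Longrightarrow> \<exists>d\<in>M. \<exists>U. p \<in> U \<and> U \<subseteq> W \<and> U \<subseteq> fst d \<and> vsmooth_on M U (\<lambda>p. dfun M (snd d) p (X p))"
  shows "vector_field_on M W X"
  unfolding vector_field_on_eq_section by (rule section_onI[OF M M smooth_map_id[OF M] W]) (use loc in simp)

lemma vector_field_on_subset:
  assumes "vector_field_on M W X" "openin (mtop M) V" "V \<subseteq> W"
  shows "vector_field_on M V X"
  unfolding vector_field_on_def
proof (intro conjI ballI assms(2))
  fix c assume "c \<in> M"
  then have "smooth_on (snd c ` (fst c \<inter> W)) (local_rep M c X)" using assms(1) by (simp add: vector_field_on_def)
  then show "smooth_on (snd c ` (fst c \<inter> V)) (local_rep M c X)" by (rule smooth_on_subset) (use assms(3) in auto)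
qed

lemma vector_field_on_cong:
  assumes "vector_field_on M W X" "\<And>p. p \<in> W \<Longrightarrow> X p = Y p"
  shows "vector_field_on M W Y"
  unfolding vector_field_on_def
proof (intro conjI ballI vector_field_onD[OF assms(1)])
  fix c assume c: "c \<in> M"
  show "smooth_on (snd c ` (fst c \<inter> W)) (local_rep M c Y)"
    by (rule smooth_on_cong[OF open_chart_image[OF M vector_field_onD[OF assms(1)] c], of "local_rep M c X"])
      (use assms c chart_inv_snd[OF M c] in \<open>auto simp: vector_field_on_def local_rep_eq\<close>)
qed

lemma vector_field_on_coord_field:
  assumes c: "c \<in> M"
  shows "vector_field_on M (fst c) (coord_field M c v)"
proof (rule vector_field_onI[OF openin_chart[OF M c]])
  fix p assume "p \<in> fst c"
  have "vsmooth_on M (fst c) (\<lambda>p. dfun M (snd c) p (coord_field M c v p))"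
    by (rule vsmooth_on_cong[OF M vsmooth_on_const[OF M openin_chart[OF M c], of v]])
      (use coord_field_component[OF M c] in simp)
  then show "\<exists>d\<in>M. \<exists>U. p \<in> U \<and> U \<subseteq> fst c \<and> U \<subseteq> fst d \<and> vsmooth_on M U (\<lambda>p. dfun M (snd d) p (coord_field M c v p))"
    using \<open>p \<in> fst c\<close> by (intro bexI[OF _ c] exI[of _ "fst c"]) auto
qed

text \<open>The first summand is the Hessian of \<open>f\<close> in the chart, symmetric in
  \<open>v\<close> and \<open>Y p\<close>; the second carries the derivative of the field, so that
  only the latter survives in a commutator.\<close>

lemma dfun_dfun:
  assumes Y: "vector_field_on M W Y" and f: "vsmooth_on M W f" and p: "p \<in> W"
  defines "c \<equiv> chart_at M p"
  shows "dfun M (\<lambda>q. dfun M f q (Y q)) p v =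
    frechet_derivative (\<lambda>x. frechet_derivative (f \<circ> chart_inv c) (at x) (Y p)) (at (snd c p)) v
    + dfun M f p (frechet_derivative (local_rep M c Y) (at (snd c p)) v)"
proof -
  have W: "openin (mtop M) W" by (rule vector_field_onD[OF Y])
  have pp: "p \<in> points M" using openin_mtop_subset[OF M W] p by auto
  have c: "c \<in> M" "p \<in> fst c" using chart_at[OF pp] by (auto simp: c_def)
  let ?O = "snd c ` (fst c \<inter> W)" and ?F = "f \<circ> chart_inv c" and ?y = "local_rep M c Y"
  have O: "open ?O" by (rule open_chart_image[OF M W c(1)])
  have F: "smooth_on ?O ?F" by (rule vsmooth_onD_chart[OF f c(1)])
  have y: "smooth_on ?O ?y" using Y c by (simp add: vector_field_on_def)
  have yp: "?y (snd c p) = Y p"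
    using dfun_chart_at[OF M pp] chart_inv_snd[OF M c] by (simp add: local_rep_eq c_def)
  have "((\<lambda>x. frechet_derivative ?F (at x) (?y x)) has_derivative
    (\<lambda>v. frechet_derivative (\<lambda>x. frechet_derivative ?F (at x) (?y (snd c p))) (at (snd c p)) v
      + frechet_derivative ?F (at (snd c p)) (frechet_derivative ?y (at (snd c p)) v))) (at (snd c p))"
    by (rule has_derivative_directional[OF F y O]) (use c p in auto)
  then have "((\<lambda>q. dfun M f q (Y q)) \<circ> chart_inv c has_derivative
    (\<lambda>v. frechet_derivative (\<lambda>x. frechet_derivative ?F (at x) (?y (snd c p))) (at (snd c p)) v
      + frechet_derivative ?F (at (snd c p)) (frechet_derivative ?y (at (snd c p)) v))) (at (snd c p))"
  proof (rule has_derivative_transform_within_open[OF _ O])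
    show "frechet_derivative ?F (at x) (?y x) = ((\<lambda>q. dfun M f q (Y q)) \<circ> chart_inv c) x" if "x \<in> ?O" for x
    proof -
      from that obtain q where q: "q \<in> fst c" "q \<in> W" "x = snd c q" by auto
      then show ?thesis
        using dfun_in_chart[OF M f q(2) c(1) q(1)] chart_inv_snd[OF M c(1)] by (simp add: local_rep_eq)
    qed
  qed (use c p in auto)
  from dfun_eqI[OF M this[unfolded c_def], folded c_def]
  show ?thesis unfolding yp by (simp add: dfun_def[of M f p] c_def)
qed

text \<open>Links the coordinate definition of the bracket with the commutator of derivations: the
  Hessian terms cancel by symmetry of second derivatives. Naturality of the bracket and its formula
  in a frame go through this form.\<close>

lemma dfun_lie_bracket:
  fixes f :: "'a \<Rightarrow> 'b::euclidean_space"
  assumes X: "vector_field_on M W X" and Y: "vector_field_on M W Y" and f: "vsmooth_on M W f" and p: "p \<in> W"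
  shows "dfun M f p (lie_bracket M X Y p) =
    dfun M (\<lambda>q. dfun M f q (Y q)) p (X p) - dfun M (\<lambda>q. dfun M f q (X q)) p (Y p)"
proof -
  let ?c = "chart_at M p"
  have W: "openin (mtop M) W" by (rule vector_field_onD[OF Y])
  have c: "?c \<in> M" "p \<in> fst ?c" using chart_at[of p M] openin_mtop_subset[OF M W] p by auto
  have "frechet_derivative (\<lambda>x. frechet_derivative (f \<circ> chart_inv ?c) (at x) (Y p)) (at (snd ?c p)) (X p)
      = frechet_derivative (\<lambda>x. frechet_derivative (f \<circ> chart_inv ?c) (at x) (X p)) (at (snd ?c p)) (Y p)"
    by (rule symmetric_second_derivative[OF vsmooth_onD_chart[OF f c(1)] open_chart_image[OF M W c(1)]]) (use c p in auto)
  then show ?thesis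
    by (simp add: dfun_dfun[OF Y f p] dfun_dfun[OF X f p] lie_bracket_def Let_def linear_diff[OF dfun_linear[OF M f p]])
qed

end

text \<open>Along \<open>\<phi>\<close> the derivative by \<open>X\<close> of a pulled-back function
  is the pullback of the derivative by \<open>X'\<close>, and likewise for \<open>Y\<close>, so
  commutators correspond. The test function is the coordinate map of a chart around
  \<open>\<phi> p\<close>.\<close>

lemma tmap_lie_bracket:
  fixes M :: "('a, 'e::euclidean_space) atlas" and N :: "('b, 'f::euclidean_space) atlas"
  assumes M: "smooth_atlas M" and N: "smooth_atlas N" and \<phi>: "smooth_map M N \<phi>"
    and X: "vector_field_on M W X" "vector_field_on M W Y"
    and X': "vector_field_on N U X'" "vector_field_on N U Y'" and WU: "\<phi> ` W \<subseteq> U"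
    and rel: "\<And>q. q \<in> W \<Longrightarrow> tmap M N \<phi> q (X q) = X' (\<phi> q)" "\<And>q. q \<in> W \<Longrightarrow> tmap M N \<phi> q (Y q) = Y' (\<phi> q)"
    and p: "p \<in> W"
  shows "tmap M N \<phi> p (lie_bracket M X Y p) = lie_bracket N X' Y' (\<phi> p)"
proof -
  have W: "openin (mtop M) W" by (rule vector_field_onD[OF M X(1)])
  have U: "openin (mtop N) U" by (rule vector_field_onD[OF N X'(1)])
  have WM: "W \<subseteq> points M" by (rule openin_mtop_subset[OF M W])
  have pp: "p \<in> points M" using WM p by auto
  let ?d = "chart_at N (\<phi> p)"
  have d: "?d \<in> N" "\<phi> p \<in> fst ?d" using chart_at[OF smooth_map_points[OF \<phi> pp]] by auto
  let ?V = "U \<inter> fst ?d"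
  have V: "openin (mtop N) ?V" by (rule openin_Int[OF U openin_chart[OF N d(1)]])
  have f: "vsmooth_on N ?V (snd ?d)" by (rule vsmooth_on_subset[OF vsmooth_on_snd[OF N d(1)] V]) auto
  let ?Q = "W \<inter> {q \<in> points M. \<phi> q \<in> ?V}"
  note f\<phi> = smooth_map_vsmooth[OF M N \<phi> f]
  have Q: "openin (mtop M) ?Q" by (rule openin_Int[OF W vsmooth_onD[OF f\<phi>]])
  have pQ: "p \<in> ?Q" using p WU d pp by auto
  have X'V: "vector_field_on N ?V X'" "vector_field_on N ?V Y'"
    by (rule vector_field_on_subset[OF N X'(1) V], simp, rule vector_field_on_subset[OF N X'(2) V], simp)
  have XQ: "vector_field_on M ?Q X" "vector_field_on M ?Q Y"
    by (rule vector_field_on_subset[OF M X(1) Q], simp, rule vector_field_on_subset[OF M X(2) Q], simp)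
  have fQ: "vsmooth_on M ?Q (\<lambda>q. snd ?d (\<phi> q))" by (rule vsmooth_on_subset[OF f\<phi> Q]) auto
  have *: "dfun M (\<lambda>q. dfun M (\<lambda>q. snd ?d (\<phi> q)) q (Z q)) p v = dfun N (\<lambda>r. dfun N (snd ?d) r (Z' r)) (\<phi> p) (tmap M N \<phi> p v)"
    if Z: "vector_field_on N ?V Z'" and r: "\<And>q. q \<in> W \<Longrightarrow> tmap M N \<phi> q (Z q) = Z' (\<phi> q)" for Z Z' v
  proof -
    have "dfun M (\<lambda>q. dfun M (\<lambda>q. snd ?d (\<phi> q)) q (Z q)) p v = dfun M (\<lambda>q. dfun N (snd ?d) (\<phi> q) (Z' (\<phi> q))) p v"
    proof (subst dfun_cong[OF M Q pQ])
      fix q assume q: "q \<in> ?Q"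
      then show "dfun M (\<lambda>q. snd ?d (\<phi> q)) q (Z q) = dfun N (snd ?d) (\<phi> q) (Z' (\<phi> q))"
        using dfun_tmap[OF M N \<phi> _ f, of q "Z q"] r[of q] by simp
    qed simp
    also have "\<dots> = dfun N (\<lambda>r. dfun N (snd ?d) r (Z' r)) (\<phi> p) (tmap M N \<phi> p v)"
      by (rule dfun_tmap[OF M N \<phi> pp vector_field_on_dfun[OF N Z f], symmetric]) (use pQ in auto)
    finally show ?thesis .
  qed
  show ?thesis
  proof (rule tmap_eqI[OF M N \<phi> pp d])
    show "dfun M (\<lambda>q. snd ?d (\<phi> q)) p (lie_bracket M X Y p) = dfun N (snd ?d) (\<phi> p) (lie_bracket N X' Y' (\<phi> p))"
      using pQ by (simp add: dfun_lie_bracket[OF M XQ fQ pQ] dfun_lie_bracket[OF N X'V f] *[OF X'V(1) rel(1)] *[OF X'V(2) rel(2)] rel[OF p])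
  qed
qed

section \<open>Connections on parallelized manifolds\<close>

lemma tr_commute:
  fixes f g :: "'e::euclidean_space \<Rightarrow> 'e"
  assumes "linear f" "linear g"
  shows "tr (\<lambda>x. f (g x)) = tr (\<lambda>x. g (f x))"
proof -
  have *: "tr (\<lambda>x. f (g x)) = (\<Sum>b\<in>Basis. \<Sum>c\<in>Basis. (g b \<bullet> c) * (f c \<bullet> b))" if "linear f" for f g :: "'e \<Rightarrow> 'e"
    unfolding tr_def by (subst linear_basis_sum[OF that]) (simp add: inner_sum_left)
  show ?thesis
    unfolding *[OF assms(1)] *[OF assms(2)] by (subst sum.swap) (simp add: mult.commute)
qed

text \<open>Product rule for a family \<open>F\<close> of linear maps whose smoothness is known only
  through its values on fixed vectors; expanding \<open>y\<close> in the basis leaves products of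
  smooth functions.\<close>

lemma
  fixes M :: "('a, 'e::euclidean_space) atlas" and F :: "'a \<Rightarrow> 'c::euclidean_space \<Rightarrow> 'd::euclidean_space"
  assumes M: "smooth_atlas M" and F: "\<And>r. vsmooth_on M W (\<lambda>q. F q r)" "\<And>q. q \<in> W \<Longrightarrow> linear (F q)"
    and y: "vsmooth_on M W y"
  shows vsmooth_on_apply: "vsmooth_on M W (\<lambda>q. F q (y q))"
    and dfun_apply: "p \<in> W \<Longrightarrow> dfun M (\<lambda>q. F q (y q)) p v = dfun M (\<lambda>q. F q (y p)) p v + F p (dfun M y p v)"
proof -
  have W: "openin (mtop M) W" by (rule vsmooth_onD[OF y])
  have yb: "vsmooth_on M W (\<lambda>q. y q \<bullet> b)" for b
    by (rule vsmooth_on_linear[OF M bounded_linear_inner_left y])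
  have s: "vsmooth_on M W (\<lambda>q. (y q \<bullet> b) *\<^sub>R F q b)" for b
    by (rule vsmooth_on_bilinear[OF M bounded_bilinear_scaleR yb F(1)])
  show "vsmooth_on M W (\<lambda>q. F q (y q))"
    by (rule vsmooth_on_cong[OF M vsmooth_on_sum[OF M W s]]) (rule linear_basis_sum[OF F(2), symmetric])
  assume p: "p \<in> W"
  have "dfun M (\<lambda>q. F q (y q)) p v = dfun M (\<lambda>q. \<Sum>b\<in>Basis. (y q \<bullet> b) *\<^sub>R F q b) p v"
    by (subst dfun_cong[OF M W p]) (rule linear_basis_sum[OF F(2)], simp_all)
  also have "\<dots> = (\<Sum>b\<in>Basis. (y p \<bullet> b) *\<^sub>R dfun M (\<lambda>q. F q b) p v + (dfun M y p v \<bullet> b) *\<^sub>R F p b)"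
    unfolding dfun_sum[OF M s p] dfun_bilinear[OF M bounded_bilinear_scaleR yb F(1) p]
      dfun_comp_linear[OF M bounded_linear_inner_left y p] ..
  also have "\<dots> = (\<Sum>b\<in>Basis. (y p \<bullet> b) *\<^sub>R dfun M (\<lambda>q. F q b) p v) + F p (dfun M y p v)"
    by (simp add: sum.distrib linear_basis_sum[OF F(2)[OF p], of "dfun M y p v"])
  also have "(\<Sum>b\<in>Basis. (y p \<bullet> b) *\<^sub>R dfun M (\<lambda>q. F q b) p v) = dfun M (\<lambda>q. \<Sum>b\<in>Basis. (y p \<bullet> b) *\<^sub>R F q b) p v"
    by (simp add: dfun_sum[OF M vsmooth_on_linear[OF M bounded_linear_scaleR_right F(1)] p]
        dfun_comp_linear[OF M bounded_linear_scaleR_right F(1) p])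
  also have "\<dots> = dfun M (\<lambda>q. F q (y p)) p v"
    by (subst dfun_cong[OF M W p]) (rule linear_basis_sum[OF F(2), symmetric], simp_all)
  finally show "dfun M (\<lambda>q. F q (y q)) p v = dfun M (\<lambda>q. F q (y p)) p v + F p (dfun M y p v)" .
qed

text \<open>A trivialization \<open>\<theta>\<close> of the tangent bundle, whose inverse consists of fields \<open>E r\<close> with constant
  structure functions.\<close>

locale parallelism =
  fixes M :: "('a, 'e::euclidean_space) atlas" and E :: "'e \<Rightarrow> 'a \<Rightarrow> 'e" and \<theta> :: "'a \<Rightarrow> 'e \<Rightarrow> 'e"
    and b :: "'e \<Rightarrow> 'e \<Rightarrow> 'e"
  assumes atlas: "smooth_atlas M"
    and \<theta>_E: "p \<in> points M \<Longrightarrow> \<theta> p (E r p) = r"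
    and E_\<theta>: "p \<in> points M \<Longrightarrow> E (\<theta> p v) p = v"
    and \<theta>_linear: "p \<in> points M \<Longrightarrow> linear (\<theta> p)"
    and E_field: "vector_field_on M (points M) (E r)"
    and \<theta>_smooth: "vector_field_on M W X \<Longrightarrow> vsmooth_on M W (\<lambda>p. \<theta> p (X p))"
    and \<theta>_bracket: "p \<in> points M \<Longrightarrow> \<theta> p (lie_bracket M (E r) (E s) p) = b r s"
begin

lemma E_linear:
  assumes "p \<in> points M" shows "linear (\<lambda>r. E r p)"
proof (rule linearI)
  show "E (r + s) p = E r p + E s p" for r s
    using E_\<theta>[OF assms, of "E r p + E s p"] by (simp add: linear_add[OF \<theta>_linear[OF assms]] \<theta>_E[OF assms])
  show "E (c *\<^sub>R r) p = c *\<^sub>R E r p" for c r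
    using E_\<theta>[OF assms, of "c *\<^sub>R E r p"] by (simp add: linear_scale[OF \<theta>_linear[OF assms]] \<theta>_E[OF assms])
qed

lemma in_points: "openin (mtop M) W \<Longrightarrow> p \<in> W \<Longrightarrow> p \<in> points M"
  using openin_mtop_subset[OF atlas] by blast

lemma E_field_on: "openin (mtop M) W \<Longrightarrow> vector_field_on M W (E r)"
  by (rule vector_field_on_subset[OF atlas E_field _ openin_mtop_subset[OF atlas]])

lemma dfun_E:
  assumes f: "vsmooth_on M W f"
  shows "vsmooth_on M W (\<lambda>q. dfun M f q (E r q))" "q \<in> W \<Longrightarrow> linear (\<lambda>r. dfun M f q (E r q))"
proof -
  have W: "openin (mtop M) W" by (rule vsmooth_onD[OF f])
  show "vsmooth_on M W (\<lambda>q. dfun M f q (E r q))"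
    by (rule vector_field_on_dfun[OF atlas E_field_on[OF W] f])
  show "linear (\<lambda>r. dfun M f q (E r q))" if "q \<in> W"
    using linear_compose[OF E_linear[OF in_points[OF W that]] dfun_linear[OF atlas f that]] by (simp add: comp_def)
qed

lemma vector_field_onI_frame:
  assumes y: "vsmooth_on M W y"
  shows "vector_field_on M W (\<lambda>p. E (y p) p)"
proof (rule vector_field_onI[OF atlas vsmooth_onD[OF y]])
  fix p assume p: "p \<in> W"
  have W: "openin (mtop M) W" by (rule vsmooth_onD[OF y])
  let ?d = "chart_at M p"
  have d: "?d \<in> M" "p \<in> fst ?d" using chart_at[OF in_points[OF W p]] by auto
  have o: "openin (mtop M) (W \<inter> fst ?d)" by (rule openin_Int[OF W openin_chart[OF atlas d(1)]])
  note sd = vsmooth_on_subset[OF vsmooth_on_snd[OF atlas d(1)] o inf_le2]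
  have "vsmooth_on M (W \<inter> fst ?d) (\<lambda>q. dfun M (snd ?d) q (E (y q) q))"
    by (rule vsmooth_on_apply[OF atlas, where F = "\<lambda>q r. dfun M (snd ?d) q (E r q)"])
      (use dfun_E[OF sd] vsmooth_on_subset[OF y o] in auto)
  then show "\<exists>d\<in>M. \<exists>U. p \<in> U \<and> U \<subseteq> W \<and> U \<subseteq> fst d \<and> vsmooth_on M U (\<lambda>p. dfun M (snd d) p (E (y p) p))"
    by (intro bexI[OF _ d(1)] exI[of _ "W \<inter> fst ?d"]) (use p d in auto)
qed

lemma vector_field_on_iff:
  "vector_field_on M W X \<longleftrightarrow> vsmooth_on M W (\<lambda>p. \<theta> p (X p))"
proof
  assume X: "vsmooth_on M W (\<lambda>p. \<theta> p (X p))"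
  show "vector_field_on M W X"
    by (rule vector_field_on_cong[OF atlas vector_field_onI_frame[OF X]])
      (rule E_\<theta>[OF in_points[OF vsmooth_onD[OF X]]])
qed (rule \<theta>_smooth)

lemma dfun_frame:
  assumes Y: "vector_field_on M W Y" and f: "vsmooth_on M W f" and p: "p \<in> W"
  shows "dfun M (\<lambda>q. dfun M f q (Y q)) p v =
    dfun M (\<lambda>q. dfun M f q (E (\<theta> p (Y p)) q)) p v + dfun M f p (E (dfun M (\<lambda>q. \<theta> q (Y q)) p v) p)"
proof -
  have W: "openin (mtop M) W" by (rule vector_field_onD[OF atlas Y])
  have "dfun M (\<lambda>q. dfun M f q (Y q)) p v = dfun M (\<lambda>q. dfun M f q (E (\<theta> q (Y q)) q)) p v"
    by (subst dfun_cong[OF atlas W p]) (simp_all add: E_\<theta>[OF in_points[OF W]])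
  also have "\<dots> = dfun M (\<lambda>q. dfun M f q (E (\<theta> p (Y p)) q)) p v + dfun M f p (E (dfun M (\<lambda>q. \<theta> q (Y q)) p v) p)"
    by (rule dfun_apply[OF atlas, where F = "\<lambda>q r. dfun M f q (E r q)"]) (use dfun_E[OF f] \<theta>_smooth[OF Y] p in auto)
  finally show ?thesis .
qed

lemma \<theta>_lie_bracket:
  assumes X: "vector_field_on M W X" and Y: "vector_field_on M W Y" and p: "p \<in> W"
  shows "\<theta> p (lie_bracket M X Y p) =
    dfun M (\<lambda>q. \<theta> q (Y q)) p (X p) - dfun M (\<lambda>q. \<theta> q (X q)) p (Y p) + b (\<theta> p (X p)) (\<theta> p (Y p))"
proof -
  have W: "openin (mtop M) W" by (rule vector_field_onD[OF atlas Y])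
  have pp: "p \<in> points M" by (rule in_points[OF W p])
  let ?d = "chart_at M p" and ?x = "\<theta> p (X p)" and ?y = "\<theta> p (Y p)"
  have d: "?d \<in> M" "p \<in> fst ?d" using chart_at[OF in_points[OF W p]] by auto
  let ?V = "W \<inter> fst ?d"
  have o: "openin (mtop M) ?V" by (rule openin_Int[OF W openin_chart[OF atlas d(1)]])
  have pV: "p \<in> ?V" using p d by auto
  note f = vsmooth_on_subset[OF vsmooth_on_snd[OF atlas d(1)] o inf_le2]
  note X' = vector_field_on_subset[OF atlas X o inf_le1] and Y' = vector_field_on_subset[OF atlas Y o inf_le1]
  let ?f = "snd ?d"
  have "dfun M ?f p (lie_bracket M X Y p) =
      dfun M (\<lambda>q. dfun M ?f q (Y q)) p (X p) - dfun M (\<lambda>q. dfun M ?f q (X q)) p (Y p)"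
    by (rule dfun_lie_bracket[OF atlas X' Y' f pV])
  also have "\<dots> = (dfun M (\<lambda>q. dfun M ?f q (E ?y q)) p (E ?x p) - dfun M (\<lambda>q. dfun M ?f q (E ?x q)) p (E ?y p))
      + (dfun M ?f p (E (dfun M (\<lambda>q. \<theta> q (Y q)) p (X p)) p) - dfun M ?f p (E (dfun M (\<lambda>q. \<theta> q (X q)) p (Y p)) p))"
    by (simp add: dfun_frame[OF Y' f pV] dfun_frame[OF X' f pV] E_\<theta>[OF pp])
  also have "dfun M (\<lambda>q. dfun M ?f q (E ?y q)) p (E ?x p) - dfun M (\<lambda>q. dfun M ?f q (E ?x q)) p (E ?y p)
      = dfun M ?f p (lie_bracket M (E ?x) (E ?y) p)"
    by (rule dfun_lie_bracket[OF atlas E_field_on[OF o] E_field_on[OF o] f pV, symmetric])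
  also have "lie_bracket M (E ?x) (E ?y) p = E (b ?x ?y) p"
    by (metis E_\<theta> \<theta>_bracket pp)
  also have "dfun M ?f p (E (b ?x ?y) p) + (dfun M ?f p (E (dfun M (\<lambda>q. \<theta> q (Y q)) p (X p)) p)
        - dfun M ?f p (E (dfun M (\<lambda>q. \<theta> q (X q)) p (Y p)) p))
      = dfun M ?f p (E (dfun M (\<lambda>q. \<theta> q (Y q)) p (X p) - dfun M (\<lambda>q. \<theta> q (X q)) p (Y p) + b ?x ?y) p)"
    by (simp add: linear_add[OF dfun_E(2)[OF f pV]] linear_diff[OF dfun_E(2)[OF f pV]])
  finally have "lie_bracket M X Y p = E (dfun M (\<lambda>q. \<theta> q (Y q)) p (X p) - dfun M (\<lambda>q. \<theta> q (X q)) p (Y p) + b ?x ?y) p"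
    by (rule tangent_eqI[OF atlas d])
  then show ?thesis by (simp add: \<theta>_E[OF pp])
qed

text \<open>A value of type \<open>conn\<close> is arbitrary on arguments that are not smooth
  fields, so the formula is demanded on smooth local fields and determines the connection up to
  \<open>conn_eq\<close>.\<close>

definition frame_conn :: "('e \<Rightarrow> 'e \<Rightarrow> 'e) \<Rightarrow> ('a, 'e) conn \<Rightarrow> bool" where
  "frame_conn A D \<longleftrightarrow> (\<forall>W Y. vector_field_on M W Y \<longrightarrow> (\<forall>p\<in>W. \<forall>v.
     D p v Y = E (dfun M (\<lambda>q. \<theta> q (Y q)) p v + A (\<theta> p v) (\<theta> p (Y p))) p))"

lemma frame_connD:
  "frame_conn A D \<Longrightarrow> vector_field_on M W Y \<Longrightarrow> p \<in> W \<Longrightarrow>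
    D p v Y = E (dfun M (\<lambda>q. \<theta> q (Y q)) p v + A (\<theta> p v) (\<theta> p (Y p))) p"
  by (simp add: frame_conn_def)

lemma frame_conn_exists: "\<exists>D. frame_conn A D"
  by (rule exI[of _ "\<lambda>p v Y. E (dfun M (\<lambda>q. \<theta> q (Y q)) p v + A (\<theta> p v) (\<theta> p (Y p))) p"]) (simp add: frame_conn_def)

lemma frame_conn_eq: "frame_conn A D \<Longrightarrow> frame_conn A D' \<Longrightarrow> conn_eq M D D'"
  by (simp add: frame_conn_def conn_eq_def)

lemma frame_conn_E:
  assumes "frame_conn A D" "p \<in> points M"
  shows "D p v (E s) = E (A (\<theta> p v) s) p"
proof -
  have "dfun M (\<lambda>q. \<theta> q (E s q)) p v = dfun M (\<lambda>q. s) p v"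
    by (subst dfun_cong[OF atlas openin_points[OF atlas] assms(2)]) (auto simp: \<theta>_E)
  then show ?thesis
    by (simp add: frame_connD[OF assms(1) E_field assms(2)] dfun_const[OF atlas] \<theta>_E[OF assms(2)])
qed

section \<open>Torsion, curvature and Ricci tensor in a frame\<close>

context
  fixes A D assumes A: "bilinear A" and D: "frame_conn A D"
begin

lemma A_bounded: "bounded_bilinear A"
  using A by (simp add: bilinear_conv_bounded_bilinear)

lemma frame_conn_linear:
  assumes "vector_field_on M W Y" "p \<in> W"
  shows "linear (\<lambda>v. D p v Y)"
proof -
  have pp: "p \<in> points M" using in_points[OF vector_field_onD[OF atlas assms(1)] assms(2)] .
  have "linear (\<lambda>v. dfun M (\<lambda>q. \<theta> q (Y q)) p v + A (\<theta> p v) (\<theta> p (Y p)))"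
    using linear_compose[OF \<theta>_linear[OF pp], of "\<lambda>v. A v (\<theta> p (Y p))"] A
    by (intro linear_compose_add dfun_linear[OF atlas \<theta>_smooth[OF assms(1)] assms(2)]) (simp add: comp_def bilinear_def)
  from linear_compose[OF this E_linear[OF pp]] show ?thesis
    by (simp add: frame_connD[OF D assms] comp_def)
qed

lemma frame_conn_field:
  assumes X: "vector_field_on M W X" and Y: "vector_field_on M W Y"
  shows "vector_field_on M W (\<lambda>p. D p (X p) Y)"
    "p \<in> W \<Longrightarrow> \<theta> p (D p (X p) Y) = dfun M (\<lambda>q. \<theta> q (Y q)) p (X p) + A (\<theta> p (X p)) (\<theta> p (Y p))"
proof -
  have W: "openin (mtop M) W" by (rule vector_field_onD[OF atlas Y])
  show 1: "\<theta> p (D p (X p) Y) = dfun M (\<lambda>q. \<theta> q (Y q)) p (X p) + A (\<theta> p (X p)) (\<theta> p (Y p))" if "p \<in> W" for p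
    by (simp add: frame_connD[OF D Y that] \<theta>_E[OF in_points[OF W that]])
  have "vsmooth_on M W (\<lambda>p. dfun M (\<lambda>q. \<theta> q (Y q)) p (X p) + A (\<theta> p (X p)) (\<theta> p (Y p)))"
    by (intro vsmooth_on_add[OF atlas] vector_field_on_dfun[OF atlas X] \<theta>_smooth Y
        vsmooth_on_bilinear[OF atlas A_bounded] X)
  then show "vector_field_on M W (\<lambda>p. D p (X p) Y)"
    unfolding vector_field_on_iff by (rule vsmooth_on_cong[OF atlas]) (simp add: 1)
qed

lemma frame_conn_affine: "affine_connection M D"
  unfolding affine_connection_def
proof (intro allI impI conjI ballI)
  fix W Y assume Y: "vector_field_on M W Y"
  have W: "openin (mtop M) W" by (rule vector_field_onD[OF atlas Y])
  note y = \<theta>_smooth[OF Y]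
  show "linear (\<lambda>v. D p v Y)" if "p \<in> W" for p by (rule frame_conn_linear[OF Y that])
  show "vector_field_on M W (\<lambda>p. D p (X p) Y)" if "vector_field_on M W X" for X
    by (rule frame_conn_field(1)[OF that Y])
  fix p v assume p: "p \<in> W"
  have pp: "p \<in> points M" by (rule in_points[OF W p])
  show "D p v (\<lambda>q. Y q + Z q) = D p v Y + D p v Z" if Z: "vector_field_on M W Z" for Z
  proof -
    have eq: "\<theta> q (Y q + Z q) = \<theta> q (Y q) + \<theta> q (Z q)" if "q \<in> W" for q
      by (rule linear_add[OF \<theta>_linear[OF in_points[OF W that]]])
    have YZ: "vector_field_on M W (\<lambda>q. Y q + Z q)"
      unfolding vector_field_on_iff by (rule vsmooth_on_cong[OF atlas vsmooth_on_add[OF atlas y \<theta>_smooth[OF Z]]]) (simp add: eq)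
    have "dfun M (\<lambda>q. \<theta> q (Y q + Z q)) p v = dfun M (\<lambda>q. \<theta> q (Y q) + \<theta> q (Z q)) p v"
      by (subst dfun_cong[OF atlas W p]) (auto simp: eq)
    then show ?thesis
      by (simp add: frame_connD[OF D YZ p] frame_connD[OF D Y p] frame_connD[OF D Z p] eq[OF p] bilinear_radd[OF A]
          dfun_add[OF atlas y \<theta>_smooth[OF Z] p] linear_add[OF E_linear[OF pp]])
  qed
  show "D p v (\<lambda>q. f q *\<^sub>R Y q) = dfun M f p v *\<^sub>R Y p + f p *\<^sub>R D p v Y" if "smooth_fun_on M W f" for f
  proof -
    have f: "vsmooth_on M W f" using that by (simp add: smooth_fun_on_eq)
    have eq: "\<theta> q (f q *\<^sub>R Y q) = f q *\<^sub>R \<theta> q (Y q)" if "q \<in> W" for q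
      by (rule linear_scale[OF \<theta>_linear[OF in_points[OF W that]]])
    have fY: "vector_field_on M W (\<lambda>q. f q *\<^sub>R Y q)"
      unfolding vector_field_on_iff by (rule vsmooth_on_cong[OF atlas vsmooth_on_bilinear[OF atlas bounded_bilinear_scaleR f y]]) (simp add: eq)
    have "dfun M (\<lambda>q. \<theta> q (f q *\<^sub>R Y q)) p v = dfun M (\<lambda>q. f q *\<^sub>R \<theta> q (Y q)) p v"
      by (subst dfun_cong[OF atlas W p]) (auto simp: eq)
    then show ?thesis
      by (simp add: frame_connD[OF D fY p] frame_connD[OF D Y p] eq[OF p] bilinear_rmul[OF A] E_\<theta>[OF pp]
          dfun_bilinear[OF atlas bounded_bilinear_scaleR f y p] linear_add[OF E_linear[OF pp]] linear_scale[OF E_linear[OF pp]] algebra_simps)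
  qed
qed

lemma frame_conn_torsion_free:
  assumes "\<And>r s. A r s - A s r = b r s"
  shows "torsion_free M D"
  unfolding torsion_free_def
proof (intro allI impI ballI, elim conjE)
  fix W X Y p assume X: "vector_field_on M W X" and Y: "vector_field_on M W Y" and p: "p \<in> W"
  have pp: "p \<in> points M" by (rule in_points[OF vector_field_onD[OF atlas X] p])
  have "\<theta> p (D p (X p) Y - D p (Y p) X) = \<theta> p (lie_bracket M X Y p)"
    by (simp add: linear_diff[OF \<theta>_linear[OF pp]] frame_conn_field(2)[OF X Y p] frame_conn_field(2)[OF Y X p]
        \<theta>_lie_bracket[OF X Y p] flip: assms)
  then show "D p (X p) Y - D p (Y p) X = lie_bracket M X Y p" by (metis E_\<theta> pp)
qed

text \<open>The second derivatives of the coefficients of \<open>Z\<close> are accounted for by the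
  bracket term, and the first derivatives of all coefficients cancel. What is left is algebraic
  because \<open>A\<close> and \<open>b\<close> have constant coefficients.\<close>

lemma frame_conn_curvature:
  assumes X: "vector_field_on M W X" and Y: "vector_field_on M W Y" and Z: "vector_field_on M W Z" and p: "p \<in> W"
  shows "curvature M D X Y Z p =
    E (A (\<theta> p (X p)) (A (\<theta> p (Y p)) (\<theta> p (Z p))) - A (\<theta> p (Y p)) (A (\<theta> p (X p)) (\<theta> p (Z p)))
      - A (b (\<theta> p (X p)) (\<theta> p (Y p))) (\<theta> p (Z p))) p"
proof -
  have W: "openin (mtop M) W" by (rule vector_field_onD[OF atlas X])
  have pp: "p \<in> points M" by (rule in_points[OF W p])
  let ?x = "\<lambda>q. \<theta> q (X q)" and ?y = "\<lambda>q. \<theta> q (Y q)" and ?z = "\<lambda>q. \<theta> q (Z q)"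
  have *: "D p (X p) (\<lambda>q. D q (Y q) Z) = E (dfun M (\<lambda>q. dfun M ?z q (Y q)) p (X p)
      + (A (\<theta> p (Y p)) (dfun M ?z p (X p)) + A (dfun M (\<lambda>q. \<theta> q (Y q)) p (X p)) (?z p))
      + A (\<theta> p (X p)) (dfun M ?z p (Y p) + A (\<theta> p (Y p)) (?z p))) p"
    if X: "vector_field_on M W X" and Y: "vector_field_on M W Y" for X Y
  proof -
    let ?y = "\<lambda>q. \<theta> q (Y q)"
    note F = frame_conn_field[OF Y Z]
    note s1 = vector_field_on_dfun[OF atlas Y \<theta>_smooth[OF Z]]
    note s2 = vsmooth_on_bilinear[OF atlas A_bounded \<theta>_smooth[OF Y] \<theta>_smooth[OF Z]]
    have "dfun M (\<lambda>q. \<theta> q (D q (Y q) Z)) p v = dfun M (\<lambda>q. dfun M ?z q (Y q) + A (?y q) (?z q)) p v" for v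
      by (subst dfun_cong[OF atlas W p]) (auto simp: F(2))
    also have "dfun M (\<lambda>q. dfun M ?z q (Y q) + A (?y q) (?z q)) p v =
        dfun M (\<lambda>q. dfun M ?z q (Y q)) p v + (A (?y p) (dfun M ?z p v) + A (dfun M ?y p v) (?z p))" for v
      unfolding dfun_add[OF atlas s1 s2 p] dfun_bilinear[OF atlas A_bounded \<theta>_smooth[OF Y] \<theta>_smooth[OF Z] p] ..
    finally show ?thesis by (simp add: frame_connD[OF D F(1) p] F(2)[OF p])
  qed
  have br: "D p (lie_bracket M X Y p) Z = E (dfun M (\<lambda>q. dfun M ?z q (Y q)) p (X p) - dfun M (\<lambda>q. dfun M ?z q (X q)) p (Y p)
      + A (dfun M ?y p (X p) - dfun M ?x p (Y p) + b (?x p) (?y p)) (?z p)) p"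
    by (simp add: frame_connD[OF D Z p] \<theta>_lie_bracket[OF X Y p] dfun_lie_bracket[OF atlas X Y \<theta>_smooth[OF Z] p])
  show ?thesis
    unfolding curvature_def *[OF X Y] *[OF Y X] br
    by (simp add: bilinear_radd[OF A] bilinear_ladd[OF A] bilinear_lsub[OF A]
      flip: linear_diff[OF E_linear[OF pp]])
qed

lemma frame_conn_Ricci:
  assumes p: "p \<in> points M" and b: "bilinear b"
  shows "Ricci M D p u v =
    tr (\<lambda>z. A z (A (\<theta> p u) (\<theta> p v)) - A (\<theta> p u) (A z (\<theta> p v)) - A (b z (\<theta> p u)) (\<theta> p v))"
proof -
  let ?c = "chart_at M p"
  let ?K = "\<lambda>z. A z (A (\<theta> p u) (\<theta> p v)) - A (\<theta> p u) (A z (\<theta> p v)) - A (b z (\<theta> p u)) (\<theta> p v)"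
  have c: "?c \<in> M" "p \<in> fst ?c" using chart_at[OF p] by auto
  have coord: "coord_field M ?c w p = w" for w
    using coord_field_component(1)[OF atlas c, of w] dfun_chart_at[OF atlas p] by simp
  note F = vector_field_on_coord_field[OF atlas c(1)]
  have "Ricci M D p u v = tr (\<lambda>z. E (?K (\<theta> p z)) p)"
    unfolding Ricci_def Let_def frame_conn_curvature[OF F F F c(2)] coord ..
  \<comment> \<open>The trace is taken on the coordinate tangent space while the algebra lives in
    the frame; cyclicity of the trace removes the conjugation by \<open>\<theta> p\<close>.\<close>
  also have "\<dots> = tr (\<lambda>z. ?K (\<theta> p (E z p)))"
  proof (rule tr_commute[OF E_linear[OF p], of "\<lambda>z. ?K (\<theta> p z)"])
    have "linear ?K"
      by (rule linearI) (simp_all add: bilinear_radd[OF A] bilinear_ladd[OF A] bilinear_rmul[OF A] bilinear_lmul[OF A]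
          bilinear_ladd[OF b] bilinear_lmul[OF b] scaleR_diff_right)
    from linear_compose[OF \<theta>_linear[OF p] this] show "linear (\<lambda>z. ?K (\<theta> p z))" by (simp add: comp_def)
  qed
  finally show ?thesis by (simp add: \<theta>_E[OF p])
qed

lemma frame_conn_radiant:
  assumes "\<And>r s. A r s - A s r = b r s" "\<And>r. A r t = r"
  shows "radiant_structure M D (E t)"
  unfolding radiant_structure_def
  using frame_conn_affine frame_conn_torsion_free[OF assms(1)] E_field frame_conn_E[OF D] assms(2) E_\<theta>
  by auto

end

text \<open>By the Leibniz rule, multiplication by the indicator function of \<open>W\<close>, which
  is smooth on \<open>W\<close> with zero differential, leaves covariant derivatives at
  \<open>p\<close> unchanged; it also makes the two fields equal as functions.\<close>

lemma affine_connection_local: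
  assumes D: "affine_connection M D" and Y: "vector_field_on M W Y" and Z: "\<And>q. q \<in> W \<Longrightarrow> Y q = Z q" and p: "p \<in> W"
  shows "D p v Y = D p v Z"
proof -
  have W: "openin (mtop M) W" by (rule vector_field_onD[OF atlas Y])
  have Z': "vector_field_on M W Z" by (rule vector_field_on_cong[OF atlas Y]) (rule Z)
  define f where "f = (indicator W :: 'a \<Rightarrow> real)"
  have "vsmooth_on M W f"
    by (rule vsmooth_on_cong[OF atlas vsmooth_on_const[OF atlas W, of 1]]) (simp add: f_def)
  then have f: "smooth_fun_on M W f" by (simp add: smooth_fun_on_eq)
  have df: "dfun M f p v = 0"
    using dfun_cong[OF atlas W p, of f "\<lambda>q. 1"] dfun_const[OF atlas, of 1 p v] by (simp add: f_def)
  have *: "D p v (\<lambda>q. f q *\<^sub>R X q) = D p v X" if "vector_field_on M W X" for X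
  proof -
    have "D p v (\<lambda>q. f q *\<^sub>R X q) = dfun M f p v *\<^sub>R X p + f p *\<^sub>R D p v X"
      using D that f p by (simp add: affine_connection_def)
    then show ?thesis using p by (simp add: df, simp add: f_def)
  qed
  have "f q *\<^sub>R Y q = f q *\<^sub>R Z q" for q by (cases "q \<in> W") (simp_all add: f_def Z)
  then have "(\<lambda>q. f q *\<^sub>R Y q) = (\<lambda>q. f q *\<^sub>R Z q)" by (rule ext)
  then show ?thesis using *[OF Y] *[OF Z'] by metis
qed

text \<open>A local field is a combination of frame fields with smooth coefficients, so additivity
  and the Leibniz rule determine the connection from its values on pairs of frame fields.\<close>

lemma affine_connection_frame_conn:
  assumes D: "affine_connection M D" and A: "bilinear A"
    and DA: "\<And>p r s. p \<in> points M \<Longrightarrow> D p (E r p) (E s) = E (A r s) p"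
  shows "frame_conn A D"
  unfolding frame_conn_def
proof (intro allI impI ballI)
  fix W Y p v assume Y: "vector_field_on M W Y" and p: "p \<in> W"
  have W: "openin (mtop M) W" by (rule vector_field_onD[OF atlas Y])
  have pp: "p \<in> points M" by (rule in_points[OF W p])
  let ?y = "\<lambda>q. \<theta> q (Y q)"
  note y = \<theta>_smooth[OF Y]
  have yb: "vsmooth_on M W (\<lambda>q. ?y q \<bullet> i)" for i
    by (rule vsmooth_on_linear[OF atlas bounded_linear_inner_left y])
  have F: "vector_field_on M W (\<lambda>q. (?y q \<bullet> i) *\<^sub>R E i q)" for i
  proof -
    have "vector_field_on M W (\<lambda>q. E ((?y q \<bullet> i) *\<^sub>R i) q)"
      by (rule vector_field_onI_frame[OF vsmooth_on_linear[OF atlas bounded_linear_scaleR_left yb]])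
    then show ?thesis
      by (rule vector_field_on_cong[OF atlas]) (simp add: linear_scale[OF E_linear[OF in_points[OF W]]])
  qed
  \<comment> \<open>The empty combination, with which the induction over partial sums
    starts.\<close>
  have zero: "D p v (\<lambda>q. 0) = 0"
  proof -
    have "smooth_fun_on M W (\<lambda>q. 0)" by (simp add: smooth_fun_on_eq vsmooth_on_const[OF atlas W])
    then have "D p v (\<lambda>q. 0 *\<^sub>R Y q) = dfun M (\<lambda>q. 0) p v *\<^sub>R Y p + 0 *\<^sub>R D p v Y"
      using D Y p unfolding affine_connection_def by blast
    then show ?thesis by (simp add: dfun_const[OF atlas])
  qed
  have sumF: "vector_field_on M W (\<lambda>q. \<Sum>i\<in>I. (?y q \<bullet> i) *\<^sub>R E i q)" for I
  proof -
    have "vector_field_on M W (\<lambda>q. E (\<Sum>i\<in>I. (?y q \<bullet> i) *\<^sub>R i) q)"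
      by (rule vector_field_onI_frame[OF vsmooth_on_sum[OF atlas W vsmooth_on_linear[OF atlas bounded_linear_scaleR_left yb]]])
    then show ?thesis
      by (rule vector_field_on_cong[OF atlas])
        (simp add: linear_sum[OF E_linear[OF in_points[OF W]]] linear_scale[OF E_linear[OF in_points[OF W]]])
  qed
  have DE: "D p v (E s) = E (A (\<theta> p v) s) p" for s
    using DA[OF pp, of "\<theta> p v" s] by (simp add: E_\<theta>[OF pp])
  have "D p v Y = D p v (\<lambda>q. \<Sum>i\<in>Basis. (?y q \<bullet> i) *\<^sub>R E i q)"
  proof (rule affine_connection_local[OF D Y _ p])
    fix q assume "q \<in> W"
    then have q: "q \<in> points M" by (rule in_points[OF W])
    show "Y q = (\<Sum>i\<in>Basis. (?y q \<bullet> i) *\<^sub>R E i q)"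
      using linear_basis_sum[OF E_linear[OF q], of "?y q"] by (simp add: E_\<theta>[OF q])
  qed
  also have "D p v (\<lambda>q. \<Sum>i\<in>I. (?y q \<bullet> i) *\<^sub>R E i q) = (\<Sum>i\<in>I. D p v (\<lambda>q. (?y q \<bullet> i) *\<^sub>R E i q))" if "finite I" for I
    using that
  proof (induction I)
    case empty
    show ?case by (simp add: zero)
  next
    case (insert i I)
    have "D p v (\<lambda>q. (?y q \<bullet> i) *\<^sub>R E i q + (\<Sum>i\<in>I. (?y q \<bullet> i) *\<^sub>R E i q))
      = D p v (\<lambda>q. (?y q \<bullet> i) *\<^sub>R E i q) + D p v (\<lambda>q. \<Sum>i\<in>I. (?y q \<bullet> i) *\<^sub>R E i q)"
      using D F[of i] sumF[of I] p unfolding affine_connection_def by blast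
    then show ?case using insert by simp
  qed
  also have "(\<Sum>i\<in>Basis. D p v (\<lambda>q. (?y q \<bullet> i) *\<^sub>R E i q))
      = (\<Sum>i\<in>Basis. E ((dfun M ?y p v \<bullet> i) *\<^sub>R i) p + E ((?y p \<bullet> i) *\<^sub>R A (\<theta> p v) i) p)"
  proof (rule sum.cong[OF refl])
    fix i :: 'e
    have "smooth_fun_on M W (\<lambda>q. ?y q \<bullet> i)" by (simp add: smooth_fun_on_eq yb)
    then have "D p v (\<lambda>q. (?y q \<bullet> i) *\<^sub>R E i q) = dfun M (\<lambda>q. ?y q \<bullet> i) p v *\<^sub>R E i p + (?y p \<bullet> i) *\<^sub>R D p v (E i)"
      using D E_field_on[OF W, of i] p unfolding affine_connection_def by blast
    then show "D p v (\<lambda>q. (?y q \<bullet> i) *\<^sub>R E i q) = E ((dfun M ?y p v \<bullet> i) *\<^sub>R i) p + E ((?y p \<bullet> i) *\<^sub>R A (\<theta> p v) i) p"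
      by (simp add: dfun_comp_linear[OF atlas bounded_linear_inner_left y p] DE linear_scale[OF E_linear[OF pp]])
  qed
  also have "\<dots> = E (\<Sum>i\<in>Basis. (dfun M ?y p v \<bullet> i) *\<^sub>R i) p + E (\<Sum>i\<in>Basis. (?y p \<bullet> i) *\<^sub>R A (\<theta> p v) i) p"
    by (simp add: sum.distrib linear_sum[OF E_linear[OF pp]])
  also have "(\<Sum>i\<in>Basis. (?y p \<bullet> i) *\<^sub>R A (\<theta> p v) i) = A (\<theta> p v) (?y p)"
    by (rule linear_basis_sum[symmetric]) (use A in \<open>simp add: bilinear_def\<close>)
  finally show "D p v Y = E (dfun M ?y p v + A (\<theta> p v) (?y p)) p"
    by (simp add: euclidean_representation linear_add[OF E_linear[OF pp]])
qed

text \<open>\<open>\<alpha>\<close> is the matrix of the differential of \<open>\<phi>\<close> in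
  the frame, assumed to be the same at every point. It will be the identity for left translations
  and \<open>Ad\<close> for inner automorphisms.\<close>

lemma frame_conn_pullback:
  assumes D: "frame_conn A D" and bij: "bij_betw \<phi> (points M) (points M)"
    and \<phi>: "smooth_map M M \<phi>" and \<psi>: "smooth_map M M (inv_into (points M) \<phi>)"
    and \<alpha>: "\<And>p v. p \<in> points M \<Longrightarrow> \<theta> (\<phi> p) (tmap M M \<phi> p v) = \<alpha> (\<theta> p v)"
    and \<beta>: "linear \<alpha>" "\<And>v. \<beta> (\<alpha> v) = v" "\<And>v. \<alpha> (\<beta> v) = v"
  shows "frame_conn (\<lambda>r s. \<beta> (A (\<alpha> r) (\<alpha> s))) (pullback_conn M \<phi> D)"
  unfolding frame_conn_def
proof (intro allI impI ballI)
  fix W Y p v assume Y: "vector_field_on M W Y" and p: "p \<in> W"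
  have W: "openin (mtop M) W" by (rule vector_field_onD[OF atlas Y])
  have pp: "p \<in> points M" by (rule in_points[OF W p])
  let ?\<psi> = "inv_into (points M) \<phi>" and ?y = "\<lambda>q. \<theta> q (Y q)"
  note inj = bij_betw_imp_inj_on[OF bij]
  have \<psi>\<phi>: "?\<psi> (\<phi> q) = q" if "q \<in> points M" for q using inv_into_f_f[OF inj that] .
  have \<phi>\<psi>: "\<phi> (?\<psi> q) = q" if "q \<in> points M" for q using bij that by (metis bij_betw_def f_inv_into_f)
  have \<psi>p: "?\<psi> q \<in> points M" if "q \<in> points M" for q by (rule smooth_map_points[OF \<psi> that])
  have \<phi>p: "\<phi> p \<in> points M" by (rule smooth_map_points[OF \<phi> pp])
  let ?U = "{q \<in> points M. ?\<psi> q \<in> W}"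
  have La: "bounded_linear \<alpha>" using \<beta>(1) by (simp add: linear_conv_bounded_linear)
  note sy = vsmooth_on_linear[OF atlas La smooth_map_vsmooth[OF atlas atlas \<psi> \<theta>_smooth[OF Y]]]
  have U: "openin (mtop M) ?U" by (rule vsmooth_onD[OF sy])
  have push: "\<theta> q (push M \<phi> Y q) = \<alpha> (?y (?\<psi> q))" if "q \<in> points M" for q
    using \<alpha>[OF \<psi>p[OF that], of "Y (?\<psi> q)"] by (simp add: push_def Let_def \<phi>\<psi>[OF that])
  have F: "vector_field_on M ?U (push M \<phi> Y)"
    unfolding vector_field_on_iff by (rule vsmooth_on_cong[OF atlas sy]) (simp add: push)
  have pU: "\<phi> p \<in> ?U" using \<phi>p p pp by (simp add: \<psi>\<phi>)
  have "dfun M (\<lambda>q. \<theta> q (push M \<phi> Y q)) (\<phi> p) (tmap M M \<phi> p v) = dfun M (\<lambda>q. \<alpha> (?y (?\<psi> q))) (\<phi> p) (tmap M M \<phi> p v)"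
    by (subst dfun_cong[OF atlas U pU]) (auto simp: push)
  also have "\<dots> = dfun M (\<lambda>q. \<alpha> (?y (?\<psi> (\<phi> q)))) p v"
    by (rule dfun_tmap[OF atlas atlas \<phi> pp sy pU])
  also have "\<dots> = dfun M (\<lambda>q. \<alpha> (?y q)) p v"
    by (subst dfun_cong[OF atlas W p]) (auto simp: \<psi>\<phi>[OF in_points[OF W]])
  also have "\<dots> = \<alpha> (dfun M ?y p v)"
    by (rule dfun_comp_linear[OF atlas La \<theta>_smooth[OF Y] p])
  finally have Dp: "D (\<phi> p) (tmap M M \<phi> p v) (push M \<phi> Y) = E (\<alpha> (dfun M ?y p v) + A (\<alpha> (\<theta> p v)) (\<alpha> (?y p))) (\<phi> p)"
    by (simp add: frame_connD[OF D F pU] \<alpha>[OF pp] push[OF \<phi>p] \<psi>\<phi>[OF pp])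
  \<comment> \<open>Differentiating \<open>\<phi> (?\<psi> q) = q\<close> at \<open>\<phi> p\<close>
    shows that the matrix of the inverse map is \<open>\<beta>\<close>.\<close>
  have inv: "\<theta> p (tmap M M ?\<psi> (\<phi> p) w) = \<beta> (\<theta> (\<phi> p) w)" for w
  proof -
    have "w = tmap M M (\<lambda>q. \<phi> (?\<psi> q)) (\<phi> p) w"
      using tmap_cong[OF atlas atlas openin_points[OF atlas] \<phi>p, of "\<lambda>q. \<phi> (?\<psi> q)" "\<lambda>q. q" w] \<phi>\<psi>
      by (simp add: tmap_id[OF atlas \<phi>p])
    also have "\<dots> = tmap M M \<phi> p (tmap M M ?\<psi> (\<phi> p) w)"
      by (simp add: tmap_compose[OF atlas atlas atlas \<psi> \<phi> \<phi>p] \<psi>\<phi>[OF pp])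
    finally have "\<theta> (\<phi> p) w = \<alpha> (\<theta> p (tmap M M ?\<psi> (\<phi> p) w))" using \<alpha>[OF pp] by metis
    then show ?thesis by (simp add: \<beta>)
  qed
  have "linear \<beta>"
  proof (rule linearI)
    show "\<beta> (r + s) = \<beta> r + \<beta> s" for r s
      using \<beta>(2)[of "\<beta> r + \<beta> s"] by (simp add: linear_add[OF \<beta>(1)] \<beta>(3))
    show "\<beta> (c *\<^sub>R r) = c *\<^sub>R \<beta> r" for c r
      using \<beta>(2)[of "c *\<^sub>R \<beta> r"] by (simp add: linear_scale[OF \<beta>(1)] \<beta>(3))
  qed
  have "\<theta> p (pullback_conn M \<phi> D p v Y) = dfun M ?y p v + \<beta> (A (\<alpha> (\<theta> p v)) (\<alpha> (?y p)))"
    by (simp add: pullback_conn_def inv Dp \<theta>_E[OF \<phi>p] linear_add[OF \<open>linear \<beta>\<close>] \<beta>)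
  then show "pullback_conn M \<phi> D p v Y = E (dfun M ?y p v + \<beta> (A (\<alpha> (\<theta> p v)) (\<alpha> (?y p)))) p"
    by (metis E_\<theta> pp)
qed

text \<open>\<open>cov_along\<close> combines the derivative of components in a chart with the
  covariant derivative of a coordinate field. Both are rewritten in the frame, where the derivatives
  of the matrix \<open>F\<close> between frame and chart cancel.\<close>

lemma frame_conn_cov_along:
  fixes S :: "('s, 'f::euclidean_space) atlas"
  assumes D: "frame_conn A D" and S: "smooth_atlas S" and f: "smooth_map S M f"
    and V: "vsmooth_on S W (\<lambda>\<sigma>. \<theta> (f \<sigma>) (V \<sigma>))" and s: "s \<in> W"
  shows "cov_along S M D f s u V =
    E (dfun S (\<lambda>\<sigma>. \<theta> (f \<sigma>) (V \<sigma>)) s u + A (\<theta> (f s) (tmap S M f s u)) (\<theta> (f s) (V s))) (f s)"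
proof -
  have W: "openin (mtop S) W" by (rule vsmooth_onD[OF V])
  have WS: "W \<subseteq> points S" by (rule openin_mtop_subset[OF S W])
  have ss: "s \<in> points S" using WS s by auto
  have fp: "f \<sigma> \<in> points M" if "\<sigma> \<in> W" for \<sigma> using smooth_map_points[OF f] WS that by auto
  let ?c = "chart_at M (f s)" and ?v = "\<lambda>\<sigma>. \<theta> (f \<sigma>) (V \<sigma>)" and ?u = "tmap S M f s u"
  have c: "?c \<in> M" "f s \<in> fst ?c" using chart_at[OF fp[OF s]] by auto
  have o: "openin (mtop M) (fst ?c)" by (rule openin_chart[OF atlas c(1)])
  define F where "F q r = dfun M (snd ?c) q (E r q)" for q r
  have F: "vsmooth_on M (fst ?c) (\<lambda>q. F q r)" "q \<in> fst ?c \<Longrightarrow> linear (F q)" for q r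
    using dfun_E[OF vsmooth_on_snd[OF atlas c(1)]] by (simp_all add: F_def[abs_def])
  have Fs: "F (f s) r = E r (f s)" for r
    by (simp add: F_def dfun_chart_at[OF atlas fp[OF s]])
  let ?U = "W \<inter> {\<sigma> \<in> points S. f \<sigma> \<in> fst ?c}"
  note sF = smooth_map_vsmooth[OF S atlas f F(1)]
  have U: "openin (mtop S) ?U" by (rule openin_Int[OF W vsmooth_onD[OF sF]])
  have sU: "s \<in> ?U" using s ss c by auto
  let ?Y = "coord_field M ?c (V s)"
  note Y = vector_field_on_coord_field[OF atlas c(1), of "V s"]
  have Ys: "?Y (f s) = V s"
    using coord_field_component(1)[OF atlas c, of "V s"] dfun_chart_at[OF atlas fp[OF s]] by simp
  have "dfun S (\<lambda>\<sigma>. component M ?c (f \<sigma>) (V \<sigma>)) s u = dfun S (\<lambda>\<sigma>. F (f \<sigma>) (?v \<sigma>)) s u"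
    by (subst dfun_cong[OF S U sU]) (auto simp: component_def F_def E_\<theta>[OF fp])
  also have "\<dots> = dfun S (\<lambda>\<sigma>. F (f \<sigma>) (?v s)) s u + F (f s) (dfun S ?v s u)"
    by (rule dfun_apply[OF S vsmooth_on_subset[OF sF U] F(2) vsmooth_on_subset[OF V U] sU]) auto
  also have "dfun S (\<lambda>\<sigma>. F (f \<sigma>) (?v s)) s u = dfun M (\<lambda>q. F q (?v s)) (f s) ?u"
    by (rule dfun_tmap[OF S atlas f ss F(1) c(2), symmetric])
  finally have 1: "dfun S (\<lambda>\<sigma>. component M ?c (f \<sigma>) (V \<sigma>)) s u
      = dfun M (\<lambda>q. F q (?v s)) (f s) ?u + E (dfun S ?v s u) (f s)" by (simp add: Fs)
  \<comment> \<open>The coordinate field has constant components in its chart; differentiating this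
    expresses the derivative of \<open>F\<close> through the frame coefficients of that
    field.\<close>
  have "0 = dfun M (\<lambda>q. V s) (f s) ?u" by (simp add: dfun_const[OF atlas])
  also have "\<dots> = dfun M (\<lambda>q. F q (\<theta> q (?Y q))) (f s) ?u"
    by (subst dfun_cong[OF atlas o c(2)])
      (auto simp: F_def E_\<theta>[OF in_points[OF o]] coord_field_component(2)[OF atlas c(1)])
  also have "\<dots> = dfun M (\<lambda>q. F q (\<theta> (f s) (?Y (f s)))) (f s) ?u + F (f s) (dfun M (\<lambda>q. \<theta> q (?Y q)) (f s) ?u)"
    by (rule dfun_apply[OF atlas F \<theta>_smooth[OF Y] c(2)])
  finally have 2: "dfun M (\<lambda>q. F q (?v s)) (f s) ?u = - E (dfun M (\<lambda>q. \<theta> q (?Y q)) (f s) ?u) (f s)"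
    by (simp add: Fs Ys eq_neg_iff_add_eq_0)
  show ?thesis
    unfolding cov_along_def Let_def 1 2
    by (simp add: frame_connD[OF D Y c(2)] Ys linear_add[OF E_linear[OF fp[OF s]]])
qed

text \<open>Here \<open>J\<close> is the differential of \<open>f\<close> in the two trivializations. The hypothesis on \<open>A\<close> says that
  \<open>f\<close> is totally geodesic with induced connection given by \<open>A\<^sub>S\<close>.\<close>

lemma frame_conn_immersion:
  fixes S :: "('s, 'f::euclidean_space) atlas"
  assumes D: "frame_conn A D" and S: "parallelism S ES \<theta>S bS" and f: "smooth_map S M f"
    and J: "\<And>r. vsmooth_on S (points S) (\<lambda>s. J s r)" "\<And>s. s \<in> points S \<Longrightarrow> linear (J s)"
    and fJ: "\<And>s v. s \<in> points S \<Longrightarrow> \<theta> (f s) (tmap S M f s v) = J s (\<theta>S s v)"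
    and AJ: "\<And>s v y. s \<in> points S \<Longrightarrow> dfun S (\<lambda>\<sigma>. J \<sigma> y) s v + A (J s (\<theta>S s v)) (J s y) = J s (AS (\<theta>S s v) y)"
  shows "totally_geodesic S M D f"
    and "immersion S M f \<Longrightarrow> parallelism.frame_conn S ES \<theta>S AS (induced_conn S M D f)"
proof -
  interpret S: parallelism S ES \<theta>S bS by (rule S)
  have key: "cov_along S M D f s v (\<lambda>\<sigma>. tmap S M f \<sigma> (Y \<sigma>))
      = tmap S M f s (ES (dfun S (\<lambda>q. \<theta>S q (Y q)) s v + AS (\<theta>S s v) (\<theta>S s (Y s))) s)"
    if Y: "vector_field_on S W Y" and s: "s \<in> W" for W Y s v
  proof -
    have W: "openin (mtop S) W" by (rule vector_field_onD[OF S.atlas Y])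
    have pS: "\<sigma> \<in> points S" if "\<sigma> \<in> W" for \<sigma> by (rule S.in_points[OF W that])
    have fs: "f s \<in> points M" by (rule smooth_map_points[OF f pS[OF s]])
    let ?y = "\<lambda>q. \<theta>S q (Y q)"
    note y = S.\<theta>_smooth[OF Y]
    have JW: "vsmooth_on S W (\<lambda>s. J s r)" for r by (rule vsmooth_on_subset[OF J(1) W]) (use pS in auto)
    have 1: "vsmooth_on S W (\<lambda>\<sigma>. J \<sigma> (?y \<sigma>))" by (rule vsmooth_on_apply[OF S.atlas JW J(2) y]) (rule pS)
    then have 2: "vsmooth_on S W (\<lambda>\<sigma>. \<theta> (f \<sigma>) (tmap S M f \<sigma> (Y \<sigma>)))"
      by (rule vsmooth_on_cong[OF S.atlas]) (simp add: fJ pS)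
    have "dfun S (\<lambda>\<sigma>. \<theta> (f \<sigma>) (tmap S M f \<sigma> (Y \<sigma>))) s v = dfun S (\<lambda>\<sigma>. J \<sigma> (?y \<sigma>)) s v"
      by (subst dfun_cong[OF S.atlas W s]) (auto simp: fJ pS)
    also have "\<dots> = dfun S (\<lambda>\<sigma>. J \<sigma> (?y s)) s v + J s (dfun S ?y s v)"
      by (rule dfun_apply[OF S.atlas JW J(2) y s]) (rule pS)
    finally have 3: "dfun S (\<lambda>\<sigma>. \<theta> (f \<sigma>) (tmap S M f \<sigma> (Y \<sigma>))) s v + A (J s (\<theta>S s v)) (J s (?y s))
        = J s (dfun S ?y s v + AS (\<theta>S s v) (?y s))"
      using AJ[OF pS[OF s], of "?y s" v] by (simp add: linear_add[OF J(2)[OF pS[OF s]]] algebra_simps)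
    have "\<theta> (f s) (cov_along S M D f s v (\<lambda>\<sigma>. tmap S M f \<sigma> (Y \<sigma>)))
      = \<theta> (f s) (tmap S M f s (ES (dfun S ?y s v + AS (\<theta>S s v) (?y s)) s))"
      by (simp add: frame_conn_cov_along[OF D S.atlas f 2 s] \<theta>_E[OF fs] fJ[OF pS[OF s]] S.\<theta>_E[OF pS[OF s]] 3)
    then show ?thesis by (metis E_\<theta> fs)
  qed
  show "totally_geodesic S M D f" unfolding totally_geodesic_def using key by auto
  assume im: "immersion S M f"
  show "S.frame_conn AS (induced_conn S M D f)"
    unfolding S.frame_conn_def
  proof (intro allI impI ballI)
    fix W Y s v assume Y: "vector_field_on S W Y" and s: "s \<in> W"
    have "s \<in> points S" by (rule S.in_points[OF vector_field_onD[OF S.atlas Y] s])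
    then have inj: "inj (tmap S M f s)" using im by (simp add: immersion_def)
    show "induced_conn S M D f s v Y = ES (dfun S (\<lambda>q. \<theta>S q (Y q)) s v + AS (\<theta>S s v) (\<theta>S s (Y s))) s"
      unfolding induced_conn_def key[OF Y s] by (rule the_equality) (use inj in \<open>auto dest: injD\<close>)
  qed
qed

end

section \<open>Lie groups\<close>

context
  fixes M :: "('a, 'e::euclidean_space) atlas"
  assumes M: "smooth_atlas M"
begin

lemma dfun_Pair:
  assumes "vsmooth_on M W f" "vsmooth_on M W g" "p \<in> W"
  shows "dfun M (\<lambda>q. (f q, g q)) p v = (dfun M f p v, dfun M g p v)"
  using dfun_eqI[OF M, of "\<lambda>q. (f q, g q)"] has_derivative_Pair[OF dfun_has_derivative[OF M assms(1,3)] dfun_has_derivative[OF M assms(2,3)]]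
  by (simp add: comp_def)

lemma dfun_compose:
  assumes g: "vsmooth_on M W g" "p \<in> W" and \<Phi>: "smooth_on T \<Phi>" "g p \<in> T"
  shows "dfun M (\<lambda>q. \<Phi> (g q)) p v = frechet_derivative \<Phi> (at (g p)) (dfun M g p v)"
proof -
  have "p \<in> points M" using openin_mtop_subset[OF M vsmooth_onD[OF g(1)]] g(2) by auto
  then have 1: "(g \<circ> chart_inv (chart_at M p)) (snd (chart_at M p) p) = g p"
    using chart_inv_snd[OF M] chart_at[of p M] by simp
  have "(\<Phi> \<circ> (g \<circ> chart_inv (chart_at M p)) has_derivative frechet_derivative \<Phi> (at (g p)) \<circ> dfun M g p) (at (snd (chart_at M p) p))"
    by (rule diff_chain_at[OF dfun_has_derivative[OF M g]]) (unfold 1, rule smooth_on_has_derivative[OF \<Phi>])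
  then have "((\<lambda>q. \<Phi> (g q)) \<circ> chart_inv (chart_at M p) has_derivative frechet_derivative \<Phi> (at (g p)) \<circ> dfun M g p) (at (snd (chart_at M p) p))"
    by (simp add: comp_def)
  from dfun_eqI[OF M this] show ?thesis by simp
qed

end

lemma section_on_const:
  assumes S: "smooth_atlas S" and M: "smooth_atlas M" and q: "q \<in> points M"
  shows "section_on S (points S) M (\<lambda>s. q) (\<lambda>s. v)"
proof (rule section_onI[OF S M smooth_map_const[OF S M q] openin_points[OF S]])
  fix s assume "s \<in> points S"
  then show "\<exists>d\<in>M. \<exists>U. s \<in> U \<and> U \<subseteq> points S \<and> (\<lambda>s. q) ` U \<subseteq> fst d \<and> vsmooth_on S U (\<lambda>s. dfun M (snd d) q v)"
    using chart_at[OF q] vsmooth_on_const[OF S openin_points[OF S]]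
    by (intro bexI[of _ "chart_at M q"] exI[of _ "points S"]) auto
qed

lemma section_on_zero:
  assumes S: "smooth_atlas S" and M: "smooth_atlas M" and b: "smooth_map S M b" and W: "openin (mtop S) W"
  shows "section_on S W M b (\<lambda>s. 0)"
  unfolding section_on_def
proof (intro conjI ballI W)
  fix d assume d: "d \<in> M"
  have "openin (mtop S) (W \<inter> {s \<in> points S. b s \<in> fst d})"
    by (rule openin_Int[OF W vsmooth_onD[OF smooth_map_snd[OF S M b d]]])
  also have "W \<inter> {s \<in> points S. b s \<in> fst d} = {s \<in> W. b s \<in> fst d}"
    using openin_mtop_subset[OF S W] by auto
  finally have o: "openin (mtop S) {s \<in> W. b s \<in> fst d}" .
  show "vsmooth_on S {s \<in> W. b s \<in> fst d} (\<lambda>s. dfun M (snd d) (b s) 0)"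
    by (rule vsmooth_on_cong[OF S vsmooth_on_const[OF S o, of 0]])
      (simp add: linear_0[OF dfun_linear[OF M vsmooth_on_snd[OF M d]]])
qed

lemma lie_bracket_antisym: "lie_bracket M X Y p = - lie_bracket M Y X p"
  by (simp add: lie_bracket_def Let_def)

section \<open>Multiplication of a Lie group in charts\<close>

locale lie_group =
  fixes G :: "'a monoid" (structure) and M :: "('a, 'e::euclidean_space) atlas"
  assumes Lie_group: "Lie_group G M"
begin

sublocale group G using Lie_group by (simp add: Lie_group_def)

lemma atlas: "smooth_atlas M" using Lie_group by (simp add: Lie_group_def manifold_def)

lemma points: "points M = carrier G" using Lie_group by (simp add: Lie_group_def)

lemma inv_smooth: "smooth_map M M (\<lambda>x. inv x)" using Lie_group by (simp add: Lie_group_def)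

text \<open>Turns smoothness for the product atlas into a smooth function \<open>\<Psi>\<close> on
  an open set of pairs of coordinates, so that no product manifold occurs afterwards.\<close>

lemma mult_in_charts:
  assumes c: "c \<in> M" and d: "d \<in> M" and e: "e \<in> M"
  obtains Q \<Psi> where "open Q" "smooth_on Q \<Psi>"
    "\<And>x y. x \<in> fst c \<Longrightarrow> y \<in> fst d \<Longrightarrow> (snd c x, snd d y) \<in> Q \<longleftrightarrow> x \<otimes> y \<in> fst e"
    "\<And>x y. x \<in> fst c \<Longrightarrow> y \<in> fst d \<Longrightarrow> x \<otimes> y \<in> fst e \<Longrightarrow> \<Psi> (snd c x, snd d y) = snd e (x \<otimes> y)"
proof -
  let ?m = "\<lambda>(x, y). x \<otimes> y" and ?cd = "(fst c \<times> fst d, map_prod (snd c) (snd d))"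
  let ?Q = "snd ?cd ` (fst ?cd \<inter> ?m -` fst e)" and ?\<Psi> = "snd e \<circ> ?m \<circ> chart_inv ?cd"
  have "smooth_map (prod_atlas M M) M ?m" using Lie_group by (simp add: Lie_group_def)
  moreover have "?cd \<in> prod_atlas M M" using c d unfolding prod_atlas_def by blast
  ultimately have Q: "open ?Q" "smooth_on ?Q ?\<Psi>" using e unfolding smooth_map_def by blast+
  have inj: "inj_on (snd c) (fst c)" "inj_on (snd d) (fst d)" using atlas c d by (auto simp: smooth_atlas_def)
  then have "inj_on (snd ?cd) (fst ?cd)" by (simp add: map_prod_inj_on)
  then have inv: "chart_inv ?cd (snd c x, snd d y) = (x, y)" if "x \<in> fst c" "y \<in> fst d" for x y
    using inv_into_f_f[of "snd ?cd" "fst ?cd" "(x, y)"] that by (simp add: chart_inv_def)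
  show thesis
  proof (rule that[OF Q])
    show "(snd c x, snd d y) \<in> ?Q \<longleftrightarrow> x \<otimes> y \<in> fst e" if "x \<in> fst c" "y \<in> fst d" for x y
      using that inj by (auto simp: inj_on_def)
    show "?\<Psi> (snd c x, snd d y) = snd e (x \<otimes> y)" if "x \<in> fst c" "y \<in> fst d" "x \<otimes> y \<in> fst e" for x y
      using inv[OF that(1,2)] by simp
  qed
qed

lemma smooth_map_mult:
  assumes S: "smooth_atlas S" and a: "smooth_map S M a" and b: "smooth_map S M b"
  shows "smooth_map S M (\<lambda>s. a s \<otimes> b s)"
proof (rule smooth_mapI[OF S atlas])
  fix s assume s: "s \<in> points S"
  have ab: "a s \<in> carrier G" "b s \<in> carrier G"
    using smooth_map_points[OF a s] smooth_map_points[OF b s] by (auto simp: points)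
  let ?c = "chart_at M (a s)" and ?d = "chart_at M (b s)" and ?e = "chart_at M (a s \<otimes> b s)"
  have c: "?c \<in> M" "a s \<in> fst ?c" and d: "?d \<in> M" "b s \<in> fst ?d" and e: "?e \<in> M" "a s \<otimes> b s \<in> fst ?e"
    using chart_at[of _ M] ab by (simp_all add: points)
  obtain Q \<Psi> where Q: "open Q" "smooth_on Q \<Psi>"
    "\<And>x y. x \<in> fst ?c \<Longrightarrow> y \<in> fst ?d \<Longrightarrow> (snd ?c x, snd ?d y) \<in> Q \<longleftrightarrow> x \<otimes> y \<in> fst ?e"
    "\<And>x y. x \<in> fst ?c \<Longrightarrow> y \<in> fst ?d \<Longrightarrow> x \<otimes> y \<in> fst ?e \<Longrightarrow> \<Psi> (snd ?c x, snd ?d y) = snd ?e (x \<otimes> y)"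
    using mult_in_charts[OF c(1) d(1) e(1)] by blast
  note sa = smooth_map_snd[OF S atlas a c(1)] and sb = smooth_map_snd[OF S atlas b d(1)]
  let ?U = "{s \<in> points S. a s \<in> fst ?c} \<inter> {s \<in> points S. b s \<in> fst ?d}"
  have U: "openin (mtop S) ?U" by (rule openin_Int[OF vsmooth_onD[OF sa] vsmooth_onD[OF sb]])
  have ab': "vsmooth_on S ?U (\<lambda>s. (snd ?c (a s), snd ?d (b s)))"
    by (rule vsmooth_on_Pair[OF S vsmooth_on_subset[OF sa U inf_le1] vsmooth_on_subset[OF sb U inf_le2]])
  let ?V = "{s \<in> ?U. (snd ?c (a s), snd ?d (b s)) \<in> Q}"
  have V: "openin (mtop S) ?V" by (rule openin_vsmooth_preimage[OF S ab' Q(1)])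
  have "vsmooth_on S ?V (\<lambda>s. \<Psi> (snd ?c (a s), snd ?d (b s)))"
    by (rule vsmooth_on_compose[OF S vsmooth_on_subset[OF ab' V] Q(2,1)]) auto
  then have 1: "vsmooth_on S ?V (\<lambda>s. snd ?e (a s \<otimes> b s))"
  proof (rule vsmooth_on_cong[OF S])
    fix s assume "s \<in> ?V"
    then show "\<Psi> (snd ?c (a s), snd ?d (b s)) = snd ?e (a s \<otimes> b s)"
      using Q(3)[of "a s" "b s"] by (intro Q(4)) auto
  qed
  show "\<exists>d\<in>M. \<exists>U. s \<in> U \<and> (\<lambda>s. a s \<otimes> b s) ` U \<subseteq> fst d \<and> vsmooth_on S U (\<lambda>q. snd d (a q \<otimes> b q))"
  proof (rule bexI[OF _ e(1)], rule exI[of _ ?V], intro conjI 1)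
    show "s \<in> ?V" using s c d e Q(3)[OF c(2) d(2)] by auto
    show "(\<lambda>s. a s \<otimes> b s) ` ?V \<subseteq> fst ?e" using Q(3) by blast
  qed
qed

lemma mult_fun_in_charts:
  fixes f :: "'a \<Rightarrow> 'c::euclidean_space"
  assumes f: "vsmooth_on M U f" and xy: "x0 \<otimes> y0 \<in> U" and c: "c \<in> M" "x0 \<in> fst c" and d: "d \<in> M" "y0 \<in> fst d"
  obtains Q \<Phi> where "open Q" "smooth_on Q \<Phi>" "(snd c x0, snd d y0) \<in> Q"
    "\<And>x y. x \<in> fst c \<Longrightarrow> y \<in> fst d \<Longrightarrow> (snd c x, snd d y) \<in> Q \<Longrightarrow> x \<otimes> y \<in> U \<and> \<Phi> (snd c x, snd d y) = f (x \<otimes> y)"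
proof -
  let ?e = "chart_at M (x0 \<otimes> y0)"
  have U: "openin (mtop M) U" by (rule vsmooth_onD[OF f])
  have e: "?e \<in> M" "x0 \<otimes> y0 \<in> fst ?e" using chart_at[of "x0 \<otimes> y0" M] openin_mtop_subset[OF atlas U] xy by auto
  obtain Q \<Psi> where Q: "open Q" "smooth_on Q \<Psi>"
    "\<And>x y. x \<in> fst c \<Longrightarrow> y \<in> fst d \<Longrightarrow> (snd c x, snd d y) \<in> Q \<longleftrightarrow> x \<otimes> y \<in> fst ?e"
    "\<And>x y. x \<in> fst c \<Longrightarrow> y \<in> fst d \<Longrightarrow> x \<otimes> y \<in> fst ?e \<Longrightarrow> \<Psi> (snd c x, snd d y) = snd ?e (x \<otimes> y)"
    using mult_in_charts[OF c(1) d(1) e(1)] by blast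
  let ?T = "snd ?e ` (fst ?e \<inter> U)"
  have T: "open ?T" by (rule open_chart_image[OF atlas U e(1)])
  let ?Q = "\<Psi> -` ?T \<inter> Q"
  have Q': "open ?Q" using continuous_on_open_vimage[OF Q(1)] smooth_on_continuous[OF Q(2)] T by blast
  have *: "x \<otimes> y \<in> U \<and> x \<otimes> y \<in> fst ?e \<and> \<Psi> (snd c x, snd d y) = snd ?e (x \<otimes> y)"
    if z: "x \<in> fst c" "y \<in> fst d" "(snd c x, snd d y) \<in> ?Q" for x y
  proof -
    have e': "x \<otimes> y \<in> fst ?e" using Q(3)[OF z(1,2)] z(3) by auto
    note \<Psi> = Q(4)[OF z(1,2) e']
    obtain u where "u \<in> fst ?e" "u \<in> U" "snd ?e (x \<otimes> y) = snd ?e u" using z(3) \<Psi> by auto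
    then have "x \<otimes> y = u" using chart_inv_snd[OF atlas e(1)] e' by metis
    then show ?thesis using \<open>u \<in> U\<close> e' \<Psi> by simp
  qed
  show thesis
  proof
    show "open ?Q" by (rule Q')
    show "smooth_on ?Q (\<lambda>z. (f \<circ> chart_inv ?e) (\<Psi> z))"
      by (rule smooth_on_compose[OF smooth_on_subset[OF Q(2)] vsmooth_onD_chart[OF f e(1)] Q' T]) auto
    show "(snd c x0, snd d y0) \<in> ?Q" using Q(3,4)[OF c(2) d(2)] e xy by auto
    fix x y assume xy: "x \<in> fst c" "y \<in> fst d" "(snd c x, snd d y) \<in> ?Q"
    show "x \<otimes> y \<in> U \<and> (f \<circ> chart_inv ?e) (\<Psi> (snd c x, snd d y)) = f (x \<otimes> y)"
      using *[OF xy] chart_inv_snd[OF atlas e(1)] by simp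
  qed
qed

context
  fixes f :: "'a \<Rightarrow> 'c::euclidean_space" and c d Q \<Phi>
  assumes c: "c \<in> M" and d: "d \<in> M" and Q: "open Q" "smooth_on Q \<Phi>"
    and \<Phi>: "\<And>x y. x \<in> fst c \<Longrightarrow> y \<in> fst d \<Longrightarrow> (snd c x, snd d y) \<in> Q \<Longrightarrow> \<Phi> (snd c x, snd d y) = f (x \<otimes> y)"
begin

lemma dfun_mult_in_charts:
  assumes S: "smooth_atlas S" and a: "smooth_map S M a" and b: "smooth_map S M b" and s: "s \<in> points S"
    and ab: "a s \<in> fst c" "b s \<in> fst d" "(snd c (a s), snd d (b s)) \<in> Q"
  shows "dfun S (\<lambda>s. f (a s \<otimes> b s)) s v = frechet_derivative \<Phi> (at (snd c (a s), snd d (b s)))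
    (dfun M (snd c) (a s) (tmap S M a s v), dfun M (snd d) (b s) (tmap S M b s v))"
proof -
  note sa = smooth_map_snd[OF S atlas a c] and sb = smooth_map_snd[OF S atlas b d]
  let ?U = "{s \<in> points S. a s \<in> fst c} \<inter> {s \<in> points S. b s \<in> fst d}"
  have U: "openin (mtop S) ?U" by (rule openin_Int[OF vsmooth_onD[OF sa] vsmooth_onD[OF sb]])
  note sa' = vsmooth_on_subset[OF sa U inf_le1] and sb' = vsmooth_on_subset[OF sb U inf_le2]
  note ab' = vsmooth_on_Pair[OF S sa' sb']
  let ?V = "{s \<in> ?U. (snd c (a s), snd d (b s)) \<in> Q}"
  have V: "openin (mtop S) ?V" by (rule openin_vsmooth_preimage[OF S ab' Q(1)])
  have sV: "s \<in> ?V" and sU: "s \<in> ?U" using s ab by auto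
  have "dfun S (\<lambda>s. f (a s \<otimes> b s)) s v = dfun S (\<lambda>s. \<Phi> (snd c (a s), snd d (b s))) s v"
    by (subst dfun_cong[OF S V sV]) (auto simp: \<Phi>)
  also have "\<dots> = frechet_derivative \<Phi> (at (snd c (a s), snd d (b s))) (dfun S (\<lambda>s. (snd c (a s), snd d (b s))) s v)"
    by (rule dfun_compose[OF S ab' sU Q(2) ab(3)])
  also have "dfun S (\<lambda>s. (snd c (a s), snd d (b s))) s v = (dfun M (snd c) (a s) (tmap S M a s v), dfun M (snd d) (b s) (tmap S M b s v))"
    unfolding dfun_Pair[OF S sa' sb' sU]
    by (simp add: dfun_tmap[OF S atlas a s vsmooth_on_snd[OF atlas c] ab(1)] dfun_tmap[OF S atlas b s vsmooth_on_snd[OF atlas d] ab(2)])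
  finally show ?thesis .
qed

lemma
  assumes ab: "x \<in> fst c" "y \<in> fst d" "(snd c x, snd d y) \<in> Q"
  shows dfun_mult_left_in_charts: "dfun M (\<lambda>x. f (x \<otimes> y)) x v = frechet_derivative \<Phi> (at (snd c x, snd d y)) (dfun M (snd c) x v, 0)"
    and dfun_mult_right_in_charts: "dfun M (\<lambda>y. f (x \<otimes> y)) y w = frechet_derivative \<Phi> (at (snd c x, snd d y)) (0, dfun M (snd d) y w)"
proof -
  have p: "x \<in> points M" "y \<in> points M" using ab chart_subset_points[OF c] chart_subset_points[OF d] by auto
  have 0: "dfun M (snd c) x 0 = 0" "dfun M (snd d) y 0 = 0"
    by (rule linear_0[OF dfun_linear[OF atlas vsmooth_on_snd[OF atlas c] ab(1)]],
        rule linear_0[OF dfun_linear[OF atlas vsmooth_on_snd[OF atlas d] ab(2)]])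
  show "dfun M (\<lambda>x. f (x \<otimes> y)) x v = frechet_derivative \<Phi> (at (snd c x, snd d y)) (dfun M (snd c) x v, 0)"
    using dfun_mult_in_charts[OF atlas smooth_map_id[OF atlas] smooth_map_const[OF atlas atlas p(2)] p(1) ab]
    by (simp add: tmap_id[OF atlas p(1)] tmap_const[OF atlas atlas p(2,1)] 0)
  show "dfun M (\<lambda>y. f (x \<otimes> y)) y w = frechet_derivative \<Phi> (at (snd c x, snd d y)) (0, dfun M (snd d) y w)"
    using dfun_mult_in_charts[OF atlas smooth_map_const[OF atlas atlas p(1)] smooth_map_id[OF atlas] p(2) ab]
    by (simp add: tmap_id[OF atlas p(2)] tmap_const[OF atlas atlas p(1,2)] 0)
qed

end

text \<open>In charts the total derivative of the multiplication is linear on pairs and splits into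
  its two partial derivatives, which are those of a right and of a left translation.\<close>

lemma dfun_mult:
  fixes f :: "'a \<Rightarrow> 'c::euclidean_space"
  assumes f: "vsmooth_on M U f" and S: "smooth_atlas S" and a: "smooth_map S M a" and b: "smooth_map S M b"
    and s: "s \<in> points S" and ab: "a s \<otimes> b s \<in> U"
  shows "dfun S (\<lambda>s. f (a s \<otimes> b s)) s v =
    dfun M (\<lambda>x. f (x \<otimes> b s)) (a s) (tmap S M a s v) + dfun M (\<lambda>y. f (a s \<otimes> y)) (b s) (tmap S M b s v)"
proof -
  let ?c = "chart_at M (a s)" and ?d = "chart_at M (b s)"
  have c: "?c \<in> M" "a s \<in> fst ?c" and d: "?d \<in> M" "b s \<in> fst ?d"
    using chart_at[OF smooth_map_points[OF a s]] chart_at[OF smooth_map_points[OF b s]] by auto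
  obtain Q \<Phi> where Q: "open Q" "smooth_on Q \<Phi>" "(snd ?c (a s), snd ?d (b s)) \<in> Q"
    "\<And>x y. x \<in> fst ?c \<Longrightarrow> y \<in> fst ?d \<Longrightarrow> (snd ?c x, snd ?d y) \<in> Q \<Longrightarrow> x \<otimes> y \<in> U \<and> \<Phi> (snd ?c x, snd ?d y) = f (x \<otimes> y)"
    using mult_fun_in_charts[OF f ab c d] by blast
  note Q4 = conjunct2[OF Q(4)]
  have lin: "linear (frechet_derivative \<Phi> (at (snd ?c (a s), snd ?d (b s))))"
    by (rule has_derivative_linear[OF smooth_on_has_derivative[OF Q(2,3)]])
  show ?thesis
    using linear_add[OF lin, of "(dfun M (snd ?c) (a s) (tmap S M a s v), 0)" "(0, dfun M (snd ?d) (b s) (tmap S M b s v))"]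
    by (simp add: dfun_mult_in_charts[OF c(1) d(1) Q(1,2) Q4 S a b s c(2) d(2) Q(3)]
        dfun_mult_left_in_charts[OF c(1) d(1) Q(1,2) Q4 c(2) d(2) Q(3)] dfun_mult_right_in_charts[OF c(1) d(1) Q(1,2) Q4 c(2) d(2) Q(3)])
qed

text \<open>Base points and vectors move together along \<open>S\<close>. With one of the two
  vectors zero this yields smoothness of left- and right-invariant fields and of the
  trivialization.\<close>

lemma vsmooth_on_dfun_mult:
  fixes f :: "'a \<Rightarrow> 'c::euclidean_space"
  assumes f: "vsmooth_on M U f" and S: "smooth_atlas S" and a: "smooth_map S M a" and b: "smooth_map S M b"
    and V: "section_on S W M a V" "section_on S W M b V'"
  shows "vsmooth_on S {s \<in> W. a s \<otimes> b s \<in> U}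
    (\<lambda>s. dfun M (\<lambda>x. f (x \<otimes> b s)) (a s) (V s) + dfun M (\<lambda>y. f (a s \<otimes> y)) (b s) (V' s))"
proof (rule vsmooth_on_local[OF S])
  fix s assume s: "s \<in> {s \<in> W. a s \<otimes> b s \<in> U}"
  have W: "openin (mtop S) W" using V by (simp add: section_on_def)
  have sS: "s \<in> points S" using openin_mtop_subset[OF S W] s by auto
  let ?c = "chart_at M (a s)" and ?d = "chart_at M (b s)"
  have c: "?c \<in> M" "a s \<in> fst ?c" and d: "?d \<in> M" "b s \<in> fst ?d"
    using chart_at[OF smooth_map_points[OF a sS]] chart_at[OF smooth_map_points[OF b sS]] by auto
  have ab: "a s \<otimes> b s \<in> U" using s by simp
  obtain Q \<Phi> where Q: "open Q" "smooth_on Q \<Phi>" "(snd ?c (a s), snd ?d (b s)) \<in> Q"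
    "\<And>x y. x \<in> fst ?c \<Longrightarrow> y \<in> fst ?d \<Longrightarrow> (snd ?c x, snd ?d y) \<in> Q \<Longrightarrow> x \<otimes> y \<in> U \<and> \<Phi> (snd ?c x, snd ?d y) = f (x \<otimes> y)"
    using mult_fun_in_charts[OF f ab c d] by blast
  note Q4 = conjunct2[OF Q(4)]
  have Va: "vsmooth_on S {s \<in> W. a s \<in> fst ?c} (\<lambda>s. dfun M (snd ?c) (a s) (V s))" using V(1) c(1) by (simp add: section_on_def)
  have Vb: "vsmooth_on S {s \<in> W. b s \<in> fst ?d} (\<lambda>s. dfun M (snd ?d) (b s) (V' s))" using V(2) d(1) by (simp add: section_on_def)
  let ?U = "{s \<in> W. a s \<in> fst ?c} \<inter> {s \<in> W. b s \<in> fst ?d}"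
  have U: "openin (mtop S) ?U" by (rule openin_Int[OF vsmooth_onD[OF Va] vsmooth_onD[OF Vb]])
  have ab': "vsmooth_on S ?U (\<lambda>s. (snd ?c (a s), snd ?d (b s)))"
    by (rule vsmooth_on_Pair[OF S vsmooth_on_subset[OF smooth_map_snd[OF S atlas a c(1)] U] vsmooth_on_subset[OF smooth_map_snd[OF S atlas b d(1)] U]])
      (use openin_mtop_subset[OF S W] in auto)
  note V' = vsmooth_on_Pair[OF S vsmooth_on_subset[OF Va U inf_le1] vsmooth_on_subset[OF Vb U inf_le2]]
  let ?R = "{s \<in> ?U. (snd ?c (a s), snd ?d (b s)) \<in> Q}"
  have R: "openin (mtop S) ?R" by (rule openin_vsmooth_preimage[OF S ab' Q(1)])
  have RU: "?R \<subseteq> ?U" by auto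
  have "vsmooth_on S ?R (\<lambda>s. frechet_derivative \<Phi> (at (snd ?c (a s), snd ?d (b s))) (dfun M (snd ?c) (a s) (V s), dfun M (snd ?d) (b s) (V' s)))"
    by (rule vsmooth_on_directional[OF S Q(2,1) vsmooth_on_subset[OF ab' R RU] _ vsmooth_on_subset[OF V' R RU]]) auto
  then have 3: "vsmooth_on S ?R (\<lambda>s. dfun M (\<lambda>x. f (x \<otimes> b s)) (a s) (V s) + dfun M (\<lambda>y. f (a s \<otimes> y)) (b s) (V' s))"
  proof (rule vsmooth_on_cong[OF S])
    fix s assume "s \<in> ?R"
    then have s: "a s \<in> fst ?c" "b s \<in> fst ?d" "(snd ?c (a s), snd ?d (b s)) \<in> Q" by auto
    have lin: "linear (frechet_derivative \<Phi> (at (snd ?c (a s), snd ?d (b s))))"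
      by (rule has_derivative_linear[OF smooth_on_has_derivative[OF Q(2) s(3)]])
    show "frechet_derivative \<Phi> (at (snd ?c (a s), snd ?d (b s))) (dfun M (snd ?c) (a s) (V s), dfun M (snd ?d) (b s) (V' s))
      = dfun M (\<lambda>x. f (x \<otimes> b s)) (a s) (V s) + dfun M (\<lambda>y. f (a s \<otimes> y)) (b s) (V' s)"
      using linear_add[OF lin, of "(dfun M (snd ?c) (a s) (V s), 0)" "(0, dfun M (snd ?d) (b s) (V' s))"]
      by (simp add: dfun_mult_left_in_charts[OF c(1) d(1) Q(1,2) Q4 s] dfun_mult_right_in_charts[OF c(1) d(1) Q(1,2) Q4 s])
  qed
  have 1: "s \<in> ?R" using s c d Q(3) by auto
  have 2: "?R \<subseteq> {s \<in> W. a s \<otimes> b s \<in> U}" using Q(4) by blast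
  show "\<exists>R. s \<in> R \<and> R \<subseteq> {s \<in> W. a s \<otimes> b s \<in> U} \<and> vsmooth_on S R (\<lambda>s. dfun M (\<lambda>x. f (x \<otimes> b s)) (a s) (V s) + dfun M (\<lambda>y. f (a s \<otimes> y)) (b s) (V' s))"
    by (rule exI[of _ ?R], rule conjI[OF 1 conjI[OF 2 3]])
qed

text \<open>Both sides are mixed second derivatives of one function \<open>\<Phi>\<close> on pairs
  of coordinates, in a direction \<open>(_, 0)\<close> and a direction
  \<open>(0, _)\<close>.\<close>

lemma dfun_mult_commute:
  fixes f :: "'a \<Rightarrow> 'c::euclidean_space"
  assumes f: "vsmooth_on M U f" and xy: "x \<in> carrier G" "y \<in> carrier G" "x \<otimes> y \<in> U"
  shows "dfun M (\<lambda>z. dfun M (\<lambda>u. f (u \<otimes> z)) x v) y w = dfun M (\<lambda>u. dfun M (\<lambda>z. f (u \<otimes> z)) y w) x v"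
proof -
  let ?c = "chart_at M x" and ?d = "chart_at M y"
  have c: "?c \<in> M" "x \<in> fst ?c" and d: "?d \<in> M" "y \<in> fst ?d"
    using chart_at[of _ M] xy by (simp_all add: points)
  obtain Q \<Phi> where Q: "open Q" "smooth_on Q \<Phi>" "(snd ?c x, snd ?d y) \<in> Q"
    "\<And>x y. x \<in> fst ?c \<Longrightarrow> y \<in> fst ?d \<Longrightarrow> (snd ?c x, snd ?d y) \<in> Q \<Longrightarrow> x \<otimes> y \<in> U \<and> \<Phi> (snd ?c x, snd ?d y) = f (x \<otimes> y)"
    using mult_fun_in_charts[OF f xy(3) c d] by blast
  note Q4 = conjunct2[OF Q(4)]
  let ?v = "(dfun M (snd ?c) x v, 0)" and ?w = "(0, dfun M (snd ?d) y w)"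
  have o: "openin (mtop M) (fst ?c)" "openin (mtop M) (fst ?d)" using openin_chart[OF atlas] c d by auto
  have gd: "vsmooth_on M (fst ?d) (\<lambda>z. (snd ?c x, snd ?d z))"
    by (rule vsmooth_on_Pair[OF atlas vsmooth_on_const[OF atlas o(2)] vsmooth_on_snd[OF atlas d(1)]])
  have gc: "vsmooth_on M (fst ?c) (\<lambda>u. (snd ?c u, snd ?d y))"
    by (rule vsmooth_on_Pair[OF atlas vsmooth_on_snd[OF atlas c(1)] vsmooth_on_const[OF atlas o(1)]])
  have od: "openin (mtop M) {z \<in> fst ?d. (snd ?c x, snd ?d z) \<in> Q}" by (rule openin_vsmooth_preimage[OF atlas gd Q(1)])
  have oc: "openin (mtop M) {u \<in> fst ?c. (snd ?c u, snd ?d y) \<in> Q}" by (rule openin_vsmooth_preimage[OF atlas gc Q(1)])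
  have yd: "y \<in> {z \<in> fst ?d. (snd ?c x, snd ?d z) \<in> Q}" and xc: "x \<in> {u \<in> fst ?c. (snd ?c u, snd ?d y) \<in> Q}"
    using c d Q(3) by auto
  have "dfun M (\<lambda>z. dfun M (\<lambda>u. f (u \<otimes> z)) x v) y w = dfun M (\<lambda>z. frechet_derivative \<Phi> (at (snd ?c x, snd ?d z)) ?v) y w"
    by (subst dfun_cong[OF atlas od yd]) (use dfun_mult_left_in_charts[OF c(1) d(1) Q(1,2) Q4 c(2)] in auto)
  also have "\<dots> = frechet_derivative (\<lambda>z. frechet_derivative \<Phi> (at z) ?v) (at (snd ?c x, snd ?d y)) (dfun M (\<lambda>z. (snd ?c x, snd ?d z)) y w)"
    by (rule dfun_compose[OF atlas gd d(2) smooth_on_derivative[OF Q(2)] Q(3)])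
  also have "dfun M (\<lambda>z. (snd ?c x, snd ?d z)) y w = ?w"
    by (simp add: dfun_Pair[OF atlas vsmooth_on_const[OF atlas o(2)] vsmooth_on_snd[OF atlas d(1)] d(2)] dfun_const[OF atlas])
  also have "frechet_derivative (\<lambda>z. frechet_derivative \<Phi> (at z) ?v) (at (snd ?c x, snd ?d y)) ?w
      = frechet_derivative (\<lambda>z. frechet_derivative \<Phi> (at z) ?w) (at (snd ?c x, snd ?d y)) ?v"
    by (rule symmetric_second_derivative[OF Q(2,1,3)])
  also have "?v = dfun M (\<lambda>u. (snd ?c u, snd ?d y)) x v"
    by (simp add: dfun_Pair[OF atlas vsmooth_on_snd[OF atlas c(1)] vsmooth_on_const[OF atlas o(1)] c(2)] dfun_const[OF atlas])
  also have "frechet_derivative (\<lambda>z. frechet_derivative \<Phi> (at z) ?w) (at (snd ?c x, snd ?d y)) (dfun M (\<lambda>u. (snd ?c u, snd ?d y)) x v)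
      = dfun M (\<lambda>u. frechet_derivative \<Phi> (at (snd ?c u, snd ?d y)) ?w) x v"
    by (rule dfun_compose[OF atlas gc c(2) smooth_on_derivative[OF Q(2)] Q(3), symmetric])
  also have "\<dots> = dfun M (\<lambda>u. dfun M (\<lambda>z. f (u \<otimes> z)) y w) x v"
    by (subst dfun_cong[OF atlas oc xc]) (use dfun_mult_right_in_charts[OF c(1) d(1) Q(1,2) Q4 _ d(2)] in auto)
  finally show ?thesis .
qed

end

text \<open>A smooth function with vanishing differential is locally constant, so its level sets are
  both open and closed.\<close>

lemma dfun_zero_imp_constant:
  fixes f :: "'a \<Rightarrow> 'b::euclidean_space"
  assumes M: "smooth_atlas M" and f: "vsmooth_on M (points M) f"
    and df: "\<And>p v. p \<in> points M \<Longrightarrow> dfun M f p v = 0"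
    and q: "q \<in> connected_component_of_set (mtop M) p"
  shows "f q = f p"
proof -
  have op: "openin (mtop M) {q \<in> points M. f q \<in> A}" for A
  proof (rule openin_subopen[THEN iffD2], rule ballI)
    fix p assume p: "p \<in> {q \<in> points M. f q \<in> A}"
    let ?c = "chart_at M p"
    have c: "?c \<in> M" "p \<in> fst ?c" using chart_at[of p M] p by auto
    have o: "open (snd ?c ` fst ?c)" using M c by (auto simp: smooth_atlas_def)
    then obtain e where e: "e > 0" "ball (snd ?c p) e \<subseteq> snd ?c ` fst ?c"
      using c(2) open_contains_ball by blast
    let ?U = "{q \<in> fst ?c. snd ?c q \<in> ball (snd ?c p) e}"
    have U: "openin (mtop M) ?U" by (rule openin_vsmooth_preimage[OF M vsmooth_on_snd[OF M c(1)] open_ball])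
    have fs: "smooth_on (snd ?c ` (fst ?c \<inter> points M)) (f \<circ> chart_inv ?c)" by (rule vsmooth_onD_chart[OF f c(1)])
    have cp: "fst ?c \<inter> points M = fst ?c" using chart_subset_points[OF c(1)] by auto
    have zero: "((f \<circ> chart_inv ?c) has_derivative (\<lambda>v. 0)) (at x within ball (snd ?c p) e)" if x: "x \<in> ball (snd ?c p) e" for x
    proof -
      obtain r where r: "r \<in> fst ?c" "x = snd ?c r" using e(2) x by auto
      have rp: "r \<in> points M" using r chart_subset_points[OF c(1)] by auto
      have "frechet_derivative (f \<circ> chart_inv ?c) (at x) w = 0" for w
      proof -
        have "0 = dfun M f r (coord_field M ?c w r)" by (simp add: df[OF rp])
        also have "\<dots> = frechet_derivative (f \<circ> chart_inv ?c) (at x) w"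
          by (simp add: dfun_in_chart[OF M f rp c(1) r(1)] coord_field_component(2)[OF M c(1) r(1)] r(2))
        finally show ?thesis by simp
      qed
      then have "frechet_derivative (f \<circ> chart_inv ?c) (at x) = (\<lambda>v. 0)" by auto
      moreover have "((f \<circ> chart_inv ?c) has_derivative frechet_derivative (f \<circ> chart_inv ?c) (at x)) (at x)"
        by (rule smooth_on_has_derivative[OF fs[unfolded cp]]) (use r in auto)
      ultimately show ?thesis by (auto intro: has_derivative_at_withinI)
    qed
    obtain k where k: "\<And>x. x \<in> ball (snd ?c p) e \<Longrightarrow> (f \<circ> chart_inv ?c) x = k"
      using has_derivative_zero_constant[OF convex_ball zero] by blast
    have fk: "f q = k" if "q \<in> ?U" for q
      using k[of "snd ?c q"] that chart_inv_snd[OF M c(1)] by simp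
    have pU: "p \<in> ?U" using c e by simp
    have "?U \<subseteq> {q \<in> points M. f q \<in> A}"
    proof
      fix q assume q: "q \<in> ?U"
      then have "f q = f p" using fk[OF q] fk[OF pU] by simp
      then show "q \<in> {q \<in> points M. f q \<in> A}" using p q chart_subset_points[OF c(1)] by auto
    qed
    then show "\<exists>T. openin (mtop M) T \<and> p \<in> T \<and> T \<subseteq> {q \<in> points M. f q \<in> A}" using U pU by (intro exI[of _ ?U]) simp
  qed
  obtain C where C: "connectedin (mtop M) C" "p \<in> C" "q \<in> C"
    using q by (auto simp: connected_component_of_def)
  have "C \<subseteq> topspace (mtop M)" by (rule connectedin_subset_topspace[OF C(1)])
  also have "topspace (mtop M) \<subseteq> points M" using openin_mtop_subset[OF M openin_topspace] .
  finally have CM: "C \<subseteq> points M" .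
  show ?thesis
  proof (rule ccontr)
    assume ne: "f q \<noteq> f p"
    let ?A = "{r \<in> points M. f r \<in> {f p}}" and ?B = "{r \<in> points M. f r \<in> - {f p}}"
    have "C \<subseteq> ?A \<union> ?B" "?A \<inter> ?B \<inter> C = {}" using CM by auto
    moreover have "p \<in> ?A \<inter> C" "q \<in> ?B \<inter> C" using CM C ne by auto
    ultimately show False
      using C(1) op[of "{f p}"] op[of "- {f p}"] unfolding connectedin by blast
  qed
qed

section \<open>Left-invariant fields and the trivialization by left translations\<close>

context lie_group
begin

abbreviation E where "E \<equiv> linv_field G M"
abbreviation b where "b \<equiv> br G M"

text \<open>The left Maurer-Cartan form.\<close>

definition \<theta> :: "'a \<Rightarrow> 'e \<Rightarrow> 'e" where
  "\<theta> p v = tmap M M (ltrans G (inv p)) p v"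

lemma one_point: "\<one> \<in> points M" by (simp add: points)

lemma ltrans_smooth: "g \<in> carrier G \<Longrightarrow> smooth_map M M (ltrans G g)"
  unfolding ltrans_def[abs_def]
  by (rule smooth_map_mult[OF atlas smooth_map_const[OF atlas atlas] smooth_map_id[OF atlas]]) (simp add: points)

lemma rtrans_smooth: "g \<in> carrier G \<Longrightarrow> smooth_map M M (\<lambda>x. x \<otimes> g)"
  by (rule smooth_map_mult[OF atlas smooth_map_id[OF atlas] smooth_map_const[OF atlas atlas]]) (simp add: points)

lemma tmap_compose':
  assumes "smooth_map M M \<phi>" "smooth_map M M \<psi>" "p \<in> carrier G" "\<And>q. q \<in> carrier G \<Longrightarrow> \<psi> (\<phi> q) = \<eta> q"
  shows "tmap M M \<psi> (\<phi> p) (tmap M M \<phi> p v) = tmap M M \<eta> p v"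
proof -
  have p: "p \<in> points M" using assms(3) by (simp add: points)
  have "tmap M M \<eta> p v = tmap M M (\<lambda>q. \<psi> (\<phi> q)) p v"
    by (rule tmap_cong[OF atlas atlas openin_points[OF atlas] p]) (use assms(4) in \<open>simp add: points\<close>)
  then show ?thesis by (simp add: tmap_compose[OF atlas atlas atlas assms(1,2) p])
qed

lemma tmap_ident: "p \<in> carrier G \<Longrightarrow> (\<And>q. q \<in> carrier G \<Longrightarrow> \<phi> q = q) \<Longrightarrow> tmap M M \<phi> p v = v"
  using tmap_cong[OF atlas atlas openin_points[OF atlas], of p \<phi> "\<lambda>q. q" v] tmap_id[OF atlas] by (simp add: points)

lemma E_one: "E r \<one> = r"
  unfolding linv_field_def by (rule tmap_ident) (simp_all add: ltrans_def)

lemma tmap_ltrans_E: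
  assumes "g \<in> carrier G" "p \<in> carrier G"
  shows "tmap M M (ltrans G g) p (E r p) = E r (g \<otimes> p)"
proof -
  have "tmap M M (ltrans G g) (ltrans G p \<one>) (tmap M M (ltrans G p) \<one> r) = tmap M M (ltrans G (g \<otimes> p)) \<one> r"
    by (rule tmap_compose'[OF ltrans_smooth ltrans_smooth]) (use assms in \<open>simp_all add: ltrans_def m_assoc\<close>)
  then show ?thesis using assms by (simp add: linv_field_def ltrans_def[of _ p \<one>])
qed

lemma theta_E: "p \<in> carrier G \<Longrightarrow> \<theta> p (E r p) = r"
  using tmap_ltrans_E[of "inv p" p r] by (simp add: \<theta>_def E_one)

lemma E_theta:
  assumes "p \<in> carrier G"
  shows "E (\<theta> p v) p = v"
proof -
  have "tmap M M (ltrans G p) (ltrans G (inv p) p) (tmap M M (ltrans G (inv p)) p v) = v"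
    using tmap_compose'[OF ltrans_smooth[of "inv p"] ltrans_smooth[of p], of p "\<lambda>q. q" v] assms
    by (simp add: tmap_ident ltrans_def flip: m_assoc)
  then show ?thesis using assms by (simp add: linv_field_def \<theta>_def ltrans_def[of _ "inv p" p])
qed

text \<open>\<open>E r q\<close> is the derivative of the multiplication at the pair
  \<open>(q, \<one>)\<close> on the vectors 0 and \<open>r\<close>.\<close>

lemma E_smooth: "vector_field_on M (points M) (E r)"
proof (rule vector_field_onI[OF atlas openin_points[OF atlas]])
  fix p assume p: "p \<in> points M"
  let ?d = "chart_at M p"
  have d: "?d \<in> M" "p \<in> fst ?d" using chart_at[OF p] by auto
  have U: "{q \<in> points M. q \<otimes> \<one> \<in> fst ?d} = fst ?d" using chart_subset_points[OF d(1)] by (auto simp: points)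
  note z = section_on_zero[OF atlas atlas smooth_map_id[OF atlas] openin_points[OF atlas]]
  have "vsmooth_on M {q \<in> points M. q \<otimes> \<one> \<in> fst ?d}
     (\<lambda>q. dfun M (\<lambda>x. snd ?d (x \<otimes> \<one>)) q 0 + dfun M (\<lambda>y. snd ?d (q \<otimes> y)) \<one> r)"
    by (rule vsmooth_on_dfun_mult[OF vsmooth_on_snd[OF atlas d(1)] atlas smooth_map_id[OF atlas] smooth_map_const[OF atlas atlas one_point] z
          section_on_const[OF atlas atlas one_point]])
  then have "vsmooth_on M (fst ?d) (\<lambda>q. dfun M (snd ?d) q (E r q))"
    unfolding U
  proof (rule vsmooth_on_cong[OF atlas])
    fix q assume q: "q \<in> fst ?d"
    then have qG: "q \<in> carrier G" using chart_subset_points[OF d(1)] by (auto simp: points)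
    have "dfun M (\<lambda>x. snd ?d (x \<otimes> \<one>)) q 0 = dfun M (snd ?d) q 0"
      using dfun_cong[OF atlas openin_chart[OF atlas d(1)] q, of "\<lambda>x. snd ?d (x \<otimes> \<one>)" "snd ?d"]
        chart_subset_points[OF d(1)] by (metis points r_one subsetD)
    also have "\<dots> = 0" by (rule linear_0[OF dfun_linear[OF atlas vsmooth_on_snd[OF atlas d(1)] q]])
    finally show "dfun M (\<lambda>x. snd ?d (x \<otimes> \<one>)) q 0 + dfun M (\<lambda>y. snd ?d (q \<otimes> y)) \<one> r = dfun M (snd ?d) q (E r q)"
      using dfun_tmap[OF atlas atlas ltrans_smooth[OF qG] one_point vsmooth_on_snd[OF atlas d(1)], of r] q qG
      by (simp add: linv_field_def ltrans_def)
  qed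
  then show "\<exists>d\<in>M. \<exists>U. p \<in> U \<and> U \<subseteq> points M \<and> U \<subseteq> fst d \<and> vsmooth_on M U (\<lambda>p. dfun M (snd d) p (E r p))"
    by (intro bexI[OF _ d(1)] exI[of _ "fst ?d"]) (use d chart_subset_points[OF d(1)] in auto)
qed

text \<open>\<open>\<theta> q (X q)\<close> is the derivative of the multiplication at the pair
  \<open>(inv q, q)\<close> on the vectors 0 and \<open>X q\<close>. The product is constantly the
  identity, so one chart there suffices on all of \<open>W\<close>.\<close>

lemma theta_smooth:
  assumes X: "vector_field_on M W X"
  shows "vsmooth_on M W (\<lambda>p. \<theta> p (X p))"
proof -
  let ?d = "chart_at M \<one>"
  have W: "openin (mtop M) W" by (rule vector_field_onD[OF atlas X])
  have WG: "p \<in> carrier G" if "p \<in> W" for p using openin_mtop_subset[OF atlas W] that by (auto simp: points)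
  have d: "?d \<in> M" "\<one> \<in> fst ?d" using chart_at[OF one_point] by auto
  have U: "{q \<in> W. inv q \<otimes> q \<in> fst ?d} = W" using WG d by auto
  note z = section_on_zero[OF atlas atlas inv_smooth W]
  have "vsmooth_on M {q \<in> W. inv q \<otimes> q \<in> fst ?d}
     (\<lambda>q. dfun M (\<lambda>x. snd ?d (x \<otimes> q)) (inv q) 0 + dfun M (\<lambda>y. snd ?d (inv q \<otimes> y)) q (X q))"
    by (rule vsmooth_on_dfun_mult[OF vsmooth_on_snd[OF atlas d(1)] atlas inv_smooth smooth_map_id[OF atlas] z
          X[unfolded vector_field_on_eq_section[OF atlas]]])
  then show ?thesis
    unfolding U
  proof (rule vsmooth_on_cong[OF atlas])
    fix q assume q: "q \<in> W"
    note qG = WG[OF q]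
    have "dfun M (\<lambda>x. snd ?d (x \<otimes> q)) (inv q) 0 = dfun M (snd ?d) (inv q \<otimes> q) (tmap M M (\<lambda>x. x \<otimes> q) (inv q) 0)"
      using dfun_tmap[OF atlas atlas rtrans_smooth[OF qG] _ vsmooth_on_snd[OF atlas d(1)], of "inv q" 0] qG d by (simp add: points)
    also have "tmap M M (\<lambda>x. x \<otimes> q) (inv q) 0 = 0"
      by (rule linear_0[OF tmap_linear[OF atlas atlas rtrans_smooth[OF qG]]]) (use qG in \<open>simp add: points\<close>)
    also have "dfun M (snd ?d) (inv q \<otimes> q) 0 = 0"
      using linear_0[OF dfun_linear[OF atlas vsmooth_on_snd[OF atlas d(1)] d(2)]] qG by simp
    finally have 1: "dfun M (\<lambda>x. snd ?d (x \<otimes> q)) (inv q) 0 = 0" .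
    have "dfun M (\<lambda>y. snd ?d (inv q \<otimes> y)) q (X q) = dfun M (snd ?d) \<one> (\<theta> q (X q))"
      using dfun_tmap[OF atlas atlas ltrans_smooth[of "inv q"] _ vsmooth_on_snd[OF atlas d(1)], of q "X q"] qG d
      by (simp add: points \<theta>_def ltrans_def[abs_def])
    also have "\<dots> = \<theta> q (X q)" by (rule dfun_chart_at[OF atlas one_point])
    finally show "dfun M (\<lambda>x. snd ?d (x \<otimes> q)) (inv q) 0 + dfun M (\<lambda>y. snd ?d (inv q \<otimes> y)) q (X q) = \<theta> q (X q)"
      using 1 by simp
  qed
qed

sublocale P: parallelism M E \<theta> b
proof (rule parallelism.intro)
  show "smooth_atlas M" by (rule atlas)
  show "\<theta> p (E r p) = r" if "p \<in> points M" for p r using theta_E that by (simp add: points)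
  show "E (\<theta> p v) p = v" if "p \<in> points M" for p v using E_theta that by (simp add: points)
  show "linear (\<theta> p)" if "p \<in> points M" for p
  proof -
    have "\<theta> p = tmap M M (ltrans G (inv p)) p" by (auto simp: \<theta>_def)
    then show ?thesis using tmap_linear[OF atlas atlas ltrans_smooth[of "inv p"] that] that by (simp add: points)
  qed
  show "vector_field_on M (points M) (E r)" for r by (rule E_smooth)
  show "vsmooth_on M W (\<lambda>p. \<theta> p (X p))" if "vector_field_on M W X" for W X by (rule theta_smooth[OF that])
  fix p r s assume p: "p \<in> points M"
  then have pG: "p \<in> carrier G" by (simp add: points)
  have "tmap M M (ltrans G p) \<one> (lie_bracket M (E r) (E s) \<one>) = lie_bracket M (E r) (E s) (ltrans G p \<one>)"
    by (rule tmap_lie_bracket[OF atlas atlas ltrans_smooth[OF pG] E_smooth E_smooth E_smooth E_smooth])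
      (use pG tmap_ltrans_E[OF pG] in \<open>auto simp: points ltrans_def\<close>)
  then have "E (b r s) p = lie_bracket M (E r) (E s) p" using pG by (simp add: br_def linv_field_def ltrans_def[of _ p \<one>])
  then show "\<theta> p (lie_bracket M (E r) (E s) p) = b r s" using theta_E[OF pG] by metis
qed

lemma theta_ltrans:
  assumes "g \<in> carrier G" "p \<in> carrier G"
  shows "\<theta> (g \<otimes> p) (tmap M M (ltrans G g) p v) = \<theta> p v"
  using tmap_ltrans_E[OF assms, of "\<theta> p v"] theta_E[of "g \<otimes> p"] assms by (simp add: E_theta)

section \<open>The adjoint representation\<close>

lemma conj_smooth: "g \<in> carrier G \<Longrightarrow> smooth_map M M (conj_by G g)"
  unfolding conj_by_def[abs_def]
  by (rule smooth_map_mult[OF atlas smooth_map_mult[OF atlas smooth_map_const[OF atlas atlas] smooth_map_id[OF atlas]]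
        smooth_map_const[OF atlas atlas]]) (simp_all add: points)

lemma conj_mult:
  assumes "g \<in> carrier G" "x \<in> carrier G" "y \<in> carrier G"
  shows "conj_by G g (x \<otimes> y) = conj_by G g x \<otimes> conj_by G g y"
proof -
  have "inv g \<otimes> (g \<otimes> (y \<otimes> inv g)) = y \<otimes> inv g" using assms by (simp flip: m_assoc)
  then show ?thesis using assms by (simp add: conj_by_def m_assoc)
qed

lemma conj_one: "g \<in> carrier G \<Longrightarrow> conj_by G g \<one> = \<one>" by (simp add: conj_by_def)

lemma conj_conj: "g \<in> carrier G \<Longrightarrow> h \<in> carrier G \<Longrightarrow> x \<in> carrier G \<Longrightarrow> conj_by G g (conj_by G h x) = conj_by G (g \<otimes> h) x"
  by (simp add: conj_by_def inv_mult_group m_assoc)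

lemma Ad_linear: "g \<in> carrier G \<Longrightarrow> linear (Ad G M g)"
  unfolding Ad_def by (rule tmap_linear[OF atlas atlas conj_smooth one_point])

lemma Ad_Ad: "g \<in> carrier G \<Longrightarrow> h \<in> carrier G \<Longrightarrow> Ad G M g (Ad G M h r) = Ad G M (g \<otimes> h) r"
  using tmap_compose'[OF conj_smooth[of h] conj_smooth[of g], of \<one> "conj_by G (g \<otimes> h)" r]
  by (simp add: Ad_def conj_conj conj_one)

lemma Ad_one: "Ad G M \<one> r = r"
  unfolding Ad_def by (rule tmap_ident) (simp_all add: conj_by_def)

lemma Ad_inv: "g \<in> carrier G \<Longrightarrow> Ad G M (inv g) (Ad G M g r) = r" "g \<in> carrier G \<Longrightarrow> Ad G M g (Ad G M (inv g) r) = r"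
  by (simp_all add: Ad_Ad Ad_one)

lemma tmap_conj_E:
  assumes g: "g \<in> carrier G" and p: "p \<in> carrier G"
  shows "tmap M M (conj_by G g) p (E r p) = E (Ad G M g r) (conj_by G g p)"
proof -
  have gp: "conj_by G g p \<in> carrier G" using g p by (simp add: conj_by_def)
  have "tmap M M (conj_by G g) (ltrans G p \<one>) (tmap M M (ltrans G p) \<one> r)
      = tmap M M (\<lambda>x. conj_by G g (ltrans G p x)) \<one> r"
    by (rule tmap_compose'[OF ltrans_smooth[OF p] conj_smooth[OF g] one_closed]) simp
  also have "\<dots> = tmap M M (ltrans G (conj_by G g p)) (conj_by G g \<one>) (tmap M M (conj_by G g) \<one> r)"
    by (rule tmap_compose'[OF conj_smooth[OF g] ltrans_smooth[OF gp] one_closed, symmetric])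
      (simp add: ltrans_def conj_mult[OF g p])
  finally show ?thesis using p by (simp add: linv_field_def Ad_def conj_one[OF g] ltrans_def[of _ p \<one>])
qed

lemma theta_conj:
  assumes g: "g \<in> carrier G" and p: "p \<in> carrier G"
  shows "\<theta> (conj_by G g p) (tmap M M (conj_by G g) p v) = Ad G M g (\<theta> p v)"
  using tmap_conj_E[OF g p, of "\<theta> p v"] theta_E[of "conj_by G g p"] g p by (simp add: E_theta conj_by_def)

lemma Ad_br:
  assumes g: "g \<in> carrier G"
  shows "Ad G M g (b r s) = b (Ad G M g r) (Ad G M g s)"
proof -
  have "tmap M M (conj_by G g) \<one> (lie_bracket M (E r) (E s) \<one>)
      = lie_bracket M (E (Ad G M g r)) (E (Ad G M g s)) (conj_by G g \<one>)"
    by (rule tmap_lie_bracket[OF atlas atlas conj_smooth[OF g] E_smooth E_smooth E_smooth E_smooth _ tmap_conj_E[OF g] tmap_conj_E[OF g]])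
      (use g in \<open>auto simp: points conj_by_def\<close>)
  then show ?thesis by (simp add: br_def Ad_def conj_one[OF g])
qed

section \<open>Right-invariant fields and the bracket of the Lie algebra\<close>

definition rinv_field :: "'e \<Rightarrow> 'a \<Rightarrow> 'e" where
  "rinv_field r p = tmap M M (\<lambda>x. x \<otimes> p) \<one> r"

text \<open>Right translation by \<open>p\<close> followed by left translation by
  \<open>inv (x \<otimes> p)\<close> is left translation by \<open>inv x\<close> followed by
  conjugation by \<open>inv p\<close>.\<close>

lemma theta_rtrans:
  assumes "p \<in> carrier G" "x \<in> carrier G"
  shows "\<theta> (x \<otimes> p) (tmap M M (\<lambda>x. x \<otimes> p) x v) = Ad G M (inv p) (\<theta> x v)"
proof -
  have "tmap M M (ltrans G (inv (x \<otimes> p))) (x \<otimes> p) (tmap M M (\<lambda>x. x \<otimes> p) x v)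
     = tmap M M (\<lambda>y. conj_by G (inv p) (ltrans G (inv x) y)) x v"
    by (rule tmap_compose'[OF rtrans_smooth[OF assms(1)] ltrans_smooth assms(2)])
      (use assms in \<open>simp_all add: ltrans_def conj_by_def inv_mult_group m_assoc\<close>)
  also have "\<dots> = tmap M M (conj_by G (inv p)) (ltrans G (inv x) x) (tmap M M (ltrans G (inv x)) x v)"
    by (rule tmap_compose'[OF ltrans_smooth conj_smooth assms(2), symmetric]) (use assms in simp_all)
  finally show ?thesis using assms by (simp add: \<theta>_def Ad_def ltrans_def[of _ "inv x" x])
qed

text \<open>The bridge from fields to \<open>Ad\<close>: smoothness and the differential of
  \<open>Ad\<close> are read off from the frame coefficients of right-invariant fields.\<close>

lemma theta_rinv: "p \<in> carrier G \<Longrightarrow> \<theta> p (rinv_field r p) = Ad G M (inv p) r"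
  using theta_rtrans[of p \<one> r] tmap_ident[of \<one> "ltrans G \<one>" r] by (simp add: rinv_field_def \<theta>_def[of \<one>] ltrans_def)

lemma dfun_rinv:
  assumes f: "vsmooth_on M U f" and p: "p \<in> U"
  shows "dfun M f p (rinv_field r p) = dfun M (\<lambda>x. f (x \<otimes> p)) \<one> r"
proof -
  have "p \<in> carrier G" using openin_mtop_subset[OF atlas vsmooth_onD[OF f]] p by (auto simp: points)
  then show ?thesis
    using dfun_tmap[OF atlas atlas rtrans_smooth one_point f, of p r] p by (simp add: rinv_field_def)
qed

lemma rinv_smooth: "vector_field_on M (points M) (rinv_field r)"
proof (rule vector_field_onI[OF atlas openin_points[OF atlas]])
  fix p assume p: "p \<in> points M"
  let ?d = "chart_at M p"
  have d: "?d \<in> M" "p \<in> fst ?d" using chart_at[OF p] by auto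
  have U: "{q \<in> points M. \<one> \<otimes> q \<in> fst ?d} = fst ?d" using chart_subset_points[OF d(1)] by (auto simp: points)
  note z = section_on_zero[OF atlas atlas smooth_map_id[OF atlas] openin_points[OF atlas]]
  have "vsmooth_on M {q \<in> points M. \<one> \<otimes> q \<in> fst ?d}
     (\<lambda>q. dfun M (\<lambda>x. snd ?d (x \<otimes> q)) \<one> r + dfun M (\<lambda>y. snd ?d (\<one> \<otimes> y)) q 0)"
    by (rule vsmooth_on_dfun_mult[OF vsmooth_on_snd[OF atlas d(1)] atlas smooth_map_const[OF atlas atlas one_point] smooth_map_id[OF atlas]
          section_on_const[OF atlas atlas one_point] z])
  then have "vsmooth_on M (fst ?d) (\<lambda>q. dfun M (snd ?d) q (rinv_field r q))"
    unfolding U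
  proof (rule vsmooth_on_cong[OF atlas])
    fix q assume q: "q \<in> fst ?d"
    have "dfun M (\<lambda>y. snd ?d (\<one> \<otimes> y)) q 0 = dfun M (snd ?d) q 0"
      using dfun_cong[OF atlas openin_chart[OF atlas d(1)] q, of "\<lambda>x. snd ?d (\<one> \<otimes> x)" "snd ?d"]
        chart_subset_points[OF d(1)] by (metis points l_one subsetD)
    also have "\<dots> = 0" by (rule linear_0[OF dfun_linear[OF atlas vsmooth_on_snd[OF atlas d(1)] q]])
    finally show "dfun M (\<lambda>x. snd ?d (x \<otimes> q)) \<one> r + dfun M (\<lambda>y. snd ?d (\<one> \<otimes> y)) q 0 = dfun M (snd ?d) q (rinv_field r q)"
      by (simp add: dfun_rinv[OF vsmooth_on_snd[OF atlas d(1)] q])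
  qed
  then show "\<exists>d\<in>M. \<exists>U. p \<in> U \<and> U \<subseteq> points M \<and> U \<subseteq> fst d \<and> vsmooth_on M U (\<lambda>p. dfun M (snd d) p (rinv_field r p))"
    by (intro bexI[OF _ d(1)] exI[of _ "fst ?d"]) (use d chart_subset_points[OF d(1)] in auto)
qed

text \<open>Deriving a function \<open>f\<close> along the two fields in either order gives the
  mixed second derivatives of \<open>f (x \<otimes> z)\<close> at \<open>(\<one>, g)\<close>, and
  these agree.\<close>

lemma lie_bracket_linv_rinv:
  assumes g: "g \<in> carrier G"
  shows "lie_bracket M (E a) (rinv_field r) g = 0"
proof -
  let ?d = "chart_at M g"
  have d: "?d \<in> M" "g \<in> fst ?d" using chart_at[of g M] g by (auto simp: points)
  let ?f = "snd ?d" and ?U = "fst ?d"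
  have U: "openin (mtop M) ?U" by (rule openin_chart[OF atlas d(1)])
  have UG: "z \<in> carrier G" if "z \<in> ?U" for z using chart_subset_points[OF d(1)] that by (auto simp: points)
  note f = vsmooth_on_snd[OF atlas d(1)]
  note R = vector_field_on_subset[OF atlas rinv_smooth U chart_subset_points[OF d(1)]]
  note Ea = P.E_field_on[OF U]
  have "dfun M (\<lambda>z. dfun M ?f z (rinv_field r z)) g (E a g) = dfun M (\<lambda>z. dfun M (\<lambda>x. ?f (x \<otimes> z)) \<one> r) g (E a g)"
    by (subst dfun_cong[OF atlas U d(2)]) (auto simp: dfun_rinv[OF f])
  also have "\<dots> = dfun M (\<lambda>x. dfun M (\<lambda>z. ?f (x \<otimes> z)) g (E a g)) \<one> r"
    by (rule dfun_mult_commute[OF f one_closed g]) (use g d in simp)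
  also have "\<dots> = dfun M (\<lambda>x. dfun M ?f (x \<otimes> g) (E a (x \<otimes> g))) \<one> r"
  proof -
    let ?V = "{x \<in> points M. x \<otimes> g \<in> ?U}"
    have V: "openin (mtop M) ?V" by (rule vsmooth_onD[OF smooth_map_vsmooth[OF atlas atlas rtrans_smooth[OF g] f]])
    have 1: "\<one> \<in> ?V" using g d by (simp add: points)
    have "dfun M (\<lambda>z. ?f (x \<otimes> z)) g (E a g) = dfun M ?f (x \<otimes> g) (E a (x \<otimes> g))" if x: "x \<in> ?V" for x
    proof -
      have xG: "x \<in> carrier G" using x by (simp add: points)
      show ?thesis
        using dfun_tmap[OF atlas atlas ltrans_smooth[OF xG] _ f, of g "E a g"] x g
        by (simp add: tmap_ltrans_E[OF xG g] points) (simp add: ltrans_def)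
    qed
    then show ?thesis by (subst dfun_cong[OF atlas V 1]) auto
  qed
  also have "\<dots> = dfun M (\<lambda>z. dfun M ?f z (E a z)) g (rinv_field r g)"
    by (rule dfun_rinv[OF vector_field_on_dfun[OF atlas Ea f] d(2), symmetric])
  finally have "dfun M ?f g (lie_bracket M (E a) (rinv_field r) g) = 0"
    by (simp add: dfun_lie_bracket[OF atlas Ea R f d(2)])
  also have "0 = dfun M ?f g 0" by (rule linear_0[OF dfun_linear[OF atlas f d(2)], symmetric])
  finally show ?thesis by (rule tangent_eqI[OF atlas d])
qed

lemma Ad_inv_smooth: "vsmooth_on M (points M) (\<lambda>p. Ad G M (inv p) r)"
  by (rule vsmooth_on_cong[OF atlas theta_smooth[OF rinv_smooth]]) (simp add: theta_rinv points)

text \<open>Since left- and right-invariant fields commute, the bracket formula in the frame computes the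
  differential of \<open>Ad\<close>.\<close>

lemma dfun_Ad_inv:
  assumes p: "p \<in> points M"
  shows "dfun M (\<lambda>p. Ad G M (inv p) r) p v = - b (\<theta> p v) (Ad G M (inv p) r)"
proof -
  have pG: "p \<in> carrier G" using p by (simp add: points)
  let ?a = "\<theta> p v"
  have d: "dfun M (\<lambda>q. \<theta> q (rinv_field r q)) p w = dfun M (\<lambda>p. Ad G M (inv p) r) p w" for w
    by (subst dfun_cong[OF atlas openin_points[OF atlas] p]) (simp_all add: theta_rinv points)
  have c: "dfun M (\<lambda>q. \<theta> q (E ?a q)) p w = 0" for w
  proof -
    have "dfun M (\<lambda>q. \<theta> q (E ?a q)) p w = dfun M (\<lambda>q. ?a) p w"
      by (subst dfun_cong[OF atlas openin_points[OF atlas] p]) (simp_all add: theta_E points)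
    then show ?thesis by (simp add: dfun_const[OF atlas])
  qed
  have "0 = \<theta> p (lie_bracket M (E ?a) (rinv_field r) p)"
    by (simp add: lie_bracket_linv_rinv[OF pG] linear_0[OF P.\<theta>_linear[OF p]])
  also have "\<dots> = dfun M (\<lambda>p. Ad G M (inv p) r) p (E ?a p) + b ?a (Ad G M (inv p) r)"
    unfolding P.\<theta>_lie_bracket[OF E_smooth rinv_smooth p] d c by (simp add: theta_E[OF pG] theta_rinv[OF pG])
  finally show ?thesis by (simp add: E_theta[OF pG] eq_neg_iff_add_eq_0)
qed

lemma br_antisym: "b r s = - b s r"
  unfolding br_def by (rule lie_bracket_antisym)

text \<open>Up to sign, \<open>b a r\<close> is the differential of
  \<open>p \<mapsto> Ad(inv p) r\<close> at the identity in the direction \<open>a\<close>, hence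
  linear in \<open>a\<close>; the other slot follows by antisymmetry.\<close>

lemma br_bilinear: "bilinear b"
proof -
  have l: "linear (\<lambda>a. b a r)" for r
  proof -
    have "(\<lambda>a. b a r) = (\<lambda>a. - dfun M (\<lambda>p. Ad G M (inv p) r) \<one> a)"
    proof
      fix a
      have "\<theta> \<one> a = a" using theta_E[of \<one> a] by (simp add: E_one)
      then show "b a r = - dfun M (\<lambda>p. Ad G M (inv p) r) \<one> a"
        by (simp add: dfun_Ad_inv[OF one_point] Ad_one)
    qed
    then show ?thesis
      using linear_compose_neg[OF dfun_linear[OF atlas Ad_inv_smooth one_point]] by simp
  qed
  have anti: "b r = (\<lambda>s. - b s r)" for r by (rule ext) (rule br_antisym)
  have "linear (b r)" for r
    by (rule ssubst[where P = linear, OF anti linear_compose_neg[OF l]])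
  then show ?thesis using l by (simp add: bilinear_def)
qed

lemma br_self: "b r r = 0"
  using br_antisym[of r r] by (simp add: eq_neg_iff_add_eq_0 flip: scaleR_2)

text \<open>Obtained by differentiating \<open>Ad(inv p) [r, s] = [Ad(inv p) r, Ad(inv p) s]\<close>
  at the identity in the direction \<open>a\<close>.\<close>

lemma br_jacobi: "b a (b r s) = b (b a r) s + b r (b a s)"
proof -
  have bb: "bounded_bilinear b" using br_bilinear by (simp add: bilinear_conv_bounded_bilinear)
  have th: "\<theta> \<one> a = a" using theta_E[of \<one> a] by (simp add: E_one)
  have "dfun M (\<lambda>p. Ad G M (inv p) (b r s)) \<one> a = dfun M (\<lambda>p. b (Ad G M (inv p) r) (Ad G M (inv p) s)) \<one> a"
    by (subst dfun_cong[OF atlas openin_points[OF atlas] one_point]) (simp_all add: Ad_br points)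
  also have "\<dots> = b r (dfun M (\<lambda>p. Ad G M (inv p) s) \<one> a) + b (dfun M (\<lambda>p. Ad G M (inv p) r) \<one> a) s"
    by (simp add: dfun_bilinear[OF atlas bb Ad_inv_smooth Ad_inv_smooth one_point] Ad_one)
  finally show ?thesis
    by (simp add: dfun_Ad_inv[OF one_point] th Ad_one bilinear_lneg[OF br_bilinear] bilinear_rneg[OF br_bilinear] algebra_simps)
qed

text \<open>Inner automorphisms are trivial, so \<open>Ad(inv p) s\<close> is constant in
  \<open>p\<close> and its differential, which is the bracket up to sign, vanishes.\<close>

lemma comm_group_br:
  assumes "comm_group G" shows "b r s = 0"
proof -
  interpret C: comm_group G by (rule assms)
  have th: "\<theta> \<one> r = r" using theta_E[of \<one> r] by (simp add: E_one)
  have "Ad G M (inv p) s = s" if "p \<in> carrier G" for p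
    unfolding Ad_def by (rule tmap_ident) (use that in \<open>simp_all add: conj_by_def C.m_comm[of "inv p"] m_assoc\<close>)
  then have "dfun M (\<lambda>p. Ad G M (inv p) s) \<one> r = dfun M (\<lambda>p. s) \<one> r"
    by (subst dfun_cong[OF atlas openin_points[OF atlas] one_point]) (simp_all add: points)
  then show ?thesis by (simp add: dfun_Ad_inv[OF one_point] th Ad_one dfun_const[OF atlas])
qed

text \<open>By invariance of \<open>k\<close> under brackets the function
  \<open>p \<mapsto> k (Ad(inv p) r) (Ad(inv p) s)\<close> has vanishing differential, hence is
  constant on the component of the identity. The argument does not reach other components.\<close>

lemma invariant_form_Ad:
  assumes k: "symmetric_form k" "invariant_form G M k" and g: "g \<in> connected_component_of_set (mtop M) \<one>"
  shows "k (Ad G M g r) (Ad G M g s) = k r s"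
proof -
  have kb: "bounded_bilinear k" and kb': "bilinear k" using k by (simp_all add: symmetric_form_def bilinear_conv_bounded_bilinear)
  have "g \<in> points M"
    using g connected_component_of_subset_topspace[of "mtop M" \<one>] openin_mtop_subset[OF atlas openin_topspace] by blast
  then have gG: "g \<in> carrier G" by (simp add: points)
  have *: "k (Ad G M (inv g) r) (Ad G M (inv g) s) = k (Ad G M (inv \<one>) r) (Ad G M (inv \<one>) s)" for r s
  proof (rule dfun_zero_imp_constant[OF atlas _ _ g])
    show "vsmooth_on M (points M) (\<lambda>p. k (Ad G M (inv p) r) (Ad G M (inv p) s))"
      by (rule vsmooth_on_bilinear[OF atlas kb Ad_inv_smooth Ad_inv_smooth])
    fix p v assume p: "p \<in> points M"
    show "dfun M (\<lambda>p. k (Ad G M (inv p) r) (Ad G M (inv p) s)) p v = 0"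
      unfolding dfun_bilinear[OF atlas kb Ad_inv_smooth Ad_inv_smooth p] dfun_Ad_inv[OF p]
      using k(2) by (simp add: invariant_form_def bilinear_lneg[OF kb'] bilinear_rneg[OF kb'])
        (metis add.commute add.inverse_inverse add_eq_0_iff)
  qed
  show ?thesis using *[of "Ad G M g r" "Ad G M g s"] gG by (simp add: Ad_inv Ad_one)
qed

text \<open>Product rule for the Maurer-Cartan form: a motion of the right factor is only left
  translated, which the form ignores, while a motion of the left factor is right translated by
  \<open>c s\<close>, which conjugates.\<close>

lemma theta_mult:
  assumes S: "smooth_atlas S" and a: "smooth_map S M a" and c: "smooth_map S M c" and s: "s \<in> points S"
  shows "\<theta> (a s \<otimes> c s) (tmap S M (\<lambda>s. a s \<otimes> c s) s v) =
    \<theta> (c s) (tmap S M c s v) + Ad G M (inv (c s)) (\<theta> (a s) (tmap S M a s v))"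
proof -
  have G: "a s \<in> carrier G" "c s \<in> carrier G"
    using smooth_map_points[OF a s] smooth_map_points[OF c s] by (auto simp: points)
  have p: "a s \<in> points M" "c s \<in> points M" "a s \<otimes> c s \<in> points M" using G by (simp_all add: points)
  let ?d = "chart_at M (a s \<otimes> c s)"
  have d: "?d \<in> M" "a s \<otimes> c s \<in> fst ?d" using chart_at[OF p(3)] by auto
  note f = vsmooth_on_snd[OF atlas d(1)]
  have "tmap S M (\<lambda>s. a s \<otimes> c s) s v = tmap M M (\<lambda>x. x \<otimes> c s) (a s) (tmap S M a s v) + tmap M M (ltrans G (a s)) (c s) (tmap S M c s v)"
  proof (rule tmap_eqI[OF S atlas smooth_map_mult[OF S a c] s d])
    show "dfun S (\<lambda>s. snd ?d (a s \<otimes> c s)) s v = dfun M (snd ?d) (a s \<otimes> c s)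
      (tmap M M (\<lambda>x. x \<otimes> c s) (a s) (tmap S M a s v) + tmap M M (ltrans G (a s)) (c s) (tmap S M c s v))"
      unfolding dfun_mult[OF f S a c s d(2)] linear_add[OF dfun_linear[OF atlas f d(2)]]
      using dfun_tmap[OF atlas atlas rtrans_smooth[OF G(2)] p(1) f d(2)]
        dfun_tmap[OF atlas atlas ltrans_smooth[OF G(1)] p(2) f] d(2)
      by (simp add: ltrans_def)
  qed
  then show ?thesis
    by (simp add: linear_add[OF P.\<theta>_linear[OF p(3)]] theta_rtrans[OF G(2,1)] theta_ltrans[OF G])
qed

section \<open>Left-invariant connections and their pullbacks\<close>

lemma ltrans_bij:
  assumes g: "g \<in> carrier G"
  shows "bij_betw (ltrans G g) (points M) (points M)" "q \<in> points M \<Longrightarrow> inv_into (points M) (ltrans G g) q = ltrans G (inv g) q"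
proof -
  have b: "bij_betw (ltrans G g) (carrier G) (carrier G)"
    by (rule bij_betw_byWitness[where f' = "ltrans G (inv g)"])
      (use g in \<open>auto simp: ltrans_def simp flip: m_assoc\<close>)
  then show "bij_betw (ltrans G g) (points M) (points M)" by (simp add: points)
  show "inv_into (points M) (ltrans G g) q = ltrans G (inv g) q" if "q \<in> points M" for q
    by (rule inv_into_f_eq) (use that g b in \<open>auto simp: points ltrans_def bij_betw_def simp flip: m_assoc\<close>)
qed

lemma conj_bij:
  assumes g: "g \<in> carrier G"
  shows "bij_betw (conj_by G g) (points M) (points M)" "q \<in> points M \<Longrightarrow> inv_into (points M) (conj_by G g) q = conj_by G (inv g) q"
proof -
  have cl: "conj_by G h x \<in> carrier G" if "h \<in> carrier G" "x \<in> carrier G" for h x using that by (simp add: conj_by_def)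
  have id: "conj_by G \<one> x = x" if "x \<in> carrier G" for x using that by (simp add: conj_by_def)
  have b: "bij_betw (conj_by G g) (carrier G) (carrier G)"
    by (rule bij_betw_byWitness[where f' = "conj_by G (inv g)"])
      (use g cl in \<open>auto simp: conj_conj id\<close>)
  then show "bij_betw (conj_by G g) (points M) (points M)" by (simp add: points)
  show "inv_into (points M) (conj_by G g) q = conj_by G (inv g) q" if "q \<in> points M" for q
    by (rule inv_into_f_eq) (use that g b cl in \<open>auto simp: points conj_conj id bij_betw_def\<close>)
qed

lemma ltrans_inv_smooth: "g \<in> carrier G \<Longrightarrow> smooth_map M M (inv_into (points M) (ltrans G g))"
  by (rule smooth_map_cong[OF atlas atlas ltrans_smooth[of "inv g"]]) (simp_all add: ltrans_bij(2))

lemma conj_inv_smooth: "g \<in> carrier G \<Longrightarrow> smooth_map M M (inv_into (points M) (conj_by G g))"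
  by (rule smooth_map_cong[OF atlas atlas conj_smooth[of "inv g"]]) (simp_all add: conj_bij(2))

text \<open>The matrix of a left translation in the left-invariant frame is the identity, so the
  pullback has the same coefficients.\<close>

lemma frame_conn_left_invariant:
  assumes "P.frame_conn A D"
  shows "left_invariant_conn G M D"
  unfolding left_invariant_conn_def
proof
  fix g assume g: "g \<in> carrier G"
  have "P.frame_conn (\<lambda>r s. A r s) (pullback_conn M (ltrans G g) D)"
    by (rule P.frame_conn_pullback[OF assms ltrans_bij(1)[OF g] ltrans_smooth[OF g] ltrans_inv_smooth[OF g], of "\<lambda>v. v" "\<lambda>v. v"])
      (use theta_ltrans[OF g] linear_ident in \<open>auto simp: points ltrans_def[of _ g]\<close>)
  then show "conn_eq M (pullback_conn M (ltrans G g) D) D" by (rule P.frame_conn_eq) (rule assms)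
qed

lemma E_left_invariant: "left_invariant_field G M (E r)"
  unfolding left_invariant_field_def
proof (intro ballI)
  fix g p assume g: "g \<in> carrier G" and p: "p \<in> carrier G"
  have "inv_into (points M) (ltrans G g) p = inv g \<otimes> p" using ltrans_bij(2)[OF g, of p] p by (simp add: points ltrans_def)
  then show "push M (ltrans G g) (E r) p = E r p"
    using tmap_ltrans_E[OF g, of "inv g \<otimes> p" r] g p by (simp add: push_def Let_def flip: m_assoc)
qed

text \<open>Passes from a prescription on left-invariant fields to one on all smooth local fields,
  the form in which torsion, curvature and pullbacks are computed.\<close>

lemma determined_by_iff:
  assumes P: "bilinear P"
  shows "determined_by G M P D \<longleftrightarrow> P.frame_conn (\<lambda>r s. P r s + (1/2) *\<^sub>R b r s) D" (is "_ \<longleftrightarrow> P.frame_conn ?A D")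
proof -
  have A: "bilinear ?A"
    using P br_bilinear unfolding bilinear_def
    by (auto intro!: linear_compose_add linear_compose_scale_right)
  show ?thesis
  proof
    assume "determined_by G M P D"
    then show "P.frame_conn ?A D"
      by (intro P.affine_connection_frame_conn A) (auto simp: determined_by_def points)
  next
    assume D: "P.frame_conn ?A D"
    then show "determined_by G M P D"
      unfolding determined_by_def
      using P.frame_conn_affine[OF A D] frame_conn_left_invariant[OF D] P.frame_conn_E[OF D] theta_E by (auto simp: points)
  qed
qed

lemma determined_by_exists: "bilinear P \<Longrightarrow> \<exists>D. determined_by G M P D"
  using P.frame_conn_exists by (simp add: determined_by_iff)

lemma frame_conn_pullback_conj:
  assumes D: "P.frame_conn A D" and g: "g \<in> carrier G"
  shows "P.frame_conn (\<lambda>r s. Ad G M (inv g) (A (Ad G M g r) (Ad G M g s))) (pullback_conn M (conj_by G g) D)"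
  by (rule P.frame_conn_pullback[OF D conj_bij(1)[OF g] conj_smooth[OF g] conj_inv_smooth[OF g] _ Ad_linear[OF g] Ad_inv(1)[OF g] Ad_inv(2)[OF g]])
    (use theta_conj[OF g] in \<open>simp add: points\<close>)

end

section \<open>Planes\<close>

text \<open>Serves as the domain of the planes, which are parametrized by open rectangles.\<close>

definition open_atlas :: "'e::euclidean_space set \<Rightarrow> ('e, 'e) atlas" where
  "open_atlas U = {(U, \<lambda>x. x)}"

context
  fixes U :: "'e::euclidean_space set"
  assumes U: "open U"
begin

lemma points_open_atlas: "points (open_atlas U) = U"
  by (simp add: points_def open_atlas_def)

lemma chart_inv_open: "x \<in> U \<Longrightarrow> chart_inv (U, \<lambda>x. x) x = x"
  by (simp add: chart_inv_def inv_into_f_f[of "\<lambda>x. x", simplified] inj_on_def)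

lemma open_atlas_smooth: "smooth_atlas (open_atlas U)"
proof -
  have "smooth_on U ((\<lambda>x. x) \<circ> chart_inv (U, \<lambda>x. x))"
    by (rule smooth_on_cong[OF U _ smooth_on_id[OF U]]) (simp add: chart_inv_open)
  then show ?thesis using U by (simp add: smooth_atlas_def open_atlas_def)
qed

lemma openin_open_atlas: "openin (mtop (open_atlas U)) W \<longleftrightarrow> W \<subseteq> U \<and> open W"
  unfolding openin_mtop[OF open_atlas_smooth] points_open_atlas
  using U by (auto simp: open_atlas_def Int_absorb1)

lemma mtop_open_atlas: "mtop (open_atlas U) = top_of_set U"
  by (rule topology_eq[THEN iffD2]) (auto simp: openin_open_atlas openin_open_eq[OF U])

lemma open_atlas_manifold: "manifold (open_atlas U)"
proof -
  obtain B :: "'e set set" where B: "countable B" "topological_basis B"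
    using ex_countable_basis by auto
  have "second_countable (euclidean :: 'e topology)"
    unfolding second_countable_def
    using B topological_basis_open[OF B(2)] topological_basis_def[of B] by (intro exI[of _ B]) (force simp: topological_basis_iff)
  then have "second_countable (top_of_set U)" by (rule second_countable_subtopology)
  moreover have "Hausdorff_space (top_of_set U)"
    by (simp add: Hausdorff_space_subtopology)
  ultimately show ?thesis by (simp add: manifold_def open_atlas_smooth mtop_open_atlas)
qed

lemma chart_at_open: "p \<in> U \<Longrightarrow> chart_at (open_atlas U) p = (U, \<lambda>x. x)"
  unfolding chart_at_def by (rule some_equality) (auto simp: open_atlas_def)

lemma vsmooth_on_open: "vsmooth_on (open_atlas U) W f \<longleftrightarrow> W \<subseteq> U \<and> open W \<and> smooth_on W f"
proof -
  have "smooth_on W (f \<circ> chart_inv (U, \<lambda>x. x)) \<longleftrightarrow> smooth_on W f" if "W \<subseteq> U" "open W"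
    using smooth_on_cong[OF that(2), of "f \<circ> chart_inv (U, \<lambda>x. x)" f] smooth_on_cong[OF that(2), of f "f \<circ> chart_inv (U, \<lambda>x. x)"]
      that(1) chart_inv_open by fastforce
  then show ?thesis
    unfolding vsmooth_on_def openin_open_atlas by (auto simp: open_atlas_def Int_absorb1)
qed

lemma dfun_open: "p \<in> U \<Longrightarrow> dfun (open_atlas U) f p = frechet_derivative f (at p)"
  using frechet_derivative_cong[OF U, of p "f \<circ> chart_inv (U, \<lambda>x. x)" f]
  by (auto simp: dfun_def chart_at_open chart_inv_open)

lemma dfun_open_ident: "p \<in> U \<Longrightarrow> dfun (open_atlas U) (\<lambda>x. x) p v = v"
  by (simp add: dfun_open)

lemma open_atlas_parallelism: "parallelism (open_atlas U) (\<lambda>r p. r) (\<lambda>p v. v) (\<lambda>r s. 0)"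
proof (rule parallelism.intro)
  let ?c = "(U, \<lambda>x::'e. x)"
  have c: "?c \<in> open_atlas U" by (simp add: open_atlas_def)
  show "vsmooth_on (open_atlas U) W (\<lambda>p. X p)" if X: "vector_field_on (open_atlas U) W X" for W X
  proof -
    have W: "openin (mtop (open_atlas U)) W" by (rule vector_field_onD[OF open_atlas_smooth X])
    then have WU: "W \<subseteq> U" by (simp add: openin_open_atlas)
    have "vsmooth_on (open_atlas U) W (\<lambda>p. dfun (open_atlas U) (\<lambda>x. x) p (X p))"
      by (rule vector_field_on_dfun[OF open_atlas_smooth X])
        (use W U in \<open>simp add: vsmooth_on_open openin_open_atlas smooth_on_id\<close>)
    then show ?thesis
      by (rule vsmooth_on_cong[OF open_atlas_smooth]) (use WU dfun_open_ident in auto)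
  qed
  show "vector_field_on (open_atlas U) (points (open_atlas U)) (\<lambda>p. r)" for r
  proof (rule vector_field_onI[OF open_atlas_smooth openin_points[OF open_atlas_smooth]])
    fix p assume "p \<in> points (open_atlas U)"
    moreover have "vsmooth_on (open_atlas U) U (\<lambda>p. dfun (open_atlas U) (\<lambda>x. x) p r)"
      by (rule vsmooth_on_cong[OF open_atlas_smooth, of _ "\<lambda>p. r"])
        (use U in \<open>simp_all add: dfun_open_ident vsmooth_on_open smooth_on_const\<close>)
    ultimately show "\<exists>d\<in>open_atlas U. \<exists>W. p \<in> W \<and> W \<subseteq> points (open_atlas U) \<and> W \<subseteq> fst d \<and>
        vsmooth_on (open_atlas U) W (\<lambda>p. dfun (open_atlas U) (snd d) p r)"
      by (intro bexI[OF _ c] exI[of _ U]) (simp add: points_open_atlas)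
  qed
  show "lie_bracket (open_atlas U) (\<lambda>p. r) (\<lambda>p. s) p = 0" if "p \<in> points (open_atlas U)" for p r s
  proof -
    have p: "p \<in> U" using that by (simp add: points_open_atlas)
    have "frechet_derivative (local_rep (open_atlas U) ?c (\<lambda>p. w)) (at p) = frechet_derivative (\<lambda>x. w) (at p)" for w
      by (rule frechet_derivative_cong[OF U p])
        (simp add: local_rep_eq[OF open_atlas_smooth] chart_inv_open dfun_open_ident)
    then show ?thesis by (simp add: lie_bracket_def chart_at_open[OF p])
  qed
qed (auto simp: open_atlas_smooth linear_ident)

end

context lie_group
begin

text \<open>The integral curve of \<open>E r\<close> through the identity, on a short interval. It
  is stated after composition with a linear functional \<open>pr\<close>, because a plane needs it
  as a map on a rectangle that depends on one coordinate.\<close>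

lemma one_parameter_curve:
  obtains g d where "d > 0" "g 0 = \<one>"
    "\<And>U pr s v. open U \<Longrightarrow> bounded_linear pr \<Longrightarrow> pr ` U \<subseteq> {-d<..<d} \<Longrightarrow> smooth_map (open_atlas U) M (\<lambda>s::'s::euclidean_space. g (pr s)) \<and>
      (s \<in> U \<longrightarrow> \<theta> (g (pr s)) (tmap (open_atlas U) M (\<lambda>s. g (pr s)) s v) = pr v *\<^sub>R r)"
proof -
  let ?c = "chart_at M \<one>"
  have c: "?c \<in> M" "\<one> \<in> fst ?c" using chart_at[OF one_point] by auto
  let ?F = "local_rep M ?c (E r)" and ?O = "snd ?c ` fst ?c"
  have cp: "fst ?c \<inter> points M = fst ?c" using chart_subset_points[OF c(1)] by auto
  have F: "smooth_on ?O ?F" using E_smooth[of r] c cp unfolding vector_field_on_def by metis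
  have O: "open ?O" using atlas c by (auto simp: smooth_atlas_def)
  obtain y d where y: "d > 0" "y 0 = snd ?c \<one>" "\<And>e. e \<le> d \<Longrightarrow> smooth_on {-e<..<e} y"
    "\<And>u. u \<in> {-d<..<d} \<Longrightarrow> y u \<in> ?O" "\<And>u. u \<in> {-d<..<d} \<Longrightarrow> (y has_vector_derivative ?F (y u)) (at u)"
    by (rule integral_curve_exists[OF F O imageI[OF c(2)]]) (rule that; assumption)
  define g where "g u = chart_inv ?c (y u)" for u
  have g: "g u \<in> fst ?c" "snd ?c (g u) = y u" if u: "u \<in> {-d<..<d}" for u
    using y(4)[OF u] chart_inv_snd[OF atlas c(1)] by (auto simp: g_def)
  show thesis
  proof (rule that[OF y(1)])
    show "g 0 = \<one>" by (simp add: g_def y(2) chart_inv_snd[OF atlas c])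
    fix U :: "'s set" and pr s v assume U: "open U" and pr: "bounded_linear pr" "pr ` U \<subseteq> {-d<..<d}"
    note S = open_atlas_smooth[OF U]
    have gU: "g (pr s) \<in> fst ?c" "snd ?c (g (pr s)) = y (pr s)" if "s \<in> U" for s using g pr(2) that by auto
    have "smooth_on U (\<lambda>s. y (pr s))"
      by (rule smooth_on_compose[OF smooth_on_linear[OF pr(1) U smooth_on_id[OF U]] y(3)[OF order_refl] U _ pr(2)]) simp
    then have sy: "smooth_on U (\<lambda>s. snd ?c (g (pr s)))"
      by (rule smooth_on_cong[OF U, rotated]) (simp add: gU)
    have sm: "smooth_map (open_atlas U) M (\<lambda>s. g (pr s))"
    proof (rule smooth_mapI[OF S atlas])
      fix p assume "p \<in> points (open_atlas U)"
      then show "\<exists>d\<in>M. \<exists>V. p \<in> V \<and> (\<lambda>s. g (pr s)) ` V \<subseteq> fst d \<and> vsmooth_on (open_atlas U) V (\<lambda>q. snd d (g (pr q)))"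
        by (intro bexI[OF _ c(1)] exI[of _ U]) (use gU sy U in \<open>auto simp: points_open_atlas[OF U] vsmooth_on_open[OF U]\<close>)
    qed
    have "\<theta> (g (pr s)) (tmap (open_atlas U) M (\<lambda>s. g (pr s)) s v) = pr v *\<^sub>R r" if s: "s \<in> U"
    proof -
      have sp: "s \<in> points (open_atlas U)" using s by (simp add: points_open_atlas[OF U])
      have gp: "g (pr s) \<in> points M" using gU[OF s] chart_subset_points[OF c(1)] by auto
      have pd: "pr s \<in> {-d<..<d}" using pr(2) s by auto
      have "((\<lambda>s. y (pr s)) has_derivative (\<lambda>v. pr v *\<^sub>R ?F (y (pr s)))) (at s)"
        using has_derivative_compose[OF bounded_linear_imp_has_derivative[OF pr(1)] y(5)[OF pd, unfolded has_vector_derivative_def]] .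
      then have "((\<lambda>s. snd ?c (g (pr s))) has_derivative (\<lambda>v. pr v *\<^sub>R ?F (y (pr s)))) (at s)"
        by (rule has_derivative_transform_within_open[OF _ U s]) (simp add: gU)
      from frechet_derivative_at[OF this]
      have "dfun (open_atlas U) (\<lambda>s. snd ?c (g (pr s))) s v = pr v *\<^sub>R ?F (y (pr s))"
        by (simp add: dfun_open[OF U s] fun_eq_iff)
      also have "?F (y (pr s)) = dfun M (snd ?c) (g (pr s)) (E r (g (pr s)))"
        by (simp add: local_rep_eq[OF atlas] g_def)
      also have "pr v *\<^sub>R \<dots> = dfun M (snd ?c) (g (pr s)) (E (pr v *\<^sub>R r) (g (pr s)))"
        by (simp add: linear_scale[OF P.E_linear[OF gp]] linear_scale[OF dfun_linear[OF atlas vsmooth_on_snd[OF atlas c(1)] gU(1)[OF s]]])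
      finally have "tmap (open_atlas U) M (\<lambda>s. g (pr s)) s v = E (pr v *\<^sub>R r) (g (pr s))"
        by (rule tmap_eqI[OF S atlas sm sp c(1) gU(1)[OF s]])
      then show ?thesis using theta_E[of "g (pr s)"] gp by (simp add: points)
    qed
    then show "smooth_map (open_atlas U) M (\<lambda>s. g (pr s)) \<and>
      (s \<in> U \<longrightarrow> \<theta> (g (pr s)) (tmap (open_atlas U) M (\<lambda>s. g (pr s)) s v) = pr v *\<^sub>R r)"
      using sm by blast
  qed
qed

text \<open>In the frame consisting of \<open>t\<close> and \<open>R s\<close> the induced connection has constant coefficients \<open>AS\<close>,
  the product of the commutative associative algebra generated by \<open>\<epsilon>\<close> with \<open>\<epsilon>\<^sup>2 = q(r, r)\<close>;
  hence it is flat.\<close>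

lemma complete_set_of_planesI:
  assumes A: "bilinear A" and D: "P.frame_conn A D"
    and At: "\<And>r. A r t = r" "\<And>r. A t r = r + b t r"
    and l: "linear l" "l t = (1::real)" "\<And>r. l (b t r) = 0"
    and q: "bilinear q" "\<And>r. l r = 0 \<Longrightarrow> A r r = (q r r :: real) *\<^sub>R t" "\<And>r. l r = 0 \<Longrightarrow> q (b t r) r + q r (b t r) = 0"
  shows "complete_set_of_planes M D (E t)"
  unfolding complete_set_of_planes_def
proof (intro ballI allI impI, elim conjE)
  fix p L assume p: "p \<in> points M" and L: "subspace L" "dim L = 2" "E t p \<in> L"
  have pG: "p \<in> carrier G" using p by (simp add: points)
  have "\<not> L \<subseteq> span {E t p}"
    using dim_subset[of L "span {E t p}"] dim_le_card'[of "{E t p}"] L(2) by auto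
  then obtain a where a: "a \<in> L" "a \<notin> span {E t p}" by auto
  \<comment> \<open>Removing the \<open>t\<close> component puts \<open>r\<close> into the kernel of
    \<open>l\<close>, where \<open>A r r\<close> is a multiple of \<open>t\<close>, without changing
    the plane spanned together with \<open>E t p\<close>.\<close>
  define r where "r = \<theta> p a - l (\<theta> p a) *\<^sub>R t"
  have Er: "E r p = a - l (\<theta> p a) *\<^sub>R E t p"
    by (simp add: r_def linear_diff[OF P.E_linear[OF p]] linear_scale[OF P.E_linear[OF p]] P.E_\<theta>[OF p])
  have ErL: "E r p \<in> L" using a L by (simp add: Er subspace_diff subspace_scale)
  have r0: "r \<noteq> 0"
  proof
    assume "r = 0"
    then have "a = l (\<theta> p a) *\<^sub>R E t p" using Er linear_0[OF P.E_linear[OF p]] by simp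
    then show False using a(2) by (metis insertI1 span_base span_scale)
  qed
  have lr: "l r = 0" using l by (simp add: r_def linear_diff linear_scale)
  obtain g1 d1 where g1: "d1 > 0" "g1 0 = \<one>"
    "\<And>U pr s v. open U \<Longrightarrow> bounded_linear pr \<Longrightarrow> pr ` U \<subseteq> {-d1<..<d1} \<Longrightarrow> smooth_map (open_atlas U) M (\<lambda>s::real \<times> real. g1 (pr s)) \<and>
      (s \<in> U \<longrightarrow> \<theta> (g1 (pr s)) (tmap (open_atlas U) M (\<lambda>s. g1 (pr s)) s v) = pr v *\<^sub>R t)"
    by (rule one_parameter_curve[of t, where 's = "real \<times> real"]) (rule that; assumption)
  obtain g2 d2 where g2: "d2 > 0" "g2 0 = \<one>"
    "\<And>U pr s v. open U \<Longrightarrow> bounded_linear pr \<Longrightarrow> pr ` U \<subseteq> {-d2<..<d2} \<Longrightarrow> smooth_map (open_atlas U) M (\<lambda>s::real \<times> real. g2 (pr s)) \<and>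
      (s \<in> U \<longrightarrow> \<theta> (g2 (pr s)) (tmap (open_atlas U) M (\<lambda>s. g2 (pr s)) s v) = pr v *\<^sub>R r)"
    by (rule one_parameter_curve[of r, where 's = "real \<times> real"]) (rule that; assumption)
  define U where "U = {-d1<..<d1} \<times> {-d2<..<d2}"
  have U: "open U" unfolding U_def by (intro open_Times) auto
  have U0: "(0, 0) \<in> U" using g1 g2 by (simp add: U_def)
  let ?S = "open_atlas U"
  note S = open_atlas_smooth[OF U]
  note pS = points_open_atlas[OF U]
  interpret S: parallelism ?S "\<lambda>r p. r" "\<lambda>p v. v" "\<lambda>r s. 0" by (rule open_atlas_parallelism[OF U])
  have im: "fst ` U \<subseteq> {-d1<..<d1}" "snd ` U \<subseteq> {-d2<..<d2}" by (auto simp: U_def)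
  note s1 = g1(3)[OF U bounded_linear_fst im(1)] and s2 = g2(3)[OF U bounded_linear_snd im(2)]
  have m1: "smooth_map ?S M (\<lambda>s. g1 (fst s))" and m2: "smooth_map ?S M (\<lambda>s. g2 (snd s))" using s1 s2 by auto
  have mp: "smooth_map ?S M (\<lambda>s. p)" by (rule smooth_map_const[OF S atlas p])
  note ma = smooth_map_mult[OF S mp m2]
  define f where "f s = (p \<otimes> g2 (snd s)) \<otimes> g1 (fst s)" for s
  have mf: "smooth_map ?S M f" unfolding f_def[abs_def] by (rule smooth_map_mult[OF S ma m1])
  have fp: "f s \<in> points M" if "s \<in> U" for s using smooth_map_points[OF mf] that by (simp add: pS)
  define R where "R s = Ad G M (inv (g1 (fst s))) r" for s :: "real \<times> real"
  define J where "J s v = fst v *\<^sub>R t + snd v *\<^sub>R R s" for s v :: "real \<times> real"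
  have g1G: "g1 (fst s) \<in> carrier G" if "s \<in> U" for s using smooth_map_points[OF m1] that by (simp add: pS points)
  have fJ: "\<theta> (f s) (tmap ?S M f s v) = J s v" if s: "s \<in> U" for s v
  proof -
    have sp: "s \<in> points ?S" using s by (simp add: pS)
    have "\<theta> (p \<otimes> g2 (snd s)) (tmap ?S M (\<lambda>s. p \<otimes> g2 (snd s)) s v) = snd v *\<^sub>R r"
      using smooth_map_points[OF m2 sp] s2[of s v] s
      by (simp add: theta_mult[OF S mp m2 sp] tmap_const[OF S atlas p sp] linear_0[OF P.\<theta>_linear[OF p]]
          linear_0[OF Ad_linear] points)
    then show ?thesis
      using theta_mult[OF S ma m1 sp, of v] s1[of s v] s g1G[OF s]
      by (simp add: f_def[abs_def] J_def R_def linear_scale[OF Ad_linear])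
  qed
  have sR: "vsmooth_on ?S (points ?S) R"
    using smooth_map_vsmooth[OF S atlas m1 Ad_inv_smooth[of r]] smooth_map_points[OF m1]
    by (simp add: R_def[abs_def] Collect_conv_if2 cong: conj_cong)
  \<comment> \<open>Only the first coordinate moves \<open>R\<close>; it differentiates
    \<open>Ad(inv (g1 u))\<close> along the integral curve of \<open>E t\<close>, which produces a
    bracket with \<open>t\<close>.\<close>
  have dR: "dfun ?S R s v = - (fst v) *\<^sub>R b t (R s)" if s: "s \<in> points ?S" for s v
  proof -
    have gp: "g1 (fst s) \<in> points M" by (rule smooth_map_points[OF m1 s])
    have "dfun ?S R s v = dfun M (\<lambda>p. Ad G M (inv p) r) (g1 (fst s)) (tmap ?S M (\<lambda>s. g1 (fst s)) s v)"
      unfolding R_def[abs_def] by (rule dfun_tmap[OF S atlas m1 s Ad_inv_smooth gp, symmetric])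
    also have "\<dots> = - b (fst v *\<^sub>R t) (R s)"
      unfolding dfun_Ad_inv[OF gp] using s1[of s v] s by (simp add: R_def pS)
    finally show ?thesis by (simp add: bilinear_lmul[OF br_bilinear])
  qed
  have conn: "s \<in> connected_component_of_set (mtop ?S) (0, 0)" if "s \<in> points ?S" for s
  proof -
    have "connectedin (mtop ?S) U"
      unfolding mtop_open_atlas[OF U] by (simp add: connectedin_subtopology) (simp add: U_def connected_Times)
    then show ?thesis using U0 that by (auto simp: connected_component_of_def pS)
  qed
  have R0: "R (0, 0) = r" by (simp add: R_def g1(2) Ad_one)
  have bl: "bounded_linear l" using l(1) by (simp add: linear_conv_bounded_linear)
  have lR: "l (R s) = 0" if s: "s \<in> points ?S" for s
  proof -
    have "l (R s) = l (R (0, 0))"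
      by (rule dfun_zero_imp_constant[OF S vsmooth_on_linear[OF S bl sR] _ conn[OF s]])
        (simp add: dfun_comp_linear[OF S bl sR] dR linear_scale[OF l(1)] l(3) linear_neg[OF l(1)])
    then show ?thesis by (simp add: R0 lr)
  qed
  have bq: "bounded_bilinear q" using q(1) by (simp add: bilinear_conv_bounded_bilinear)
  have qR: "q (R s) (R s) = q r r" if s: "s \<in> points ?S" for s
  proof -
    have "q (R s) (R s) = q (R (0, 0)) (R (0, 0))"
    proof (rule dfun_zero_imp_constant[OF S vsmooth_on_bilinear[OF S bq sR sR] _ conn[OF s]])
      fix s v assume s: "s \<in> points ?S"
      have "dfun ?S (\<lambda>s. q (R s) (R s)) s v = - fst v * (q (R s) (b t (R s)) + q (b t (R s)) (R s))"
        by (simp add: dfun_bilinear[OF S bq sR sR s] dR[OF s] bilinear_lmul[OF q(1)] bilinear_rmul[OF q(1)]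
            bilinear_lneg[OF q(1)] bilinear_rneg[OF q(1)] algebra_simps)
      then show "dfun ?S (\<lambda>s. q (R s) (R s)) s v = 0" using q(3)[OF lR[OF s]] by (simp add: add.commute)
    qed
    then show ?thesis by (simp add: R0)
  qed
  define AS where "AS v y = (fst v * fst y + q r r * (snd v * snd y), fst v * snd y + snd v * fst y)" for v y :: "real \<times> real"
  have AS: "bilinear AS"
    unfolding bilinear_def AS_def[abs_def] by (auto intro!: linearI simp: algebra_simps)
  have sJ: "vsmooth_on ?S (points ?S) (\<lambda>s. J s v)" for v
    unfolding J_def
    by (intro vsmooth_on_add[OF S] vsmooth_on_const[OF S] openin_points[OF S] vsmooth_on_linear[OF S bounded_linear_scaleR_right sR])
  have linJ: "linear (J s)" for s by (rule linearI) (simp_all add: J_def algebra_simps)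
  \<comment> \<open>\<open>A t (R s) = R s + b t (R s)\<close> need not be tangent by itself; the
    derivative of \<open>R\<close> along the first coordinate is \<open>- b t (R s)\<close> and
    cancels the excess.\<close>
  have AJ: "dfun ?S (\<lambda>\<sigma>. J \<sigma> y) s v + A (J s v) (J s y) = J s (AS v y)" if s: "s \<in> points ?S" for s v y
  proof -
    have "dfun ?S (\<lambda>\<sigma>. J \<sigma> y) s v = - (snd y * fst v) *\<^sub>R b t (R s)"
      unfolding J_def
      by (simp add: dfun_add[OF S vsmooth_on_const[OF S openin_points[OF S]] vsmooth_on_linear[OF S bounded_linear_scaleR_right sR] s]
          dfun_comp_linear[OF S bounded_linear_scaleR_right sR s] dfun_const[OF S] dR[OF s])
    moreover have "A (J s v) (J s y) = (fst v * fst y + snd v * snd y * q r r) *\<^sub>R t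
        + (fst v * snd y + snd v * fst y) *\<^sub>R R s + (fst v * snd y) *\<^sub>R b t (R s)"
      by (simp add: J_def bilinear_ladd[OF A] bilinear_radd[OF A] bilinear_lmul[OF A] bilinear_rmul[OF A] At br_self
          q(2)[OF lR[OF s]] qR[OF s] algebra_simps)
    ultimately show ?thesis by (simp add: J_def AS_def algebra_simps)
  qed
  have fJ': "\<theta> (f s) (tmap ?S M f s v) = J s v" if "s \<in> points ?S" for s v
    using fJ that by (simp add: pS)
  note imm = P.frame_conn_immersion[OF D S.parallelism_axioms mf, where J = J and AS = AS]
  have geo: "totally_geodesic ?S M D f"
    by (rule imm(1)) (simp_all add: sJ linJ fJ' AJ)
  \<comment> \<open>\<open>l\<close> recovers the first coordinate, being 1 on \<open>t\<close> and
    0 on \<open>R s\<close>; the second is recovered because \<open>Ad\<close> is invertible and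
    \<open>r\<close> is not zero.\<close>
  have injJ: "J s v = 0 \<Longrightarrow> v = 0" if s: "s \<in> points ?S" for s v
  proof -
    assume 0: "J s v = 0"
    then have "l (J s v) = 0" by (simp add: linear_0[OF l(1)])
    then have v1: "fst v = 0" by (simp add: J_def linear_add[OF l(1)] linear_scale[OF l(1)] l(2) lR[OF s])
    have g: "g1 (fst s) \<in> carrier G" using g1G s by (simp add: pS)
    have "R s \<noteq> 0"
      using Ad_inv(2)[OF g, of r] r0 linear_0[OF Ad_linear[OF g]] by (auto simp: R_def)
    then have "snd v = 0" using 0 v1 by (simp add: J_def)
    with v1 show "v = 0" by (simp add: prod_eq_iff)
  qed
  have tE: "tmap ?S M f s v = E (J s v) (f s)" if s: "s \<in> points ?S" for s v
    using fJ'[OF s] P.E_\<theta>[OF smooth_map_points[OF mf s]] by metis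
  have immf: "immersion ?S M f"
    unfolding immersion_def
  proof (intro conjI ballI mf)
    fix s assume s: "s \<in> points ?S"
    show "inj (tmap ?S M f s)"
      unfolding linear_injective_0[OF tmap_linear[OF S atlas mf s]]
      using injJ[OF s] fJ'[OF s] linear_0[OF P.\<theta>_linear[OF smooth_map_points[OF mf s]]] by metis
  qed
  have ind: "S.frame_conn AS (induced_conn ?S M D f)"
    by (rule imm(2)) (simp_all add: sJ linJ fJ' AJ immf)
  have Et: "E t (f s) \<in> range (tmap ?S M f s)" if s: "s \<in> points ?S" for s
    using tE[OF s, of "(1, 0)"] by (metis J_def add.right_neutral fst_conv scaleR_one scaleR_zero_left snd_conv rangeI)
  have flat: "flat ?S (induced_conn ?S M D f)"
    unfolding flat_def
  proof (intro allI impI ballI, elim conjE)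
    fix W X Y Z s assume X: "vector_field_on ?S W X" and Y: "vector_field_on ?S W Y" and Z: "vector_field_on ?S W Z" and s: "s \<in> W"
    show "curvature ?S (induced_conn ?S M D f) X Y Z s = 0"
      unfolding S.frame_conn_curvature[OF AS ind X Y Z s]
      by (simp add: AS_def algebra_simps zero_prod_def)
  qed
  have plane: "plane M D (E t) ?S f"
    unfolding plane_def planelike_surface_def
    using open_atlas_manifold[OF U] immf geo Et flat by auto
  have 0: "(0, 0) \<in> points ?S" using U0 by (simp add: pS)
  have f0: "f (0, 0) = p" using pG by (simp add: f_def g1(2) g2(2))
  have "range (tmap ?S M f (0, 0)) = L"
  proof (rule subspace_dim_equal)
    note lin = tmap_linear[OF S atlas mf 0]
    show "subspace (range (tmap ?S M f (0, 0)))" by (rule linear_subspace_image[OF lin subspace_UNIV])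
    show "range (tmap ?S M f (0, 0)) \<subseteq> L"
    proof
      fix x assume "x \<in> range (tmap ?S M f (0, 0))"
      then obtain v where "x = tmap ?S M f (0, 0) v" by auto
      then have "x = fst v *\<^sub>R E t p + snd v *\<^sub>R E r p"
        by (simp add: tE[OF 0] f0 J_def R0 linear_add[OF P.E_linear[OF p]] linear_scale[OF P.E_linear[OF p]])
      then show "x \<in> L" using L ErL by (simp add: subspace_add subspace_scale)
    qed
    have inj: "inj (tmap ?S M f (0, 0))" using immf 0 by (simp add: immersion_def)
    have "dim (range (tmap ?S M f (0, 0))) = dim (UNIV :: (real \<times> real) set)"
      by (rule dim_image_eq[OF lin]) (use inj in simp)
    then show "dim L \<le> dim (range (tmap ?S M f (0, 0)))" by (simp add: L(2))
  qed (rule L(1))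
  then show "\<exists>S f. plane M D (E t) S f \<and> (\<exists>s\<in>points S. f s = p \<and> range (tmap S M f s) = L)"
    using plane f0 0 by blast
qed

end

lemma complete_set_of_planes_imp_conelike: "complete_set_of_planes M D E \<Longrightarrow> conelike M D E"
  unfolding complete_set_of_planes_def conelike_def plane_def by blast

section \<open>The tensor \<open>\<Pi>\<close> and its Ricci curvature\<close>

lemma tr_add: "tr (\<lambda>x. f x + g x) = tr f + tr g"
  by (simp add: tr_def inner_add_left sum.distrib)

lemma tr_diff: "tr (\<lambda>x. f x - g x) = tr f - tr g"
  by (simp add: tr_def inner_diff_left sum_subtractf)

lemma tr_minus: "tr (\<lambda>x. - f x) = - tr f"
  by (simp add: tr_def sum_negf)

lemma tr_scale: "tr (\<lambda>x. c *\<^sub>R f x) = c * tr f"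
  by (simp add: tr_def sum_distrib_left)

lemma tr_ident: "tr (\<lambda>x::'e::euclidean_space. x) = DIM('e)"
  by (simp add: tr_def)

lemma tr_rank_one:
  fixes f :: "'e::euclidean_space \<Rightarrow> real"
  assumes "linear f" shows "tr (\<lambda>x. f x *\<^sub>R v) = f v"
  using linear_basis_sum[OF assms, of v] by (simp add: tr_def mult.commute)

text \<open>The brackets of elements of \<open>J\<close> span an ideal of \<open>J\<close> that is
  not zero, hence all of \<open>J\<close>.\<close>

lemma simple_ideal_span:
  assumes b: "bilinear b" and J: "simple_ideal b J"
  shows "J \<subseteq> span (range (\<lambda>(x, y). b x y))"
proof -
  have sJ: "subspace J" and id: "\<And>x y. y \<in> J \<Longrightarrow> b x y \<in> J" and ne: "\<exists>x\<in>J. \<exists>y\<in>J. b x y \<noteq> 0"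
    and simple: "\<And>I. subspace I \<Longrightarrow> I \<subseteq> J \<Longrightarrow> (\<And>x y. x \<in> J \<Longrightarrow> y \<in> I \<Longrightarrow> b x y \<in> I) \<Longrightarrow> I = {0} \<or> I = J"
    using J unfolding simple_ideal_def by auto
  let ?I = "span ((\<lambda>(x, y). b x y) ` (J \<times> J))"
  have IJ: "?I \<subseteq> J" by (rule span_minimal[OF _ sJ]) (use id in auto)
  have gen: "b x y \<in> ?I" if "x \<in> J" "y \<in> J" for x y by (rule span_base) (use that in auto)
  have "?I = {0} \<or> ?I = J" by (rule simple[OF subspace_span IJ]) (use IJ gen in blast)
  moreover have "?I \<noteq> {0}" using ne gen by blast
  ultimately have "J = ?I" by simp
  also have "\<dots> \<subseteq> span (range (\<lambda>(x, y). b x y))" by (rule span_mono) auto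
  finally show ?thesis .
qed

lemma semisimple_perfect:
  assumes b: "bilinear b" and "semisimple b"
  shows "span (range (\<lambda>(x, y). b x y)) = UNIV"
proof -
  obtain \<J> where J: "\<And>J. J \<in> \<J> \<Longrightarrow> simple_ideal b J" "span (\<Union>\<J>) = UNIV"
    using assms(2) unfolding semisimple_def by auto
  have "\<Union>\<J> \<subseteq> span (range (\<lambda>(x, y). b x y))" using simple_ideal_span[OF b J(1)] by blast
  then have "span (\<Union>\<J>) \<subseteq> span (range (\<lambda>(x, y). b x y))" by (rule span_minimal[OF _ subspace_span])
  then show ?thesis using J(2) by auto
qed

text \<open>With \<open>l = h(t, -)\<close> this covers \<open>\<Pi>\<close>, its restriction to a subgroup, and, for \<open>q = 0\<close> and
  vanishing bracket, the tensor of an abelian subgroup.\<close>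

definition Pi_form ::
  "('e::real_vector \<Rightarrow> 'e \<Rightarrow> 'e) \<Rightarrow> ('e \<Rightarrow> real) \<Rightarrow> ('e \<Rightarrow> 'e \<Rightarrow> real) \<Rightarrow> 'e \<Rightarrow> 'e \<Rightarrow> 'e \<Rightarrow> 'e" where
  "Pi_form b l q t r s = - (l r * l s) *\<^sub>R t + l r *\<^sub>R s + l s *\<^sub>R r
    + (1/2 * l r) *\<^sub>R b t s + (1/2 * l s) *\<^sub>R b t r + q r s *\<^sub>R t"

text \<open>\<open>l t = 1\<close> and \<open>q t r = 0\<close> give \<open>A r t = r\<close>. The
  conditions on \<open>b t\<close> keep a vector that is moved by \<open>Ad(exp(- u t))\<close> in
  the kernel of \<open>l\<close>, with a constant value of \<open>q\<close>.\<close>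

definition (in lie_group) radiant_data :: "('e \<Rightarrow> real) \<Rightarrow> ('e \<Rightarrow> 'e \<Rightarrow> real) \<Rightarrow> 'e \<Rightarrow> bool" where
  "radiant_data l q t \<longleftrightarrow> linear l \<and> l t = 1 \<and> (\<forall>r. l (b t r) = 0) \<and> bilinear q \<and> (\<forall>r s. q r s = q s r) \<and>
    (\<forall>r. q t r = 0) \<and> (\<forall>r s. q (b t r) s + q r (b t s) = 0)"

lemma Pi_form_bilinear:
  assumes "bilinear b" "linear l" "bilinear q"
  shows "bilinear (Pi_form b l q t)"
  unfolding bilinear_def Pi_form_def[abs_def]
  by (auto intro!: linearI simp: linear_add[OF assms(2)] linear_scale[OF assms(2)] bilinear_radd[OF assms(1)] bilinear_rmul[OF assms(1)]
      bilinear_ladd[OF assms(3)] bilinear_lmul[OF assms(3)] bilinear_radd[OF assms(3)] bilinear_rmul[OF assms(3)] algebra_simps add_divide_distrib)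

context lie_group
begin

context
  fixes l q t
  assumes d: "radiant_data l q t"
begin

abbreviation "A r s \<equiv> Pi_form b l q t r s + (1/2) *\<^sub>R b r s"

lemma radiant_dataD:
  "linear l" "l t = 1" "l (b t r) = 0" "bilinear q" "q r s = q s r" "q t r = 0" "q (b t r) s + q r (b t s) = 0"
  using d by (auto simp: radiant_data_def)

lemma radiant_dataD': "q r t = 0" using radiant_dataD(5,6) by metis

lemma Pi_bilinear: "bilinear (Pi_form b l q t)"
  by (rule Pi_form_bilinear[OF br_bilinear radiant_dataD(1,4)])

lemma A_bilinear: "bilinear (\<lambda>r s. A r s)"
  using Pi_bilinear br_bilinear unfolding bilinear_def by (auto intro!: linear_compose_add linear_compose_scale_right)

text \<open>The half bracket with \<open>t\<close> in \<open>Pi_form\<close> and the half bracket in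
  \<open>A\<close> cancel in one order of the arguments and add up in the other.\<close>

lemma A_t: "A r t = r" "A t r = r + b t r"
proof -
  show "A r t = r"
    using br_antisym[of t r] by (simp add: Pi_form_def radiant_dataD radiant_dataD' br_self)
  have "A t r = r + ((1/2) *\<^sub>R b t r + (1/2) *\<^sub>R b t r)"
    by (simp add: Pi_form_def radiant_dataD radiant_dataD' br_self)
  then show "A t r = r + b t r" by (simp flip: scaleR_left_distrib)
qed

lemma A_torsion: "A r s - A s r = b r s"
proof -
  have "Pi_form b l q t r s = Pi_form b l q t s r"
    by (simp add: Pi_form_def radiant_dataD(5)[of r s] algebra_simps)
  then have "A r s - A s r = (1/2) *\<^sub>R b r s + (1/2) *\<^sub>R b r s"
    using br_antisym[of s r] by simp
  then show ?thesis by (simp flip: scaleR_left_distrib)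
qed

lemma Pi_form_conn:
  assumes D: "P.frame_conn (\<lambda>r s. A r s) D"
  shows "left_invariant_radiant_structure G M D (E t)" "complete_set_of_planes M D (E t)"
proof -
  show "left_invariant_radiant_structure G M D (E t)"
    unfolding left_invariant_radiant_structure_def
    using P.frame_conn_radiant[OF A_bilinear D A_torsion A_t(1)] frame_conn_left_invariant[OF D] E_left_invariant by blast
  show "complete_set_of_planes M D (E t)"
    by (rule complete_set_of_planesI[OF A_bilinear D A_t radiant_dataD(1,2,3,4) _ radiant_dataD(7)])
      (simp add: Pi_form_def br_self)
qed

context
  fixes f :: "'e \<Rightarrow> 'e" assumes f: "linear f"
begin

lemma lin_f: "linear (\<lambda>x. l (f x))" "linear (\<lambda>x. q (f x) a)" "linear (\<lambda>x. q a (f x))"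
  using linear_compose[OF f radiant_dataD(1)] linear_compose[OF f, of "\<lambda>x. q x a"] linear_compose[OF f, of "q a"] radiant_dataD(4)
  by (simp_all add: comp_def bilinear_def)

text \<open>An inner linear map \<open>f\<close> is allowed because the Ricci trace needs both the
  identity and a bracket in its place. The summands are of rank one except for the multiple of
  \<open>f x\<close> and the brackets containing \<open>f x\<close>.\<close>

lemma tr_A_left: "tr (\<lambda>x. A (f x) a) = - (l (f t) * l a) + l (f a) + l a * tr f + 1/2 * l (f (b t a))
    + 1/2 * l a * tr (\<lambda>x. b t (f x)) + q (f t) a + 1/2 * tr (\<lambda>x. b (f x) a)"
proof -
  have 1: "tr (\<lambda>x. - (l (f x) * l a) *\<^sub>R t) = - (l (f t) * l a)"
    using tr_rank_one[OF lin_f(1), of "l a *\<^sub>R t"] linear_scale[OF f] linear_scale[OF radiant_dataD(1)]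
    by (simp add: tr_minus mult.commute)
  have 2: "tr (\<lambda>x. (1/2 * l (f x)) *\<^sub>R b t a) = 1/2 * l (f (b t a))"
    using tr_scale[of "1/2" "\<lambda>x. l (f x) *\<^sub>R b t a"] by (simp add: tr_rank_one[OF lin_f(1)])
  show ?thesis
    unfolding Pi_form_def tr_add 1 2 tr_scale tr_rank_one[OF lin_f(1)] tr_rank_one[OF lin_f(2)] by simp
qed

lemma tr_A_right: "tr (\<lambda>x. A a (f x)) = - (l a * l (f t)) + l a * tr f + l (f a) + 1/2 * l a * tr (\<lambda>x. b t (f x))
    + 1/2 * l (f (b t a)) + q a (f t) + 1/2 * tr (\<lambda>x. b a (f x))"
proof -
  have 1: "tr (\<lambda>x. - (l a * l (f x)) *\<^sub>R t) = - (l a * l (f t))"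
    using tr_rank_one[OF lin_f(1), of "l a *\<^sub>R t"] linear_scale[OF f] linear_scale[OF radiant_dataD(1)]
    by (simp add: tr_minus mult.commute)
  have 2: "tr (\<lambda>x. (1/2 * l (f x)) *\<^sub>R b t a) = 1/2 * l (f (b t a))"
    using tr_scale[of "1/2" "\<lambda>x. l (f x) *\<^sub>R b t a"] by (simp add: tr_rank_one[OF lin_f(1)])
  show ?thesis
    unfolding Pi_form_def tr_add 1 2 tr_scale tr_rank_one[OF lin_f(1)] tr_rank_one[OF lin_f(3)] by simp
qed

end

end

section \<open>Traces of brackets and the Killing form\<close>

abbreviation (input) "tr_ad \<equiv> ell G M"
abbreviation (input) "B \<equiv> Killing G M"

lemma br_linear: "linear (b r)" "linear (\<lambda>x. b x r)"
  using br_bilinear by (simp_all add: bilinear_def)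

lemma br_br_linear: "linear (\<lambda>x. b r (b s x))"
  using linear_compose[OF br_linear(1) br_linear(1)] by (simp add: comp_def)

lemma ell_linear: "linear tr_ad"
proof (rule linearI)
  have "b (r + s) = (\<lambda>x. b r x + b s x)" for r s by (rule ext) (rule bilinear_ladd[OF br_bilinear])
  then show "tr_ad (r + s) = tr_ad r + tr_ad s" for r s by (simp add: ell_def tr_add)
  have "b (c *\<^sub>R r) = (\<lambda>x. c *\<^sub>R b r x)" for c r by (rule ext) (rule bilinear_lmul[OF br_bilinear])
  then show "tr_ad (c *\<^sub>R r) = c *\<^sub>R tr_ad r" for c r by (simp add: ell_def tr_scale)
qed

lemma ell_br: "tr_ad (b r s) = 0"
proof -
  have "b (b r s) = (\<lambda>x. b r (b s x) - b s (b r x))"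
    by (rule ext) (use br_jacobi[of r s] in simp)
  then have "tr_ad (b r s) = tr (\<lambda>x. b r (b s x)) - tr (\<lambda>x. b s (b r x))"
    by (simp add: ell_def tr_diff)
  then show ?thesis using tr_commute[OF br_linear(1) br_linear(1)] by simp
qed

lemma Killing_sym: "B r s = B s r"
  unfolding Killing_def by (rule tr_commute[OF br_linear(1) br_linear(1)])

lemma Killing_bilinear: "bilinear B"
proof -
  have "linear (\<lambda>r. B r s)" for s
    by (rule linearI) (simp_all add: Killing_def bilinear_ladd[OF br_bilinear] bilinear_lmul[OF br_bilinear] tr_add tr_scale)
  moreover have "B r = (\<lambda>s. B s r)" for r by (rule ext) (rule Killing_sym)
  ultimately show ?thesis unfolding bilinear_def by (metis (no_types, lifting))
qed

text \<open>After expansion by the Jacobi identity one pair of traces cancels outright and the other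
  by cyclicity.\<close>

lemma Killing_invariant: "B (b a r) s + B r (b a s) = 0"
proof -
  have *: "b (b x y) z = b x (b y z) - b y (b x z)" for x y z using br_jacobi[of x y z] by simp
  have "B (b a r) s = tr (\<lambda>x. b a (b r (b s x))) - tr (\<lambda>x. b r (b a (b s x)))"
    by (simp add: Killing_def * tr_diff)
  moreover have "B r (b a s) = tr (\<lambda>x. b r (b a (b s x))) - tr (\<lambda>x. b r (b s (b a x)))"
    by (simp add: Killing_def * tr_diff bilinear_rsub[OF br_bilinear])
  moreover have "tr (\<lambda>x. b a (b r (b s x))) = tr (\<lambda>x. b r (b s (b a x)))"
    by (rule tr_commute[OF br_linear(1) br_br_linear])
  ultimately show ?thesis by simp
qed

text \<open>Conjugation by the automorphism \<open>Ad\<close> of the bracket preserves traces. This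
  works for every \<open>g\<close> in the group, whereas for \<open>k\<close> the infinitesimal
  condition reaches only the identity component.\<close>

lemma Killing_Ad:
  assumes g: "g \<in> carrier G"
  shows "B (Ad G M g r) (Ad G M g s) = B r s"
proof -
  have "b (Ad G M g r) (b (Ad G M g s) x) = Ad G M g (b r (b s (Ad G M (inv g) x)))" for x
    by (simp add: Ad_br[OF g] Ad_inv[OF g])
  then have "B (Ad G M g r) (Ad G M g s) = tr (\<lambda>x. Ad G M g (b r (b s (Ad G M (inv g) x))))"
    by (simp add: Killing_def)
  also have "\<dots> = tr (\<lambda>x. b r (b s (Ad G M (inv g) (Ad G M g x))))"
    by (rule tr_commute[OF Ad_linear[OF g]])
      (use linear_compose[OF Ad_linear[of "inv g"] br_br_linear] g in \<open>simp add: comp_def\<close>)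
  finally show ?thesis by (simp add: Ad_inv[OF g] Killing_def)
qed

lemma tr_br_left: "tr (\<lambda>x. b x r) = - tr_ad r"
  using br_antisym[of _ r] tr_minus[of "b r"] by (simp add: ell_def)

lemma tr_br_br: "tr (\<lambda>x. b r (b x s)) = - B r s" "tr (\<lambda>x. b (b x r) s) = B s r"
proof -
  have "b r (b x s) = - b r (b s x)" for x using br_antisym[of x s] by (simp add: bilinear_rneg[OF br_bilinear])
  then show "tr (\<lambda>x. b r (b x s)) = - B r s" by (simp add: Killing_def tr_minus)
  have "b (b x r) s = b s (b r x)" for x
    using br_antisym[of "b x r" s] br_antisym[of x r] by (simp add: bilinear_rneg[OF br_bilinear])
  then show "tr (\<lambda>x. b (b x r) s) = B s r" by (simp add: Killing_def)
qed

end

section \<open>The tensor of an invariant form and its Ricci trace\<close>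

locale invariant_lie_group = lie_group G M
  for G :: "'a monoid" (structure) and M :: "('a, 'e::euclidean_space) atlas" +
  fixes k :: "'e \<Rightarrow> 'e \<Rightarrow> real" and t :: 'e
  assumes k_sym: "symmetric_form k" and k_inv: "invariant_form G M k" and k_t: "k t t \<noteq> 0"
begin

definition "h = normalized k t"
definition "l = h t"
text \<open>The four Killing terms together are the Killing form of \<open>r - l(r) t\<close> and
  \<open>s - l(s) t\<close>, the components in the kernel of \<open>l\<close>. As
  \<open>b t t = 0\<close> too, \<open>q\<close> vanishes when one argument is
  \<open>t\<close>.\<close>

definition q where
  "q r s = 1 / (4 * (real DIM('e) - 2)) * (Killing G M r s + Killing G M t t * l r * l s
    - Killing G M t r * l s - Killing G M t s * l r - 2 * h (b t r) (b t s))"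

lemma Pi_tensor_eq: "Pi_tensor G M k t = Pi_form b l q t"
  by (intro ext) (simp add: Pi_tensor_def Pi_form_def Let_def q_def l_def h_def)

lemma h_bilinear: "bilinear h"
  unfolding bilinear_def h_def normalized_def[abs_def]
  using k_sym unfolding symmetric_form_def bilinear_def
  by (auto intro!: linearI simp: linear_add linear_scale algebra_simps)

lemma h_sym: "h r s = h s r"
  using k_sym by (simp add: h_def normalized_def symmetric_form_def)

lemma h_inv: "h (b a r) s = - h r (b a s)"
proof -
  have "k (b a r) s = - k r (b a s)" using k_inv by (simp add: invariant_form_def eq_neg_iff_add_eq_0)
  then show ?thesis by (simp add: h_def normalized_def)
qed

lemma l_linear: "linear l" using h_bilinear by (simp add: l_def bilinear_def)

lemma l_t: "l t = 1" using k_t by (simp add: l_def h_def normalized_def)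

lemma l_br_t: "l (b t r) = 0"
proof -
  have "h t (b t r) = - h (b t t) r" by (simp add: h_inv)
  also have "h (b t t) r = 0" by (simp add: br_self bilinear_lzero[OF h_bilinear])
  finally show ?thesis by (simp add: l_def)
qed

text \<open>Invariance of \<open>h\<close> is applied twice to move brackets across. The result is
  symmetric in \<open>r\<close> and \<open>s\<close>, so it belongs to the symmetric part of the
  Ricci trace; this is the origin of the last summand of \<open>q\<close>.\<close>

lemma l_br: "l (b (b t s) r) = - h (b t r) (b t s)"
proof -
  have "l (b (b t s) r) = - h (b (b t s) t) r" unfolding l_def h_inv by simp
  also have "b (b t s) t = - b t (b t s)" by (rule br_antisym)
  also have "- h (- b t (b t s)) r = h (b t (b t s)) r" by (simp add: bilinear_lneg[OF h_bilinear])
  also have "\<dots> = - h (b t r) (b t s)" using h_inv[of t "b t s" r] h_sym[of "b t s" "b t r"] by simp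
  finally show ?thesis .
qed

text \<open>Invariance of \<open>q\<close> under \<open>b t\<close> holds term by term: the Killing
  form and \<open>h\<close> are invariant, while \<open>l\<close> and the Killing form with
  \<open>t\<close> vanish on the image of \<open>b t\<close>.\<close>

lemma radiant_data: "radiant_data l q t"
  unfolding radiant_data_def
proof (intro conjI allI l_linear l_t l_br_t)
  let ?B = "Killing G M"
  note K = Killing_bilinear
  note lin = bilinear_ladd[OF K] bilinear_radd[OF K] bilinear_lmul[OF K] bilinear_rmul[OF K]
    bilinear_ladd[OF h_bilinear] bilinear_radd[OF h_bilinear] bilinear_lmul[OF h_bilinear] bilinear_rmul[OF h_bilinear]
    bilinear_radd[OF br_bilinear] bilinear_rmul[OF br_bilinear] linear_add[OF l_linear] linear_scale[OF l_linear]
  show "bilinear q"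
    unfolding bilinear_def q_def[abs_def]
    by (auto intro!: linearI simp: lin algebra_simps simp flip: add_divide_distrib diff_divide_distrib)
  show "q r s = q s r" for r s
    by (simp add: q_def Killing_sym[of r s] h_sym[of "b t r"] algebra_simps)
  show "q t r = 0" for r
    by (simp add: q_def l_t br_self bilinear_lzero[OF h_bilinear])
  show "q (b t r) s + q r (b t s) = 0" for r s
  proof -
    have Bt: "?B t (b t x) = 0" for x
      using Killing_invariant[of t t x] by (simp add: br_self bilinear_lzero[OF K])
    have "?B (b t r) s = - ?B r (b t s)" using Killing_invariant[of t r s] by simp
    moreover have "h (b t (b t r)) (b t s) = - h (b t r) (b t (b t s))" by (rule h_inv)
    ultimately show ?thesis by (simp add: q_def l_br_t Bt algebra_simps)
  qed
qed

text \<open>The coefficient \<open>n - 2\<close> of \<open>q\<close> comes about as \<open>n\<close>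
  from the first trace, through \<open>tr (\<lambda>x. A x a)\<close> at the value
  \<open>a = A r s\<close>, minus 1 for each of two rank one terms in the second trace. The products
  of \<open>q\<close> with \<open>ell t\<close> cancel within the first trace.\<close>

lemma ricci_trace:
  assumes n: "DIM('e) > 2"
  shows "tr (\<lambda>x. A l q t x (A l q t r s) - A l q t r (A l q t x s) - A l q t (b x r) s)
    = (2 * real DIM('e) + ell G M t) / 4 * l (b r s)"
proof -
  let ?n = "real DIM('e)" and ?A = "A l q t" and ?B = "Killing G M" and ?e = "ell G M"
  note d = radiant_data
  note radiant_dataD = radiant_dataD[OF d] and radiant_dataD' = radiant_dataD'[OF d]
  have qt: "q r (b t s) = - q (b t r) s" using radiant_dataD(7)[of r s] by simp
  have T: "linear (b t)" by (rule br_linear)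
  have ltT: "l (b r (b t s)) = - l (b (b t r) s)"
    using br_jacobi[of t r s] l_br_t[of "b r s"] by (simp add: linear_add[OF l_linear])
  have lts: "l (b (b t r) s) = - h (b t r) (b t s)"
    using l_br[of r s] h_sym by metis
  have lA: "l (?A r s) = l r * l s + q r s + 1/2 * l (b r s)" for r s
    by (simp add: Pi_form_def linear_add[OF l_linear] linear_diff[OF l_linear] linear_scale[OF l_linear] linear_neg[OF l_linear] l_t l_br_t)
  have eA: "?e (?A r s) = - l r * l s * ?e t + l r * ?e s + l s * ?e r + q r s * ?e t"
    by (simp add: Pi_form_def linear_add[OF ell_linear] linear_diff[OF ell_linear] linear_scale[OF ell_linear] linear_neg[OF ell_linear] ell_br)
  have t1: "tr (\<lambda>x. ?A x a) = (?n + 1/2 * ?e t) * l a - 1/2 * ?e a" for a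
    unfolding tr_A_left[OF d linear_ident]
    by (simp add: l_t l_br_t radiant_dataD(6) tr_ident tr_br_left ell_def[symmetric] algebra_simps)
  have tL: "tr (\<lambda>x. ?A r x) = (?n + 1/2 * ?e t) * l r + 1/2 * ?e r"
    unfolding tr_A_right[OF d linear_ident]
    by (simp add: l_t l_br_t radiant_dataD' tr_ident ell_def[symmetric] algebra_simps)
  have tT: "tr (\<lambda>x. ?A r (b t x)) = l r * ?e t + 1/2 * l r * ?B t t + 1/2 * ?B r t"
    unfolding tr_A_right[OF d T]
    by (simp add: l_br_t br_self linear_0[OF l_linear] bilinear_rzero[OF radiant_dataD(4)] ell_def[symmetric] Killing_def[symmetric])
  have tb: "tr (\<lambda>x. ?A r (b x s)) = - l r * ?e s + l (b r s) - 1/2 * l r * ?B t s + 1/2 * l (b (b t r) s)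
      + q r (b t s) - 1/2 * ?B r s"
    unfolding tr_A_right[OF d br_linear(2)]
    by (simp add: l_br_t tr_br_left tr_br_br)
  have t3: "tr (\<lambda>x. ?A (b x r) s) = l (b s r) - l s * ?e r + 1/2 * l (b (b t s) r) - 1/2 * l s * ?B t r
      + q (b t r) s + 1/2 * ?B s r"
    unfolding tr_A_left[OF d br_linear(2)]
    by (simp add: l_br_t tr_br_left tr_br_br)
  note Abil = A_bilinear[OF d]
  \<comment> \<open>Only the inner \<open>A\<close> is expanded, so that the trace over
    \<open>x\<close> splits into rank one terms and traces of the outer \<open>A r\<close> applied
    to \<open>x\<close>, \<open>b t x\<close> and \<open>b x s\<close>.\<close>
  have Ax: "?A r (?A x s) = - ((l x * l s) *\<^sub>R r) + l x *\<^sub>R ?A r s + l s *\<^sub>R ?A r x + (1/2) *\<^sub>R (l x *\<^sub>R ?A r (b t s))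
      + (1/2 * l s) *\<^sub>R ?A r (b t x) + q x s *\<^sub>R r + (1/2) *\<^sub>R ?A r (b x s)" for x
  proof -
    have "?A x s = - (l x * l s) *\<^sub>R t + l x *\<^sub>R s + l s *\<^sub>R x + (1/2 * l x) *\<^sub>R b t s + (1/2 * l s) *\<^sub>R b t x + q x s *\<^sub>R t
        + (1/2) *\<^sub>R b x s" by (simp add: Pi_form_def)
    then have "?A r (?A x s) = ?A r (- (l x * l s) *\<^sub>R t + l x *\<^sub>R s + l s *\<^sub>R x + (1/2 * l x) *\<^sub>R b t s + (1/2 * l s) *\<^sub>R b t x + q x s *\<^sub>R t
        + (1/2) *\<^sub>R b x s)" by (rule arg_cong)
    also have "\<dots> = - (l x * l s) *\<^sub>R ?A r t + l x *\<^sub>R ?A r s + l s *\<^sub>R ?A r x + (1/2 * l x) *\<^sub>R ?A r (b t s)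
        + (1/2 * l s) *\<^sub>R ?A r (b t x) + q x s *\<^sub>R ?A r t + (1/2) *\<^sub>R ?A r (b x s)"
      by (simp only: bilinear_radd[OF Abil] bilinear_rmul[OF Abil])
    finally show ?thesis unfolding A_t(1)[OF d] by simp
  qed
  have r1: "tr (\<lambda>x. (l x * l s) *\<^sub>R r) = l r * l s"
    using tr_rank_one[OF l_linear, of "l s *\<^sub>R r"] by (simp add: linear_scale[OF l_linear] mult.commute)
  have lq: "linear (\<lambda>x. q x s)" using radiant_dataD(4) by (simp add: bilinear_def)
  have t2: "tr (\<lambda>x. ?A r (?A x s)) = - (l r * l s) + l (?A r s) + l s * tr (\<lambda>x. ?A r x) + 1/2 * l (?A r (b t s))
      + 1/2 * l s * tr (\<lambda>x. ?A r (b t x)) + q r s + 1/2 * tr (\<lambda>x. ?A r (b x s))"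
    unfolding Ax tr_add tr_minus tr_scale r1 tr_rank_one[OF l_linear] tr_rank_one[OF lq] ..
  have bsr: "l (b s r) = - l (b r s)"
    using br_antisym[of s r] by (simp add: linear_neg[OF l_linear])
  have hh: "l (b (b t s) r) = - h (b t r) (b t s)" by (rule l_br)
  \<comment> \<open>The division by \<open>n - 2\<close> is undone here; for \<open>n = 2\<close>
    the factor in \<open>q\<close> would be the default value 0 and the equation could fail.\<close>
  have qq: "4 * (?n - 2) * q r s = ?B r s + ?B t t * l r * l s - ?B t r * l s - ?B t s * l r - 2 * h (b t r) (b t s)"
    using n by (simp add: q_def)
  \<comment> \<open>The sum splits into the antisymmetric part that is claimed and the defect of the
    equation \<open>qq\<close>, which is zero.\<close>
  have sum: "4 * (tr (\<lambda>x. ?A x (?A r s)) - tr (\<lambda>x. ?A r (?A x s)) - tr (\<lambda>x. ?A (b x r) s))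
      = (2 * ?n + ?e t) * l (b r s) + (4 * (?n - 2) * q r s
      - (?B r s + ?B t t * l r * l s - ?B t r * l s - ?B t s * l r - 2 * h (b t r) (b t s)))"
    unfolding t1 t2 t3 tL tT tb lA eA ltT lts bsr hh qt l_br_t Killing_sym[of s r] Killing_sym[of r t]
    by (simp add: algebra_simps)
  have "tr (\<lambda>x. ?A x (?A r s) - ?A r (?A x s) - ?A (b x r) s) =
      tr (\<lambda>x. ?A x (?A r s)) - tr (\<lambda>x. ?A r (?A x s)) - tr (\<lambda>x. ?A (b x r) s)"
    unfolding tr_diff ..
  then show ?thesis using sum qq by simp
qed

text \<open>All ingredients of the tensor are equivariant under \<open>Ad g\<close>: the bracket and
  the Killing form for every \<open>g\<close>, the form \<open>k\<close> by the hypothesis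
  \<open>kg\<close>.\<close>

lemma Pi_tensor_Ad:
  assumes g: "g \<in> carrier G" and kg: "\<And>r s. k (Ad G M g r) (Ad G M g s) = k r s"
  defines "t' \<equiv> Ad G M (inv g) t"
  shows "k t' t' = k t t"
    and "Pi_tensor G M k t' r s = Ad G M (inv g) (Pi_tensor G M k t (Ad G M g r) (Ad G M g s))"
proof -
  have t: "Ad G M g t' = t" by (simp add: t'_def Ad_inv[OF g])
  show kt: "k t' t' = k t t" using kg[of t' t'] by (simp add: t)
  let ?r = "Ad G M g r" and ?s = "Ad G M g s" and ?i = "Ad G M (inv g)"
  have gi: "inv g \<in> carrier G" using g by simp
  have h': "normalized k t' x y = h (Ad G M g x) (Ad G M g y)" for x y
    by (simp add: h_def normalized_def kt kg)
  have B': "Killing G M t' x = Killing G M t (Ad G M g x)" "Killing G M r s = Killing G M ?r ?s" for x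
    using Killing_Ad[OF g, of t' x] by (simp_all add: Killing_Ad[OF g] t)
  have b': "b t' x = ?i (b t (Ad G M g x))" for x
    by (simp add: Ad_br[OF gi] Ad_inv[OF g] t'_def)
  show "Pi_tensor G M k t' r s = ?i (Pi_tensor G M k t ?r ?s)"
    unfolding Pi_tensor_def Let_def h' B' b' h_def[symmetric]
    by (simp add: linear_add[OF Ad_linear[OF gi]] linear_diff[OF Ad_linear[OF gi]] linear_scale[OF Ad_linear[OF gi]] linear_neg[OF Ad_linear[OF gi]] t Ad_inv[OF g])
      (simp add: t'_def)
qed

end

section \<open>Subgroups\<close>

context parallelism
begin

lemma totally_geodesic_transfer:
  fixes S :: "('s, 'f::euclidean_space) atlas"
  assumes D1: "frame_conn A1 D1" and D2: "frame_conn A2 D2" and A: "\<And>r s. A2 r s = A1 r s + Q r s *\<^sub>R t"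
    and S: "smooth_atlas S" and f: "smooth_map S M f" and E: "\<And>s. s \<in> points S \<Longrightarrow> E t (f s) \<in> range (tmap S M f s)"
    and geo: "totally_geodesic S M D1 f"
  shows "totally_geodesic S M D2 f"
  unfolding totally_geodesic_def
proof (intro allI impI ballI)
  fix W Y s v assume Y: "vector_field_on S W Y" and s: "s \<in> W"
  have sS: "s \<in> points S" using openin_mtop_subset[OF S vector_field_onD[OF S Y]] s by auto
  have fs: "f s \<in> points M" by (rule smooth_map_points[OF f sS])
  let ?c = "chart_at M (f s)" and ?V = "\<lambda>\<sigma>. tmap S M f \<sigma> (Y \<sigma>)" and ?w = "tmap S M f s v"
  have c: "?c \<in> M" "f s \<in> fst ?c" using chart_at[OF fs] by auto
  note F = vector_field_on_coord_field[OF atlas c(1), of "?V s"]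
  have sub: "subspace (range (tmap S M f s))"
    by (rule linear_subspace_image[OF tmap_linear[OF S atlas f sS] subspace_UNIV])
  obtain a where "D2 (f s) ?w (coord_field M ?c (?V s)) = D1 (f s) ?w (coord_field M ?c (?V s)) + a *\<^sub>R E t (f s)"
    by (rule that[of "Q (\<theta> (f s) ?w) (\<theta> (f s) (coord_field M ?c (?V s) (f s)))"])
      (simp add: frame_connD[OF D1 F c(2)] frame_connD[OF D2 F c(2)] A linear_add[OF E_linear[OF fs]] linear_scale[OF E_linear[OF fs]])
  \<comment> \<open>The other summand of \<open>cov_along\<close> differentiates components in a
    chart and does not involve the connection.\<close>
  then have "cov_along S M D2 f s v ?V = cov_along S M D1 f s v ?V + a *\<^sub>R E t (f s)"
    by (simp add: cov_along_def Let_def)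
  moreover have "cov_along S M D1 f s v ?V \<in> range (tmap S M f s)"
    using geo Y s unfolding totally_geodesic_def by blast
  ultimately show "cov_along S M D2 f s v ?V \<in> range (tmap S M f s)"
    using E[OF sS] sub by (simp add: subspace_add subspace_scale)
qed

lemma planelike_surface_transfer:
  assumes "frame_conn A1 D1" and "frame_conn A2 D2" and "\<And>r s. A2 r s = A1 r s + Q r s *\<^sub>R t"
  shows "planelike_surface M D1 (E t) S f \<longleftrightarrow> planelike_surface M D2 (E t) S f"
proof -
  have "A1 r s = A2 r s + (- Q r s) *\<^sub>R t" for r s by (simp add: assms(3))
  then show ?thesis
    using totally_geodesic_transfer[OF assms] totally_geodesic_transfer[OF assms(2,1), of "\<lambda>r s. - Q r s"]
    unfolding planelike_surface_def manifold_def immersion_def by blast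
qed

end

section \<open>The inclusion of a Lie subgroup\<close>

locale lie_subgroup = lie_group G M
  for G :: "'a monoid" (structure) and M :: "('a, 'e::euclidean_space) atlas" +
  fixes H :: "'a set" and N :: "('a, 'f::euclidean_space) atlas"
  assumes sub: "Lie_subgroup G M H N"
begin

abbreviation "GH \<equiv> G\<lparr>carrier := H\<rparr>"
abbreviation \<iota> where "\<iota> \<equiv> incl G M N"

sublocale H: lie_group GH N
  by unfold_locales (use sub in \<open>simp add: Lie_subgroup_def\<close>)

lemma H_subset: "H \<subseteq> carrier G"
  using sub subgroup.subset by (auto simp: Lie_subgroup_def)

lemma N_points: "points N = H"
  using H.points by simp

lemma incl_immersion: "immersion N M (\<lambda>x. x)"
  using sub by (simp add: Lie_subgroup_def)

lemma incl_smooth: "smooth_map N M (\<lambda>x. x)"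
  using incl_immersion by (simp add: immersion_def)

lemma H_one: "\<one> \<in> points N"
  using H.one_point by simp

lemma incl_linear: "linear \<iota>"
  unfolding incl_def by (rule tmap_linear[OF H.atlas atlas incl_smooth H_one])

text \<open>The left translation by \<open>p\<close> is the same function for \<open>H\<close> and
  for \<open>G\<close>, so it commutes with the inclusion.\<close>

lemma tmap_incl_E:
  assumes p: "p \<in> H"
  shows "tmap N M (\<lambda>x. x) p (H.E a p) = E (\<iota> a) p"
proof -
  have pG: "p \<in> carrier G" using p H_subset by auto
  have pH: "p \<in> carrier GH" using p by simp
  have "tmap N M (\<lambda>x. x) (ltrans GH p \<one>) (tmap N N (ltrans GH p) \<one> a) = tmap N M (ltrans GH p) \<one> a"
    by (rule tmap_compose[OF H.atlas H.atlas atlas H.ltrans_smooth[OF pH] incl_smooth H_one, symmetric])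
  also have e: "ltrans GH p = ltrans G p" by (simp add: ltrans_def fun_eq_iff)
  also have "tmap N M (ltrans G p) \<one> a = tmap M M (ltrans G p) \<one> (tmap N M (\<lambda>x. x) \<one> a)"
    by (rule tmap_compose[OF H.atlas atlas atlas incl_smooth ltrans_smooth[OF pG] H_one])
  finally show ?thesis using pG by (simp add: linv_field_def incl_def e ltrans_def[of G p \<one>])
qed

lemma theta_incl:
  assumes p: "p \<in> H"
  shows "\<theta> p (tmap N M (\<lambda>x. x) p v) = \<iota> (H.\<theta> p v)"
proof -
  have "p \<in> carrier G" "p \<in> carrier GH" using p H_subset by auto
  then show ?thesis using tmap_incl_E[OF p, of "H.\<theta> p v"] theta_E H.E_theta by metis
qed

lemma incl_br: "\<iota> (br GH N a c) = b (\<iota> a) (\<iota> c)"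
proof -
  have "tmap N M (\<lambda>x. x) \<one> (lie_bracket N (H.E a) (H.E c) \<one>) = lie_bracket M (E (\<iota> a)) (E (\<iota> c)) \<one>"
    by (rule tmap_lie_bracket[OF H.atlas atlas incl_smooth H.E_smooth H.E_smooth E_smooth E_smooth _ tmap_incl_E tmap_incl_E H_one])
      (use H_subset N_points in \<open>auto simp: points\<close>)
  then show ?thesis by (simp add: br_def incl_def)
qed

text \<open>In the two left-invariant frames the inclusion has the constant matrix
  \<open>\<iota>\<close>, so the derivative term in the criterion for immersions vanishes and the
  compatibility of \<open>T\<close> with \<open>TN\<close> remains.\<close>

lemma frame_conn_induced:
  assumes D: "P.frame_conn T D" and T: "\<And>a c. T (\<iota> a) (\<iota> c) = \<iota> (TN a c)"
  shows "totally_geodesic N M D (\<lambda>x. x)" "H.P.frame_conn TN (induced_conn N M D (\<lambda>x. x))"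
proof -
  have J: "vsmooth_on N (points N) (\<lambda>s. \<iota> r)" for r
    by (rule vsmooth_on_const[OF H.atlas openin_points[OF H.atlas]])
  note imm = P.frame_conn_immersion[OF D H.P.parallelism_axioms incl_smooth, where J = "\<lambda>s. \<iota>" and AS = TN]
  show "totally_geodesic N M D (\<lambda>x. x)"
    by (rule imm(1)) (simp_all add: J[unfolded N_points] incl_linear theta_incl N_points T dfun_const[OF H.atlas])
  show "H.P.frame_conn TN (induced_conn N M D (\<lambda>x. x))"
    by (rule imm(2)) (simp_all add: J[unfolded N_points] incl_linear theta_incl N_points T dfun_const[OF H.atlas] incl_immersion)
qed

end

section \<open>Induced structures on subgroups\<close>

context invariant_lie_group
begin

context
  fixes H :: "'a set" and N :: "('a, 'f::euclidean_space) atlas" and \<tau>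
  assumes sub: "Lie_subgroup G M H N" and \<tau>: "incl G M N \<tau> = t"
begin

interpretation S: lie_subgroup G M H N by unfold_locales (rule sub)

abbreviation (input) "lH \<equiv> \<lambda>a. l (incl G M N a)"
abbreviation (input) "qH \<equiv> \<lambda>a c. q (incl G M N a) (incl G M N c)"

text \<open>The first instance belongs to the induced connection, the second, with zero form, to the
  tensor \<open>Pi_abelian\<close> on an abelian subgroup.\<close>

lemma subgroup_radiant_data: "S.H.radiant_data lH qH \<tau>" "S.H.radiant_data lH (\<lambda>a c. 0) \<tau>"
proof -
  note d = radiant_dataD[OF radiant_data]
  have "linear (\<lambda>c. qH a c)" "linear (\<lambda>c. qH c a)" for a
    using linear_compose[OF S.incl_linear, of "q (S.\<iota> a)"] linear_compose[OF S.incl_linear, of "\<lambda>x. q x (S.\<iota> a)"] d(4)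
    by (simp_all add: bilinear_def comp_def)
  then have q: "bilinear qH" by (simp add: bilinear_def)
  have l: "linear lH" using linear_compose[OF S.incl_linear l_linear] by (simp add: comp_def)
  show "S.H.radiant_data lH qH \<tau>"
    unfolding S.H.radiant_data_def S.incl_br \<tau>
    by (intro conjI allI l q d(2,3,6,7)) (rule d(5))
  show "S.H.radiant_data lH (\<lambda>a c. 0) \<tau>"
    unfolding S.H.radiant_data_def S.incl_br \<tau>
    by (simp add: l d(2,3) bilinear_def linear_zero)
qed

abbreviation (input) "AH \<equiv> \<lambda>a c. Pi_form (br (G\<lparr>carrier := H\<rparr>) N) lH qH \<tau> a c + (1/2) *\<^sub>R br (G\<lparr>carrier := H\<rparr>) N a c"

lemma incl_A: "Pi_form b l q t (incl G M N a) (incl G M N c) + (1/2) *\<^sub>R b (incl G M N a) (incl G M N c) = incl G M N (AH a c)"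
  by (simp add: Pi_form_def linear_add[OF S.incl_linear] linear_scale[OF S.incl_linear] linear_diff[OF S.incl_linear]
      linear_neg[OF S.incl_linear] S.incl_br \<tau>)

lemma subgroup_totally_geodesic:
  assumes D: "P.frame_conn (\<lambda>r s. Pi_form b l q t r s + (1/2) *\<^sub>R b r s) D"
  shows "totally_geodesic N M D (\<lambda>x. x)"
    and "S.H.P.frame_conn AH (induced_conn N M D (\<lambda>x. x))"
  by (rule S.frame_conn_induced[OF D incl_A])+

lemma subgroup_radiant:
  assumes D: "P.frame_conn (\<lambda>r s. Pi_form b l q t r s + (1/2) *\<^sub>R b r s) D"
  defines "E' \<equiv> linv_field (G\<lparr>carrier := H\<rparr>) N \<tau>"
  shows "left_invariant_radiant_structure (G\<lparr>carrier := H\<rparr>) N (induced_conn N M D (\<lambda>x. x)) E'"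
    and "conelike N (induced_conn N M D (\<lambda>x. x)) E'"
  unfolding E'_def
  using S.H.Pi_form_conn[OF subgroup_radiant_data(1) subgroup_totally_geodesic(2)[OF D]] complete_set_of_planes_imp_conelike
  by blast+

context
  assumes comm: "comm_group (G\<lparr>carrier := H\<rparr>)"
begin

lemma Pi_abelian_eq: "Pi_abelian k (incl G M N) \<tau> = Pi_form (br (G\<lparr>carrier := H\<rparr>) N) lH (\<lambda>a c. 0) \<tau>"
  by (intro ext) (simp add: Pi_abelian_def Pi_form_def Let_def \<tau> l_def h_def S.H.comm_group_br[OF comm])

lemma abelian_subgroup:
  assumes D': "determined_by (G\<lparr>carrier := H\<rparr>) N (Pi_abelian k (incl G M N) \<tau>) D'"
  defines "E' \<equiv> linv_field (G\<lparr>carrier := H\<rparr>) N \<tau>"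
  shows "left_invariant_radiant_structure (G\<lparr>carrier := H\<rparr>) N D' E'"
    and "conelike N D' E'"
    and "Ricci_flat N D'"
    and "P.frame_conn (\<lambda>r s. Pi_form b l q t r s + (1/2) *\<^sub>R b r s) D \<Longrightarrow>
      planelike_surface N D' E' S f \<longleftrightarrow> planelike_surface N (induced_conn N M D (\<lambda>x. x)) E' S f"
proof -
  note d = subgroup_radiant_data(2)
  let ?A = "\<lambda>a c. Pi_form (br (G\<lparr>carrier := H\<rparr>) N) lH (\<lambda>a c. 0) \<tau> a c + (1/2) *\<^sub>R br (G\<lparr>carrier := H\<rparr>) N a c"
  have D'': "S.H.P.frame_conn ?A D'"
    using D' S.H.determined_by_iff[OF S.H.Pi_bilinear[OF d]] by (simp add: Pi_abelian_eq)
  show "left_invariant_radiant_structure (G\<lparr>carrier := H\<rparr>) N D' E'" "conelike N D' E'"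
    unfolding E'_def
    using S.H.Pi_form_conn[OF d D''] complete_set_of_planes_imp_conelike by blast+
  show "Ricci_flat N D'"
    unfolding Ricci_flat_def
  proof (intro ballI allI)
    fix p u v assume p: "p \<in> points N"
    note l = S.H.radiant_dataD(1)[OF d]
    \<comment> \<open>The product \<open>?A\<close> is commutative and associative, with unit
      \<open>\<tau>\<close> and zero product on the kernel of \<open>lH\<close>; so the whole
      curvature vanishes before the trace is taken.\<close>
    have "?A z (?A x y) - ?A x (?A z y) - ?A (br (G\<lparr>carrier := H\<rparr>) N z x) y = 0" for x y z
      by (simp add: S.H.comm_group_br[OF comm] Pi_form_def linear_add[OF l] linear_diff[OF l] linear_scale[OF l] linear_neg[OF l]
          linear_0[OF l] S.H.radiant_dataD(2)[OF d] algebra_simps)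
    then show "Ricci N D' p u v = 0"
      by (simp only: S.H.P.frame_conn_Ricci[OF S.H.A_bilinear[OF d] D'' p S.H.br_bilinear]) (simp add: tr_def)
  qed
  show "planelike_surface N D' E' S f \<longleftrightarrow> planelike_surface N (induced_conn N M D (\<lambda>x. x)) E' S f"
    if D: "P.frame_conn (\<lambda>r s. Pi_form b l q t r s + (1/2) *\<^sub>R b r s) D"
    unfolding E'_def
    by (rule S.H.P.planelike_surface_transfer[OF D'' subgroup_totally_geodesic(2)[OF D], of qH]) (simp add: Pi_form_def)
qed

end

end

section \<open>Ricci tensor and conjugation on the whole group\<close>

lemma Pi_tensor_conn: "determined_by G M (Pi_tensor G M k t) D \<longleftrightarrow>
    P.frame_conn (\<lambda>r s. Pi_form b l q t r s + (1/2) *\<^sub>R b r s) D"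
  unfolding Pi_tensor_eq by (rule determined_by_iff[OF Pi_bilinear[OF radiant_data]])

context
  fixes D assumes D: "P.frame_conn (\<lambda>r s. Pi_form b l q t r s + (1/2) *\<^sub>R b r s) D"
begin

lemma Ricci_E:
  assumes "DIM('e) > 2" "p \<in> carrier G"
  shows "Ricci M D p (E r p) (E s p) = (2 * real DIM('e) + ell G M t) / 4 * l (b r s)"
  using P.frame_conn_Ricci[OF A_bilinear[OF radiant_data] D _ br_bilinear, of p] assms ricci_trace[OF assms(1)]
  by (simp add: points theta_E)

lemma Ricci_antisym:
  assumes "DIM('e) > 2" "p \<in> carrier G"
  shows "Ricci M D p u v = - Ricci M D p v u"
proof -
  have "l (b (\<theta> p u) (\<theta> p v)) = - l (b (\<theta> p v) (\<theta> p u))"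
    using br_antisym[of "\<theta> p u"] by (simp add: linear_neg[OF l_linear])
  then show ?thesis
    using Ricci_E[OF assms, of "\<theta> p u" "\<theta> p v"] Ricci_E[OF assms, of "\<theta> p v" "\<theta> p u"] assms(2)
    by (simp add: E_theta)
qed

lemma semisimple_not_Ricci_flat:
  assumes "DIM('e) > 2" and ss: "semisimple b"
  shows "\<not> Ricci_flat M D"
proof
  assume flat: "Ricci_flat M D"
  have t: "t \<in> span (range (\<lambda>(x, y). b x y))" using semisimple_perfect[OF br_bilinear ss] by simp
  \<comment> \<open>With \<open>ell t = 0\<close> the factor in the Ricci tensor becomes
    \<open>2 n / 4\<close>, which is not zero, so Ricci-flatness makes \<open>l\<close> vanish on
    all brackets and hence on \<open>t\<close>.\<close>
  have "ell G M t = 0" by (rule linear_eq_0_on_span[OF ell_linear _ t]) (auto simp: ell_br)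
  then have "l (b r s) = 0" for r s
    using Ricci_E[OF assms(1) one_closed, of r s] flat assms(1) by (simp add: Ricci_flat_def points)
  then have "l t = 0" by (intro linear_eq_0_on_span[OF l_linear _ t]) auto
  then show False by (simp add: l_t)
qed

context
  fixes g assumes g: "g \<in> carrier G" and kg: "\<And>r s. k (Ad G M g r) (Ad G M g s) = k r s"
begin

lemma pullback_conj_conn:
  defines "t' \<equiv> Ad G M (inv g) t"
  shows "k t' t' \<noteq> 0" "determined_by G M (Pi_tensor G M k t') (pullback_conn M (conj_by G g) D)"
proof -
  note Pi' = Pi_tensor_Ad[OF g kg]
  show t': "k t' t' \<noteq> 0" using Pi'(1) k_t by (simp add: t'_def)
  \<comment> \<open>The hypotheses hold for \<open>t'\<close> in place of \<open>t\<close>, so the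
    conjugated coefficients can be recognized as those of the tensor of \<open>t'\<close>.\<close>
  interpret I': invariant_lie_group G M k t'
    by unfold_locales (use k_sym k_inv t' in auto)
  have gi: "inv g \<in> carrier G" using g by simp
  have "(\<lambda>r s. Ad G M (inv g) (Pi_form b l q t (Ad G M g r) (Ad G M g s) + (1/2) *\<^sub>R b (Ad G M g r) (Ad G M g s)))
      = (\<lambda>r s. Pi_form b I'.l I'.q t' r s + (1/2) *\<^sub>R b r s)"
    unfolding I'.Pi_tensor_eq[symmetric] Pi'(2)[folded t'_def] Pi_tensor_eq
    by (simp add: linear_add[OF Ad_linear[OF gi]] linear_scale[OF Ad_linear[OF gi]] Ad_br[OF gi] Ad_inv[OF g])
  then show "determined_by G M (Pi_tensor G M k t') (pullback_conn M (conj_by G g) D)"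
    using frame_conn_pullback_conj[OF D g] by (simp add: I'.Pi_tensor_conn)
qed

lemma conj_automorphism:
  assumes "Ad G M g t = t"
  shows "automorphism M D (E t) (conj_by G g)"
  unfolding automorphism_def diffeomorphism_def
proof (intro conjI ballI conj_bij(1) conj_smooth conj_inv_smooth g)
  have "Ad G M (inv g) t = t" using Ad_inv(1)[OF g, of t] assms by simp
  then have "P.frame_conn (\<lambda>r s. Pi_form b l q t r s + (1/2) *\<^sub>R b r s) (pullback_conn M (conj_by G g) D)"
    using pullback_conj_conn(2) by (simp add: Pi_tensor_conn)
  then show "conn_eq M (pullback_conn M (conj_by G g) D) D" by (rule P.frame_conn_eq) (rule D)
  fix p assume p: "p \<in> points M"
  then have "conj_by G (inv g) p \<in> carrier G" "conj_by G g (conj_by G (inv g) p) = p"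
    using g by (simp_all add: points conj_conj) (simp_all add: conj_by_def)
  then show "push M (conj_by G g) (E t) p = E t p"
    using tmap_conj_E[OF g, of "conj_by G (inv g) p" t] assms by (simp add: push_def Let_def conj_bij(2)[OF g p])
qed

end

end

end

theorem theorem11p2:
  fixes G :: "'a monoid" and M :: "('a, 'e::euclidean_space) atlas"
    and k h :: "'e \<Rightarrow> 'e \<Rightarrow> real" and t :: 'e and n :: nat
  assumes "Lie_group G M" and "n = DIM('e)" and "n > 2"
    and "symmetric_form k" and "invariant_form G M k" and "k t t \<noteq> 0"
    and h: "h = normalized k t"
  shows "(\<exists>D. determined_by G M (Pi_tensor G M k t) D) \<and>
    (\<forall>D. determined_by G M (Pi_tensor G M k t) D \<longrightarrow>
      left_invariant_radiant_structure G M D (linv_field G M t) \<and>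
      conelike M D (linv_field G M t) \<and>
      (\<forall>p\<in>carrier G. \<forall>u v. Ricci M D p u v = - Ricci M D p v u) \<and>
      (\<forall>p\<in>carrier G. \<forall>r s. Ricci M D p (linv_field G M r p) (linv_field G M s p) =
         (2 * real n + ell G M t) / 4 * h t (br G M r s)) \<and>
      (\<forall>p\<in>carrier G. \<forall>a. Ricci M D p (linv_field G M t p) (linv_field G M a p) = 0) \<and>
      \<comment> \<open>(1)\<close>
      (\<forall>g\<in>carrier G.
         g \<in> connected_component_of_set (mtop M) \<one>\<^bsub>G\<^esub> \<or>
         (\<forall>r s. k (Ad G M g r) (Ad G M g s) = k r s) \<longrightarrow>
         (let t' = Ad G M (inv\<^bsub>G\<^esub> g) t in
            k t' t' \<noteq> 0 \<and>
            determined_by G M (Pi_tensor G M k t') (pullback_conn M (conj_by G g) D)) \<and>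
         (Ad G M g t = t \<longrightarrow> automorphism M D (linv_field G M t) (conj_by G g))) \<and>
      \<comment> \<open>(2)\<close>
      complete_set_of_planes M D (linv_field G M t) \<and>
      \<comment> \<open>(3)\<close>
      (semisimple (br G M) \<longrightarrow> \<not> Ricci_flat M D) \<and>
      \<comment> \<open>(4)\<close>
      (\<forall>H (N :: ('a, 'f::euclidean_space) atlas) \<tau>.
         Lie_subgroup G M H N \<and> incl G M N \<tau> = t \<longrightarrow>
         totally_geodesic N M D (\<lambda>x. x) \<and>
         left_invariant_radiant_structure (G\<lparr>carrier := H\<rparr>) N
           (induced_conn N M D (\<lambda>x. x)) (linv_field (G\<lparr>carrier := H\<rparr>) N \<tau>) \<and>
         conelike N (induced_conn N M D (\<lambda>x. x)) (linv_field (G\<lparr>carrier := H\<rparr>) N \<tau>)) \<and>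
      \<comment> \<open>(5)\<close>
      (\<forall>H (N :: ('a, 'f) atlas) \<tau>.
         Lie_subgroup G M H N \<and> incl G M N \<tau> = t \<and> comm_group (G\<lparr>carrier := H\<rparr>) \<and> DIM('f) \<ge> 3 \<longrightarrow>
         (\<exists>D'. determined_by (G\<lparr>carrier := H\<rparr>) N (Pi_abelian k (incl G M N) \<tau>) D') \<and>
         (\<forall>D'. determined_by (G\<lparr>carrier := H\<rparr>) N (Pi_abelian k (incl G M N) \<tau>) D' \<longrightarrow>
            left_invariant_radiant_structure (G\<lparr>carrier := H\<rparr>) N D'
              (linv_field (G\<lparr>carrier := H\<rparr>) N \<tau>) \<and>
            conelike N D' (linv_field (G\<lparr>carrier := H\<rparr>) N \<tau>) \<and>
            Ricci_flat N D' \<and>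
            (\<forall>S f. planelike_surface N D' (linv_field (G\<lparr>carrier := H\<rparr>) N \<tau>) S f \<longleftrightarrow>
               planelike_surface N (induced_conn N M D (\<lambda>x. x))
                 (linv_field (G\<lparr>carrier := H\<rparr>) N \<tau>) S f))))"
proof -
  interpret invariant_lie_group G M k t
    by unfold_locales (use assms in auto)
  note n = \<open>n = DIM('e)\<close> and n2 = \<open>n > 2\<close>[unfolded \<open>n = DIM('e)\<close>]
  have ht: "h t = l" by (simp add: l_def h_def \<open>h = normalized k t\<close>)
  show ?thesis
  proof (intro conjI allI impI)
    show "\<exists>D. determined_by G M (Pi_tensor G M k t) D"
      unfolding Pi_tensor_eq by (rule determined_by_exists[OF Pi_bilinear[OF radiant_data]])
    fix D assume "determined_by G M (Pi_tensor G M k t) D"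
    then have D: "P.frame_conn (\<lambda>r s. Pi_form b l q t r s + (1/2) *\<^sub>R b r s) D" by (simp add: Pi_tensor_conn)
    show "left_invariant_radiant_structure G M D (E t)" and planes: "complete_set_of_planes M D (E t)"
      by (rule Pi_form_conn[OF radiant_data D])+
    show "conelike M D (E t)" by (rule complete_set_of_planes_imp_conelike[OF planes])
    show "\<forall>p\<in>carrier G. \<forall>u v. Ricci M D p u v = - Ricci M D p v u"
      using Ricci_antisym[OF D n2] by blast
    show "\<forall>p\<in>carrier G. \<forall>r s. Ricci M D p (E r p) (E s p) = (2 * real n + ell G M t) / 4 * h t (b r s)"
      using Ricci_E[OF D n2] by (simp add: ht n)
    \<comment> \<open>This is \<open>\<varrho> = 0\<close>: the values are multiples of
      \<open>l\<close> on the image of \<open>b t\<close>.\<close>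
    show "\<forall>p\<in>carrier G. \<forall>a. Ricci M D p (E t p) (E a p) = 0"
      using Ricci_E[OF D n2, of _ t] by (simp add: l_br_t)
    show "\<not> Ricci_flat M D" if "semisimple b"
      by (rule semisimple_not_Ricci_flat[OF D n2 that])
    show "\<forall>g\<in>carrier G. g \<in> connected_component_of_set (mtop M) \<one>\<^bsub>G\<^esub> \<or> (\<forall>r s. k (Ad G M g r) (Ad G M g s) = k r s) \<longrightarrow>
         (let t' = Ad G M (inv\<^bsub>G\<^esub> g) t in
            k t' t' \<noteq> 0 \<and> determined_by G M (Pi_tensor G M k t') (pullback_conn M (conj_by G g) D)) \<and>
         (Ad G M g t = t \<longrightarrow> automorphism M D (E t) (conj_by G g))"
    proof (intro ballI impI)
      fix g assume g: "g \<in> carrier G"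
        and "g \<in> connected_component_of_set (mtop M) \<one>\<^bsub>G\<^esub> \<or> (\<forall>r s. k (Ad G M g r) (Ad G M g s) = k r s)"
      \<comment> \<open>In the first alternative the invariance of \<open>k\<close> is integrated
        along the identity component; from here on both alternatives are the same.\<close>
      then have kg: "k (Ad G M g r) (Ad G M g s) = k r s" for r s
        using invariant_form_Ad[OF k_sym k_inv] by blast
      show "(let t' = Ad G M (inv\<^bsub>G\<^esub> g) t in
            k t' t' \<noteq> 0 \<and> determined_by G M (Pi_tensor G M k t') (pullback_conn M (conj_by G g) D)) \<and>
         (Ad G M g t = t \<longrightarrow> automorphism M D (E t) (conj_by G g))"
        using pullback_conj_conn[OF D g kg] conj_automorphism[OF D g kg] by (simp add: Let_def)
    qed
  next
    fix D H and N :: "('a, 'f) atlas" and \<tau>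
    assume "determined_by G M (Pi_tensor G M k t) D"
    then have D: "P.frame_conn (\<lambda>r s. Pi_form b l q t r s + (1/2) *\<^sub>R b r s) D" by (simp add: Pi_tensor_conn)
    assume "Lie_subgroup G M H N \<and> incl G M N \<tau> = t"
    then have H: "Lie_subgroup G M H N" "incl G M N \<tau> = t" by auto
    show "totally_geodesic N M D (\<lambda>x. x)" by (rule subgroup_totally_geodesic(1)[OF H D])
    show "left_invariant_radiant_structure (G\<lparr>carrier := H\<rparr>) N (induced_conn N M D (\<lambda>x. x)) (linv_field (G\<lparr>carrier := H\<rparr>) N \<tau>)"
      "conelike N (induced_conn N M D (\<lambda>x. x)) (linv_field (G\<lparr>carrier := H\<rparr>) N \<tau>)"
      by (rule subgroup_radiant[OF H D])+
  next
    fix D H and N :: "('a, 'f) atlas" and \<tau>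
    assume "determined_by G M (Pi_tensor G M k t) D"
    then have D: "P.frame_conn (\<lambda>r s. Pi_form b l q t r s + (1/2) *\<^sub>R b r s) D" by (simp add: Pi_tensor_conn)
    assume "Lie_subgroup G M H N \<and> incl G M N \<tau> = t \<and> comm_group (G\<lparr>carrier := H\<rparr>) \<and> 3 \<le> DIM('f)"
    then have H: "Lie_subgroup G M H N" "incl G M N \<tau> = t" and comm: "comm_group (G\<lparr>carrier := H\<rparr>)" by auto
    interpret S: lie_subgroup G M H N by unfold_locales (rule H(1))
    show "\<exists>D'. determined_by (G\<lparr>carrier := H\<rparr>) N (Pi_abelian k (incl G M N) \<tau>) D'"
      unfolding Pi_abelian_eq[OF H comm]
      by (rule S.H.determined_by_exists[OF S.H.Pi_bilinear[OF subgroup_radiant_data(2)[OF H]]])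
    fix D' assume D': "determined_by (G\<lparr>carrier := H\<rparr>) N (Pi_abelian k (incl G M N) \<tau>) D'"
    show "left_invariant_radiant_structure (G\<lparr>carrier := H\<rparr>) N D' (linv_field (G\<lparr>carrier := H\<rparr>) N \<tau>)"
      "conelike N D' (linv_field (G\<lparr>carrier := H\<rparr>) N \<tau>)" "Ricci_flat N D'"
      by (rule abelian_subgroup[OF H comm D'])+
    show "planelike_surface N D' (linv_field (G\<lparr>carrier := H\<rparr>) N \<tau>) S f \<longleftrightarrow>
        planelike_surface N (induced_conn N M D (\<lambda>x. x)) (linv_field (G\<lparr>carrier := H\<rparr>) N \<tau>) S f" for S f
      by (rule abelian_subgroup(4)[OF H comm D' D])
  qed
qed

end
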